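(* Let $n\in\mathbb{N}$ and $z_0\in\mathbb{C}^n$. Given $0<r,s<1$, $\delta>0$ and a holomorphic automorphism $f_1\colon\mathbb{C}^n\to\mathbb{C}^n$, there exists a number $q\in\mathbb{N}$ such that the following holds. For any sequence of holomorphic automorphisms $f_j\colon\mathbb{C}^n\to\mathbb{C}^n$, $j\in\mathbb{N}$ (whose first member is the given $f_1$), fixing $z_0$, with $$s\|z-z_0\|<\|f_j(z)-z_0\|<r\|z-z_0\|\quad\text{for all } j\in\mathbb{N} \text{ and all } z \text{ with } 0<\|z-z_0\|<\delta,$$ and with $$\frac{\partial^{|\alpha|}f_1}{\partial z^\alpha}(z_0)=\frac{\partial^{|\alpha|}f_j}{\partial z^\alpha}(z_0)\quad\text{for all } j\in\mathbb{N} \text{ and all multi-indices }\alpha\in\mathbb{N}_0^n\text{ with }1\le|\alpha|\le q-1,$$ the basin of attraction $$\Omega^{z_0}_{f_j}=\{z\in\mathbb{C}^n : \lim_{j\to\infty}f_j\circ f_{j-1}\circ\dots\circ f_1(z)=z_0\}$$ is biholomorphic to $\mathbb{C}^n$. Moreover, let $p\in\mathbb{N}$ be such that $r^p<s$. Then $q$ can be estimated as follows: (1) If each of the derivatives $\mathrm{d}_{z_0}f_j$, $j\in\mathbb{N}$, is normal (i.e. for the class of sequences of holomorphic automorphisms $f_j\colon\mathbb{C}^n\to\mathbb{C}^n$, $j\in\mathbb{N}$, with first member $f_1$, fixing $z_0$, satisfying $s\|z-z_0\|<\|f_j(z)-z_0\|<r\|z-z_0\|$ for all $j\in\mathbb{N}$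 and all $z$ with $0<\|z-z_0\|<\delta$, satisfying $\frac{\partial^{|\alpha|}f_1}{\partial z^\alpha}(z_0)=\frac{\partial^{|\alpha|}f_j}{\partial z^\alpha}(z_0)$ for all $j\in\mathbb{N}$ and all $\alpha\in\mathbb{N}_0^n$ with $1\le|\alpha|\le q-1$, and having the additional property that each $\mathrm{d}_{z_0}f_j$ is normal), then $q$ can be chosen, independently of $f_1$, such that $$q\le\frac{\ln\left(\sum_{i=1}^{(p-1)^{(n-1)^2}}Q(i)\left(\frac{n!}{s^n}\left(1+r\sum_{m=2}^{p-1}n^2Q(m)^2\left(\frac{\sqrt n}{\min\{1,\delta\}}\right)^m\right)^{n-1}\right)^i\right)}{\ln\frac1r}+1.$$ (2) If $n=2$ and each of the derivatives $\mathrm{d}_{z_0}f_j$, $j\in\mathbb{N}$, is normal, then $q$ can be chosen, independently of $f_1$, such that $$q\le\frac{\ln\left(\sum_{i=1}^{p-1}(i+1)\left(\frac{2}{s^2}\left(1+2rp\left(\frac{\sqrt2}{\min\{1,\delta\}}\right)^{p-1}\right)\right)^i\right)}{\ln\frac1r}+1,$$ and the right-hand side is in $O(p^2)$ (as a function of $p$).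
   Context: $\mathbb{N}=\{1,2,\dots\}$, $\mathbb{N}_0=\mathbb{N}\cup\{0\}$. $\|\cdot\|$ is the Euclidean norm on $\mathbb{C}^n$. A holomorphic automorphism of $\mathbb{C}^n$ is a biholomorphic map $\mathbb{C}^n\to\mathbb{C}^n$. $\mathrm{d}_{z_0}f$ denotes the complex differential (Jacobian matrix) of $f$ at $z_0$; it is normal if it commutes with its adjoint. $Q(m)$ denotes the number of multi-indices in $n$ variables of order $m$, i.e. the number of $\alpha\in\mathbb{N}_0^n$ with $|\alpha|=m$. *)

theory Defs
  imports "HOL-Analysis.Analysis" "HOL-Library.Landau_Symbols"
begin

text \<open>
  The space of \<open>n\<close> complex variables is \<open>complex ^ 'n\<close> with \<open>n = CARD('n)\<close>; the library norm on
  this type is the Euclidean one.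
\<close>

text \<open>
  Several-variable analogue of \<^const>\<open>holomorphic_on\<close>: the real Frechet derivative
  exists and is complex linear, i.e. given by a complex matrix.
\<close>

definition holomorphic_map_on :: "(complex ^ 'n \<Rightarrow> complex ^ 'm) \<Rightarrow> (complex ^ 'n) set \<Rightarrow> bool"
  where "holomorphic_map_on f S \<longleftrightarrow>
    (\<forall>z\<in>S. \<exists>A :: complex ^ 'n ^ 'm. (f has_derivative (\<lambda>h. A *v h)) (at z within S))"

definition biholomorphic_map ::
  "(complex ^ 'n \<Rightarrow> complex ^ 'm) \<Rightarrow> (complex ^ 'n) set \<Rightarrow> (complex ^ 'm) set \<Rightarrow> bool"
  where "biholomorphic_map f S T \<longleftrightarrow>
    open S \<and> open T \<and> bij_betw f S T \<and>
    holomorphic_map_on f S \<and> holomorphic_map_on (inv_into S f) T"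

definition biholomorphic :: "(complex ^ 'n) set \<Rightarrow> (complex ^ 'm) set \<Rightarrow> bool"
  where "biholomorphic S T \<longleftrightarrow> (\<exists>f. biholomorphic_map f S T)"

definition holomorphic_automorphism :: "(complex ^ 'n \<Rightarrow> complex ^ 'n) \<Rightarrow> bool"
  where "holomorphic_automorphism f \<longleftrightarrow> biholomorphic_map f UNIV UNIV"

text \<open>
  The matrix of the Frechet derivative with respect to the complex standard basis; this is the
  complex Jacobian whenever the derivative is complex linear.
\<close>

definition complex_jacobian ::
  "(complex ^ 'n \<Rightarrow> complex ^ 'm) \<Rightarrow> complex ^ 'n \<Rightarrow> complex ^ 'n ^ 'm"
  where "complex_jacobian f z = matrix (frechet_derivative f (at z))"

definition conj_transpose :: "complex ^ 'n ^ 'm \<Rightarrow> complex ^ 'm ^ 'n"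
  where "conj_transpose A = (\<chi> i j. cnj (A $ j $ i))"

definition normal_matrix :: "complex ^ 'n ^ 'n \<Rightarrow> bool"
  where "normal_matrix A \<longleftrightarrow> A ** conj_transpose A = conj_transpose A ** A"

definition complex_partial ::
  "'n \<Rightarrow> (complex ^ 'n \<Rightarrow> complex ^ 'm) \<Rightarrow> complex ^ 'n \<Rightarrow> complex ^ 'm"
  where "complex_partial i f z = (\<chi> k. deriv (\<lambda>t. f (z + axis i t) $ k) 0)"

text \<open>
  A multi-index is a function \<open>\<alpha> :: 'n \<Rightarrow> nat\<close>. The index type carries no order, so the iterated
  derivative takes the variables in some fixed enumeration; for holomorphic maps the
  result does not depend on it.
\<close>

definition multi_partial ::
  "('n \<Rightarrow> nat) \<Rightarrow> (complex ^ 'n \<Rightarrow> complex ^ 'm) \<Rightarrow> complex ^ 'n \<Rightarrow> complex ^ 'm"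
  where "multi_partial \<alpha> f =
    foldr (\<lambda>i. complex_partial i ^^ \<alpha> i) (SOME is. distinct is \<and> set is = UNIV) f"

definition multi_order :: "('n::finite \<Rightarrow> nat) \<Rightarrow> nat"
  where "multi_order \<alpha> = (\<Sum>i\<in>UNIV. \<alpha> i)"

definition multi_index_count :: "'n::finite itself \<Rightarrow> nat \<Rightarrow> nat"
  where "multi_index_count _ m = card {\<alpha> :: 'n \<Rightarrow> nat. multi_order \<alpha> = m}"

text \<open>
  Sequences of maps are indexed from 1, so that the value at 0 is irrelevant, and
  \<open>forward_comp f j = f j \<circ> \<dots> \<circ> f 1\<close>.
\<close>

primrec forward_comp :: "(nat \<Rightarrow> 'a \<Rightarrow> 'a) \<Rightarrow> nat \<Rightarrow> 'a \<Rightarrow> 'a"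
  where
    "forward_comp f 0 = id"
  | "forward_comp f (Suc j) = f (Suc j) \<circ> forward_comp f j"

definition basin_of_attraction ::
  "(nat \<Rightarrow> complex ^ 'n \<Rightarrow> complex ^ 'n) \<Rightarrow> complex ^ 'n \<Rightarrow> (complex ^ 'n) set"
  where "basin_of_attraction f z0 = {z. (\<lambda>j. forward_comp f j z) \<longlonglongrightarrow> z0}"

definition admissible_sequence ::
  "complex ^ 'n \<Rightarrow> real \<Rightarrow> real \<Rightarrow> real \<Rightarrow> nat \<Rightarrow> (nat \<Rightarrow> complex ^ 'n \<Rightarrow> complex ^ 'n) \<Rightarrow> bool"
  where "admissible_sequence z0 r s \<delta> q f \<longleftrightarrow>
    (\<forall>j\<ge>1. holomorphic_automorphism (f j) \<and> f j z0 = z0) \<and>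
    (\<forall>j\<ge>1. \<forall>z. 0 < norm (z - z0) \<and> norm (z - z0) < \<delta> \<longrightarrow>
      s * norm (z - z0) < norm (f j z - z0) \<and> norm (f j z - z0) < r * norm (z - z0)) \<and>
    (\<forall>j\<ge>1. \<forall>\<alpha>. 1 \<le> multi_order \<alpha> \<and> multi_order \<alpha> \<le> q - 1 \<longrightarrow>
      multi_partial \<alpha> (f 1) z0 = multi_partial \<alpha> (f j) z0)"

text \<open>
  The two bounds below are meant for \<open>0 < r, s < 1\<close> and \<open>r ^ p < s\<close>. For \<open>p = 1\<close> the outer sum can be
  empty, and \<^term>\<open>ln (0::real) = 0\<close> then makes the bound 1; this is harmless because \<open>r < s\<close>
  leaves no admissible sequence.
\<close>

definition normal_bound :: "'n::finite itself \<Rightarrow> real \<Rightarrow> real \<Rightarrow> real \<Rightarrow> nat \<Rightarrow> real"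
  where "normal_bound N r s \<delta> p =
    (let n = CARD('n); Q = (\<lambda>m. real (multi_index_count N m)) in
      ln (\<Sum>i = 1..(p - 1) ^ ((n - 1)\<^sup>2).
        Q i *
        (fact n / s ^ n *
          (1 + r * (\<Sum>m = 2..p - 1. (real n)\<^sup>2 * (Q m)\<^sup>2 * (sqrt (real n) / min 1 \<delta>) ^ m)) ^ (n - 1)) ^ i)
      / ln (1 / r) + 1)"

definition normal_bound_dim2 :: "real \<Rightarrow> real \<Rightarrow> real \<Rightarrow> nat \<Rightarrow> real"
  where "normal_bound_dim2 r s \<delta> p =
    ln (\<Sum>i = 1..p - 1.
      (real i + 1) * (2 / s\<^sup>2 * (1 + 2 * r * real p * (sqrt 2 / min 1 \<delta>) ^ (p - 1))) ^ i)
    / ln (1 / r) + 1"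

end

theory Submission
  imports Defs "HOL-Complex_Analysis.Cauchy_Integral_Formula" "HOL-Computational_Algebra.Fundamental_Theorem_Algebra"
begin

text \<open>
  Let \<open>q\<close> be the least exponent with \<open>r ^ q < s\<close>. The theorem holds with this \<open>q\<close>, whatever \<open>f\<^sub>1\<close> is, for the
  following reason. If \<open>q = 1\<close>, then \<open>r < s\<close> and no sequence satisfies the hypotheses; so let \<open>q \<ge> 2\<close>.

  The linear part \<open>A\<close> of \<open>f\<^sub>1\<close> at the fixed point (moved to the origin) satisfies \<open>s |v| \<le> |A v| \<le> r |v|\<close>.
  By the Poincare-Dulac method \<open>f\<^sub>1\<close> is conjugate, up to any prescribed order \<open>m\<close>, to a triangular automorphism \<open>G\<close>
  with linear part \<open>A\<close>: there is a change of coordinates \<open>X\<close>, tangent to the identity, with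
  \<open>X \<circ> f\<^sub>1 = G \<circ> X + O(|z| ^ m)\<close> (\<open>attracting_model\<close>). Every orbit of the triangular map \<open>G\<close> tends to the origin, so
  the basin of \<open>G\<close> is the whole space. By hypothesis the \<open>f\<^sub>j\<close> agree with \<open>f\<^sub>1\<close> to order \<open>q\<close>, and Cauchy's
  estimates make this uniform in \<open>j\<close> (\<open>vanishing_partials_bound\<close>); with \<open>m = q\<close> this gives
  \<open>X \<circ> f\<^sub>j = G \<circ> X + O(|z| ^ q)\<close>, uniformly in \<open>j\<close>.

  Now consider the maps \<open>G ^ (-k) \<circ> X \<circ> f\<^sub>k \<circ> \<dots> \<circ> f\<^sub>1\<close>. The step from \<open>k\<close> to \<open>k + 1\<close> introduces an error of order \<open>q\<close> at a
  point of size \<open>r ^ k\<close>, and pulling it back by \<open>G ^ (-k)\<close> multiplies it by at most \<open>L ^ k\<close>, where the Lipschitz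
  constant \<open>L\<close> of the inverse of \<open>G\<close> near the origin can be taken as close to \<open>1 / s\<close> as desired. Since \<open>r ^ q < s\<close>, it can
  be chosen with \<open>L r ^ q < 1\<close>, the errors are summable and the maps converge near the origin to a
  biholomorphic map \<open>\<Phi>\<close>. It conjugates the sequence to \<open>G\<close> in the sense that \<open>G \<circ> \<Phi>\<close> is the limit map of the shifted
  sequence composed with \<open>f\<^sub>1\<close>, so it extends along the dynamics to a biholomorphic map from the basin of the sequence
  onto the basin of \<open>G\<close> (locale \<open>near_conjugacy\<close>).

  The triangular normal form is not obtained from resonances of monomials but from a basis in which \<open>A\<close> is
  triangular, almost diagonal, and has its eigenvalues almost sorted by modulus (\<open>graded_triangularization\<close>). Then the
  homological equation has an explicit solution by a convergent series (\<open>solve_component\<close>), and no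
  polynomials in several variables occur.

  Finally, \<open>r ^ (q - 1) \<ge> s\<close> for \<open>q \<ge> 2\<close>, which gives \<open>q \<le> ln (1 / s) / ln (1 / r) + 1\<close>, and the sums
  inside the two logarithms are at least \<open>1 / s\<close> because their first terms are. For \<open>q = 1\<close> it suffices that both bounds are at least \<open>1\<close>.
\<close>

section \<open>Holomorphic maps of several variables\<close>

abbreviation entire :: "(complex^'n \<Rightarrow> complex^'m) \<Rightarrow> bool"
  where "entire f \<equiv> holomorphic_map_on f UNIV"

lemma norm_vector_scalar_mult: "norm (c *s v) = cmod c * norm v" for v :: "complex^'n"
proof -
  have "(\<Sum>i\<in>UNIV. (cmod (c * v$i))\<^sup>2) = (cmod c)\<^sup>2 * (\<Sum>i\<in>UNIV. (cmod (v$i))\<^sup>2)"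
    by (simp add: norm_mult power_mult_distrib sum_distrib_left)
  then show ?thesis
    by (simp add: norm_vec_def L2_set_def real_sqrt_mult)
qed

lemma norm_le_sum_components: "norm v \<le> (\<Sum>i\<in>UNIV. norm (v$i))" for v :: "'a::real_normed_vector^'n"
  by (simp add: norm_vec_def L2_set_le_sum)

lemma norm_matrix_vector_mult_le:
  fixes A :: "complex^'n^'m"
  shows "norm (A *v v) \<le> (\<Sum>i\<in>UNIV. \<Sum>j\<in>UNIV. cmod (A$i$j)) * norm v"
proof -
  have comp: "cmod ((A *v v)$i) \<le> (\<Sum>j\<in>UNIV. cmod (A$i$j) * norm v)" for i
    unfolding matrix_vector_mult_def
    by (auto intro!: order_trans[OF norm_sum] sum_mono mult_left_mono Finite_Cartesian_Product.norm_nth_le simp: norm_mult)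
  have "norm (A *v v) \<le> (\<Sum>i\<in>UNIV. norm ((A *v v)$i))"
    by (rule norm_le_sum_components)
  also have "\<dots> \<le> (\<Sum>i\<in>UNIV. \<Sum>j\<in>UNIV. cmod (A$i$j) * norm v)"
    by (intro sum_mono comp)
  also have "\<dots> = (\<Sum>i\<in>UNIV. \<Sum>j\<in>UNIV. cmod (A$i$j)) * norm v"
    by (simp add: sum_distrib_right)
  finally show ?thesis .
qed

lemma has_derivative_complex_jacobian:
  assumes "(f has_derivative (\<lambda>h. A *v h)) (at z)"
  shows "complex_jacobian f z = A"
  unfolding complex_jacobian_def frechet_derivative_at[OF assms, symmetric] by simp

lemma holomorphic_map_has_derivative:
  assumes "holomorphic_map_on f S" "open S" "z \<in> S"
  shows "(f has_derivative (\<lambda>h. complex_jacobian f z *v h)) (at z)"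
proof -
  obtain A where "(f has_derivative (\<lambda>h. A *v h)) (at z within S)"
    using assms by (auto simp: holomorphic_map_on_def)
  then have A: "(f has_derivative (\<lambda>h. A *v h)) (at z)"
    using assms by (metis at_within_open)
  then show ?thesis using has_derivative_complex_jacobian[OF A] by simp
qed

lemma holomorphic_map_onI:
  assumes "\<And>z. z \<in> S \<Longrightarrow> \<exists>A. (f has_derivative (\<lambda>h. A *v h)) (at z)"
  shows "holomorphic_map_on f S"
  using assms has_derivative_at_withinI unfolding holomorphic_map_on_def by blast

lemma holomorphic_map_subset:
  "holomorphic_map_on f S \<Longrightarrow> T \<subseteq> S \<Longrightarrow> holomorphic_map_on f T"
  unfolding holomorphic_map_on_def by (meson has_derivative_subset subsetD)

lemma holomorphic_map_continuous:
  assumes "holomorphic_map_on f S" shows "continuous_on S f"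
  using assms unfolding holomorphic_map_on_def continuous_on_eq_continuous_within
  by (meson has_derivative_continuous)

lemma holomorphic_map_matrix [simp]: "holomorphic_map_on (\<lambda>z. A *v z) S"
  unfolding holomorphic_map_on_def
  by (intro ballI exI) (rule bounded_linear.has_derivative[OF matrix_vector_mul_bounded_linear has_derivative_ident])

lemma holomorphic_map_id [simp]: "holomorphic_map_on (\<lambda>z. z) S"
  using holomorphic_map_matrix[of "mat 1" S] by simp

lemma holomorphic_map_const [simp]: "holomorphic_map_on (\<lambda>z. c) S"
  unfolding holomorphic_map_on_def
  by (intro ballI exI[of _ 0] has_derivative_eq_rhs[OF has_derivative_const]) (simp add: fun_eq_iff)

lemma holomorphic_map_add:
  assumes "holomorphic_map_on f S" "holomorphic_map_on g S"
  shows "holomorphic_map_on (\<lambda>z. f z + g z) S"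
  unfolding holomorphic_map_on_def
proof
  fix z assume z: "z \<in> S"
  obtain A B where "(f has_derivative (\<lambda>h. A *v h)) (at z within S)" "(g has_derivative (\<lambda>h. B *v h)) (at z within S)"
    using assms z unfolding holomorphic_map_on_def by blast
  from has_derivative_add[OF this]
  have "((\<lambda>z. f z + g z) has_derivative (\<lambda>h. (A + B) *v h)) (at z within S)"
    by (simp add: matrix_vector_mult_add_rdistrib)
  then show "\<exists>A. ((\<lambda>z. f z + g z) has_derivative (\<lambda>h. A *v h)) (at z within S)" by blast
qed

lemma holomorphic_map_diff:
  assumes "holomorphic_map_on f S" "holomorphic_map_on g S"
  shows "holomorphic_map_on (\<lambda>z. f z - g z) S"
  unfolding holomorphic_map_on_def
proof
  fix z assume z: "z \<in> S"
  obtain A B where "(f has_derivative (\<lambda>h. A *v h)) (at z within S)" "(g has_derivative (\<lambda>h. B *v h)) (at z within S)"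
    using assms z unfolding holomorphic_map_on_def by blast
  from has_derivative_diff[OF this]
  have "((\<lambda>z. f z - g z) has_derivative (\<lambda>h. (A - B) *v h)) (at z within S)"
    by (simp add: matrix_vector_mult_diff_rdistrib)
  then show "\<exists>A. ((\<lambda>z. f z - g z) has_derivative (\<lambda>h. A *v h)) (at z within S)" by blast
qed

lemma holomorphic_map_compose:
  assumes "holomorphic_map_on f S" "holomorphic_map_on g T" "f ` S \<subseteq> T"
  shows "holomorphic_map_on (\<lambda>z. g (f z)) S"
  unfolding holomorphic_map_on_def
proof
  fix z assume z: "z \<in> S"
  obtain A where A: "(f has_derivative (\<lambda>h. A *v h)) (at z within S)"
    using assms z by (auto simp: holomorphic_map_on_def)
  obtain B where "(g has_derivative (\<lambda>h. B *v h)) (at (f z) within T)"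
    using assms(2,3) z unfolding holomorphic_map_on_def by blast
  then have "(g has_derivative (\<lambda>h. B *v h)) (at (f z) within f ` S)"
    using assms(3) has_derivative_subset by blast
  from diff_chain_within[OF A this]
  have "((\<lambda>z. g (f z)) has_derivative (\<lambda>h. (B ** A) *v h)) (at z within S)"
    by (simp add: o_def matrix_vector_mul_assoc)
  then show "\<exists>A. ((\<lambda>z. g (f z)) has_derivative (\<lambda>h. A *v h)) (at z within S)" by blast
qed

lemma holomorphic_map_cmul:
  assumes "holomorphic_map_on f S" shows "holomorphic_map_on (\<lambda>z. c *s f z) S"
proof -
  have "(\<lambda>z. c *s f z) = (\<lambda>z. mat c *v f z)"
    by (auto simp: fun_eq_iff vec_eq_iff matrix_vector_mult_def mat_def if_distrib [of "\<lambda>x. x * _"] cong: if_cong)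
  then show ?thesis
    using holomorphic_map_compose[OF assms, of "\<lambda>z. mat c *v z" UNIV] by simp
qed

lemma holomorphic_map_components:
  fixes U :: "'m::finite \<Rightarrow> complex^'n \<Rightarrow> complex^'k" and k :: "'m \<Rightarrow> 'k"
  assumes "\<And>i. holomorphic_map_on (U i) S"
  shows "holomorphic_map_on (\<lambda>z. \<chi> i. U i z $ k i) S"
  unfolding holomorphic_map_on_def
proof
  fix z assume z: "z \<in> S"
  have "\<forall>i. \<exists>A. (U i has_derivative (\<lambda>h. A *v h)) (at z within S)"
    using assms z by (auto simp: holomorphic_map_on_def)
  then obtain A where A: "\<And>i. (U i has_derivative (\<lambda>h. A i *v h)) (at z within S)" by metis
  have "((\<lambda>z. \<chi> i. U i z $ k i) has_derivative (\<lambda>h. (\<chi> i. A i $ k i) *v h)) (at z within S)"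
    unfolding has_derivative_componentwise_within[of "\<lambda>z. \<chi> i. U i z $ k i"]
  proof
    fix b :: "complex^'m" assume "b \<in> Basis"
    then obtain j u where b: "b = axis j u" unfolding Basis_vec_def by auto
    have "((\<lambda>z. U j z $ k j) has_derivative (\<lambda>h. (A j *v h) $ k j)) (at z within S)"
      by (rule bounded_linear.has_derivative[OF bounded_linear_vec_nth A])
    then have "((\<lambda>z. U j z $ k j \<bullet> u) has_derivative (\<lambda>h. (A j *v h) $ k j \<bullet> u)) (at z within S)"
      by (rule has_derivative_inner_left)
    then show "((\<lambda>x. (\<chi> i. U i x $ k i) \<bullet> b) has_derivative (\<lambda>x. ((\<chi> i. A i $ k i) *v x) \<bullet> b)) (at z within S)"
      by (simp add: b inner_axis matrix_vector_mult_def)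
  qed
  then show "\<exists>A. ((\<lambda>z. \<chi> i. U i z $ k i) has_derivative (\<lambda>h. A *v h)) (at z within S)" by blast
qed

lemma vec_has_derivative_line: 
  "((\<lambda>t. z + t *s v) has_derivative (\<lambda>t. t *s v)) (at t within S)" for v :: "complex^'n"
proof -
  have "bounded_linear (\<lambda>t. t *s v)"
    by (rule bounded_linear_intro[of _ "norm v"])
       (auto simp: vector_sadd_rdistrib norm_vector_scalar_mult vec_eq_iff)
  from bounded_linear.has_derivative[OF this has_derivative_ident]
  have "((\<lambda>t. t *s v) has_derivative (\<lambda>t. t *s v)) (at t within S)" .
  from has_derivative_add[OF has_derivative_const this, of z] show ?thesis by simp
qed

lemma has_field_derivative_along_line:
  fixes f :: "complex^'n \<Rightarrow> complex^'m"
  assumes "(f has_derivative (\<lambda>h. A *v h)) (at (z + t *s v))"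
  shows "((\<lambda>t. f (z + t *s v) $ k) has_field_derivative (A *v v) $ k) (at t)"
proof -
  have "((\<lambda>t. f (z + t *s v)) has_derivative (\<lambda>h. A *v (h *s v))) (at t)"
    using diff_chain_at[OF vec_has_derivative_line[of z v t UNIV] assms] by (simp add: o_def)
  from bounded_linear.has_derivative[OF bounded_linear_vec_nth this, of k]
  have "((\<lambda>t. f (z + t *s v) $ k) has_derivative (\<lambda>h. (A *v (h *s v)) $ k)) (at t)" .
  moreover have "(A *v (h *s v)) $ k = (A *v v) $ k * h" for h
    by (simp add: matrix_vector_mult_def sum_distrib_left mult_ac)
  ultimately show ?thesis by (simp add: has_field_derivative_def fun_eq_iff)
qed

lemma holomorphic_on_line:
  assumes "holomorphic_map_on f (ball z \<rho>)" "R * norm v \<le> \<rho>" "R > 0" 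
  shows "(\<lambda>t. f (z + t *s v) $ k) holomorphic_on (ball 0 R)"
proof (cases "v = 0")
  case False
  show ?thesis
    unfolding holomorphic_on_open[OF open_ball]
  proof
    fix t :: complex assume "t \<in> ball 0 R"
    then have "cmod t * norm v < R * norm v" using False by simp
    then have "z + t *s v \<in> ball z \<rho>"
      using assms(2) by (simp add: dist_norm norm_vector_scalar_mult)
    from has_field_derivative_along_line[OF holomorphic_map_has_derivative[OF assms(1) open_ball this]]
    show "\<exists>f'. ((\<lambda>t. f (z + t *s v) $ k) has_field_derivative f') (at t)" by blast
  qed
qed (auto simp: vector_scalar_mult_def zero_vec_def[symmetric])

text \<open>Cauchy's estimate for the first derivative, read off on complex lines.\<close>

lemma Cauchy_estimate_derivative:
  fixes f :: "complex^'n \<Rightarrow> complex^'m"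
  assumes f: "holomorphic_map_on f (ball z \<rho>)" and "\<rho> > 0"
    and M: "\<And>w. w \<in> ball z \<rho> \<Longrightarrow> norm (f w) \<le> M"
  shows "cmod ((complex_jacobian f z *v v) $ k) \<le> 2 * M / \<rho> * norm v"
proof (cases "v = 0")
  case False
  define R where "R = \<rho> / norm v"
  have R: "R > 0" "R * norm v \<le> \<rho>" using False \<open>\<rho> > 0\<close> by (auto simp: R_def)
  let ?\<phi> = "\<lambda>t. f (z + t *s v) $ k"
  have hol: "?\<phi> holomorphic_on ball 0 R" by (rule holomorphic_on_line[OF f R(2,1)])
  have sub: "cball 0 (R/2) \<subseteq> ball (0::complex) R" using R by auto
  have "norm ((deriv ^^ 1) ?\<phi> 0) \<le> fact 1 * M / (R/2)^1"
  proof (rule Cauchy_inequality)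
    show "?\<phi> holomorphic_on ball 0 (R/2)" using hol sub holomorphic_on_subset by (meson ball_subset_cball subset_trans)
    show "continuous_on (cball 0 (R/2)) ?\<phi>" using hol sub holomorphic_on_imp_continuous_on continuous_on_subset by blast
    show "R/2 > 0" using R by simp
    fix x assume "cmod (0 - x) = R/2"
    then have "z + x *s v \<in> ball z \<rho>" using False \<open>\<rho> > 0\<close> by (simp add: dist_norm norm_vector_scalar_mult R_def)
    then show "cmod (?\<phi> x) \<le> M" using M Finite_Cartesian_Product.norm_nth_le order_trans by blast
  qed
  moreover have "deriv ?\<phi> 0 = (complex_jacobian f z *v v) $ k"
    by (rule DERIV_imp_deriv, rule has_field_derivative_along_line)
       (use holomorphic_map_has_derivative[OF f open_ball] \<open>\<rho> > 0\<close> in simp)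
  ultimately show ?thesis using False \<open>\<rho> > 0\<close> by (simp add: R_def field_simps)
qed (simp add: matrix_vector_mult_0_right)

lemma norm_jacobian_mult_le:
  fixes f :: "complex^'n \<Rightarrow> complex^'m"
  assumes "holomorphic_map_on f (ball z \<rho>)" and "\<rho> > 0"
    and "\<And>w. w \<in> ball z \<rho> \<Longrightarrow> norm (f w) \<le> M"
  shows "norm (complex_jacobian f z *v v) \<le> 2 * real CARD('m) * M / \<rho> * norm v"
proof -
  have "norm (complex_jacobian f z *v v) \<le> (\<Sum>k\<in>(UNIV::'m set). 2 * M / \<rho> * norm v)"
    by (rule order_trans[OF norm_le_sum_components sum_mono])
       (use Cauchy_estimate_derivative[OF assms] in auto)
  then show ?thesis by (simp add: mult_ac)
qed

text \<open>
  Taylor's formula on the complex line through \<open>z\<close> in direction \<open>v\<close>. The constant depends on \<open>f\<close> only through a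
  bound, which is what allows passing to limits.
\<close>

lemma second_order_estimate:
  fixes f :: "complex^'n \<Rightarrow> complex^'m"
  assumes f: "holomorphic_map_on f (ball z \<rho>)" and "\<rho> > 0"
    and M: "\<And>w. w \<in> ball z \<rho> \<Longrightarrow> norm (f w) \<le> M" and v: "norm v \<le> \<rho> / 4"
  shows "norm (f (z + v) - f z - complex_jacobian f z *v v) \<le> 8 * real CARD('m) * M / \<rho>\<^sup>2 * (norm v)\<^sup>2"
proof (cases "v = 0")
  case False
  define R where "R = \<rho> / norm v"
  have R: "R \<ge> 4" "R > 0" "R * norm v \<le> \<rho>" using False \<open>\<rho> > 0\<close> v by (auto simp: R_def field_simps)
  have comp: "cmod ((f (z + v) - f z - complex_jacobian f z *v v) $ k) \<le> 8 * M / \<rho>\<^sup>2 * (norm v)\<^sup>2" for k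
  proof -
    let ?\<phi> = "\<lambda>t. f (z + t *s v) $ k"
    have hol: "?\<phi> holomorphic_on ball 0 R" by (rule holomorphic_on_line[OF f R(3,2)])
    have "cmod ((deriv^^0) ?\<phi> 1 - (\<Sum>i\<le>1. (deriv^^i) ?\<phi> 0 * (1 - 0)^i / fact i)) \<le> 8 * M / R\<^sup>2 * cmod (1 - 0)^Suc 1 / fact 1"
    proof (rule complex_Taylor[where S = "cball 0 1" and f = "\<lambda>i. (deriv^^i) ?\<phi>"])
      fix i :: nat and x :: complex assume "x \<in> cball 0 1"
      then have x: "x \<in> ball 0 R" using R by auto
      have "(deriv^^i) ?\<phi> holomorphic_on ball 0 R" by (rule holomorphic_higher_deriv[OF hol open_ball])
      then show "((deriv ^^ i) ?\<phi> has_field_derivative (deriv ^^ Suc i) ?\<phi> x) (at x within cball 0 1)"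
        using holomorphic_derivI[OF _ open_ball x] by simp
    next
      fix x :: complex assume x: "x \<in> cball 0 1"
      have sub: "cball x (R/2) \<subseteq> ball 0 R"
      proof
        fix y assume "y \<in> cball x (R/2)"
        then have "cmod y \<le> cmod x + R/2"
          by (metis dist_norm mem_cball norm_minus_commute norm_triangle_sub add.commute add_left_mono order_trans)
        then show "y \<in> ball 0 R" using x R by auto
      qed
      have "norm ((deriv ^^ 2) ?\<phi> x) \<le> fact 2 * M / (R/2)^2"
      proof (rule Cauchy_inequality)
        show "?\<phi> holomorphic_on ball x (R/2)" using hol sub holomorphic_on_subset by (meson ball_subset_cball subset_trans)
        show "continuous_on (cball x (R/2)) ?\<phi>" using hol sub holomorphic_on_imp_continuous_on continuous_on_subset by blast
        show "R/2 > 0" using R by simp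
        fix y assume "cmod (x - y) = R/2"
        then have "y \<in> ball 0 R" using sub by (auto simp: dist_norm)
        then have "cmod y * norm v < R * norm v" using False by simp
        then have "z + y *s v \<in> ball z \<rho>" using R by (simp add: dist_norm norm_vector_scalar_mult)
        then show "cmod (?\<phi> y) \<le> M" using M Finite_Cartesian_Product.norm_nth_le order_trans by blast
      qed
      then show "cmod ((deriv ^^ Suc 1) ?\<phi> x) \<le> 8 * M / R\<^sup>2" by (simp add: numeral_2_eq_2[symmetric] power_divide)
    qed auto
    moreover have "deriv ?\<phi> 0 = (complex_jacobian f z *v v) $ k"
      by (rule DERIV_imp_deriv, rule has_field_derivative_along_line)
         (use holomorphic_map_has_derivative[OF f open_ball] \<open>\<rho> > 0\<close> in simp)
    ultimately show ?thesis using False by (simp add: R_def power_divide field_simps)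
  qed
  have "norm (f (z + v) - f z - complex_jacobian f z *v v) \<le> (\<Sum>k\<in>(UNIV::'m set). 8 * M / \<rho>\<^sup>2 * (norm v)\<^sup>2)"
    by (rule order_trans[OF norm_le_sum_components sum_mono]) (rule comp)
  then show ?thesis by (simp add: mult_ac)
qed (simp add: matrix_vector_mult_0_right)

section \<open>Locally uniform limits\<close>

lemma matrix_vector_mult_axis_nth: "(A *v axis j 1) $ i = A $ i $ j" for A :: "'a::comm_semiring_1^'n^'m"
  by (simp add: matrix_vector_mult_def axis_def if_distrib[of "\<lambda>x. _ * x"] cong: if_cong)

lemma norm_matrix_le: "norm A \<le> (\<Sum>i\<in>UNIV. \<Sum>j\<in>UNIV. cmod (A$i$j))" for A :: "complex^'n^'m"
  by (rule order_trans[OF norm_le_sum_components]) (intro sum_mono norm_le_sum_components)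

text \<open>
  The jacobians of a locally uniformly convergent sequence form a Cauchy sequence, and the quadratic
  remainder estimate, being uniform along the sequence, passes to the limit.
\<close>

lemma uniform_limit_has_jacobian:
  fixes f :: "nat \<Rightarrow> complex^'n \<Rightarrow> complex^'m"
  assumes "\<rho> > 0" and hol: "\<And>k. holomorphic_map_on (f k) (ball z \<rho>)"
    and lim: "uniform_limit (ball z \<rho>) f g sequentially"
  obtains A where "(g has_derivative (\<lambda>h. A *v h)) (at z)"
    and "(\<lambda>k. complex_jacobian (f k) z) \<longlonglongrightarrow> A"
proof -
  let ?J = "\<lambda>k. complex_jacobian (f k) z"
  let ?N = "real CARD('m) * real CARD('n)"
  have "?N > 0" by simp
  have diffJ: "norm (?J k - ?J l) \<le> ?N * (2 * e / \<rho>)"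
    if e: "\<And>w. w \<in> ball z \<rho> \<Longrightarrow> norm (f k w - f l w) \<le> e" for k l e
  proof -
    have "(f k has_derivative (\<lambda>h. ?J k *v h)) (at z)" "(f l has_derivative (\<lambda>h. ?J l *v h)) (at z)"
      using holomorphic_map_has_derivative[OF hol open_ball] \<open>\<rho> > 0\<close> by auto
    from has_derivative_diff[OF this]
    have D: "((\<lambda>w. f k w - f l w) has_derivative (\<lambda>h. (?J k - ?J l) *v h)) (at z)"
      by (simp add: matrix_vector_mult_diff_rdistrib)
    have J: "complex_jacobian (\<lambda>w. f k w - f l w) z = ?J k - ?J l"
      by (rule has_derivative_complex_jacobian[OF D])
    have "cmod ((?J k - ?J l) $ i $ j) \<le> 2 * e / \<rho>" for i j
      using Cauchy_estimate_derivative[OF holomorphic_map_diff[OF hol hol] \<open>\<rho> > 0\<close> e, of "axis j 1" i]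
      by (simp add: J matrix_vector_mult_axis_nth)
    then have "(\<Sum>i\<in>UNIV. \<Sum>j\<in>UNIV. cmod ((?J k - ?J l)$i$j)) \<le> (\<Sum>i\<in>(UNIV::'m set). \<Sum>j\<in>(UNIV::'n set). 2 * e / \<rho>)"
      by (intro sum_mono)
    with norm_matrix_le[of "?J k - ?J l"] show ?thesis by (simp add: mult_ac)
  qed
  have "Cauchy ?J"
  proof (rule CauchyI)
    fix \<epsilon> :: real assume "\<epsilon> > 0"
    define e where "e = \<epsilon> * \<rho> / (4 * ?N)"
    have "e > 0" using \<open>\<epsilon> > 0\<close> \<open>\<rho> > 0\<close> by (simp add: e_def)
    have "uniformly_Cauchy_on (ball z \<rho>) f"
      using lim uniformly_convergent_Cauchy uniformly_convergent_on_def by blast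
    then obtain K where K: "\<And>k l w. k \<ge> K \<Longrightarrow> l \<ge> K \<Longrightarrow> w \<in> ball z \<rho> \<Longrightarrow> dist (f k w) (f l w) < e"
      unfolding uniformly_Cauchy_on_def using \<open>e > 0\<close> by metis
    have "norm (?J k - ?J l) < \<epsilon>" if "k \<ge> K" "l \<ge> K" for k l
    proof -
      have "norm (?J k - ?J l) \<le> ?N * (2 * e / \<rho>)"
        by (rule diffJ) (use K[OF that] in \<open>simp add: dist_norm less_imp_le\<close>)
      also have "\<dots> = \<epsilon> / 2" using \<open>\<rho> > 0\<close> by (simp add: e_def field_simps)
      finally show ?thesis using \<open>\<epsilon> > 0\<close> by simp
    qed
    then show "\<exists>K. \<forall>k\<ge>K. \<forall>l\<ge>K. norm (?J k - ?J l) < \<epsilon>" by blast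
  qed
  then obtain A where A: "?J \<longlonglongrightarrow> A" using Cauchy_convergent convergent_def by blast
  have limv: "(\<lambda>k. ?J k *v v) \<longlonglongrightarrow> A *v v" for v
    unfolding matrix_vector_mult_def by (intro tendsto_intros A)
  obtain \<rho>' where \<rho>': "0 < \<rho>'" "\<rho>' < \<rho>" using \<open>\<rho> > 0\<close> dense by blast
  have sub: "ball z \<rho>' \<subseteq> ball z \<rho>" "cball z \<rho>' \<subseteq> ball z \<rho>" using \<rho>' by auto
  obtain K where K: "\<And>k w. k \<ge> K \<Longrightarrow> w \<in> ball z \<rho> \<Longrightarrow> dist (f k w) (g w) < 1"
    using uniform_limitD[OF lim zero_less_one] unfolding eventually_sequentially by blast
  have "bounded (f K ` cball z \<rho>')"
    by (intro compact_imp_bounded compact_continuous_image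
        continuous_on_subset[OF holomorphic_map_continuous[OF hol]] sub) simp
  then obtain M where M: "\<And>w. w \<in> cball z \<rho>' \<Longrightarrow> norm (f K w) \<le> M"
    unfolding bounded_iff by blast
  have bd: "norm (f k w) \<le> M + 2" if "k \<ge> K" "w \<in> ball z \<rho>'" for k w
  proof -
    have w: "w \<in> ball z \<rho>" using sub that by blast
    have "norm (f k w - f K w) \<le> norm (f k w - g w) + norm (g w - f K w)"
      by (metis norm_triangle_ineq diff_add_cancel add_diff_eq)
    also have "\<dots> \<le> 2" using K[OF that(1) w] K[OF order_refl w] by (simp add: dist_norm norm_minus_commute)
    finally have "norm (f k w) \<le> norm (f K w) + 2"
      by (metis add.commute add_le_cancel_left norm_triangle_sub order_trans)
    then show ?thesis using M[of w] that by auto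
  qed
  define C where "C = 8 * real CARD('m) * (M + 2) / \<rho>'\<^sup>2"
  have est: "norm (g (z + v) - g z - A *v v) \<le> C * (norm v)\<^sup>2" if v: "norm v \<le> \<rho>' / 4" for v
  proof -
    have "(\<lambda>k. norm (f k (z + v) - f k z - ?J k *v v)) \<longlonglongrightarrow> norm (g (z + v) - g z - A *v v)"
      by (intro tendsto_intros limv tendsto_uniform_limitI[OF lim]) (use v \<rho>' in \<open>auto simp: dist_norm\<close>)
    moreover have "\<forall>\<^sub>F k in sequentially. norm (f k (z + v) - f k z - ?J k *v v) \<le> C * (norm v)\<^sup>2"
      unfolding eventually_sequentially C_def
      using second_order_estimate[OF holomorphic_map_subset[OF hol sub(1)] \<rho>'(1) bd v] by blast
    ultimately show ?thesis by (intro tendsto_upperbound) auto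
  qed
  have "C \<ge> 0"
    using order_trans[OF norm_ge_zero M[of z]] \<rho>' by (auto simp: C_def)
  have "(g has_derivative (\<lambda>h. A *v h)) (at z)"
    unfolding has_derivative_at
  proof (intro conjI)
    show "((\<lambda>h. norm (g (z + h) - g z - A *v h) / norm h) \<longlongrightarrow> 0) (at 0)"
    proof (rule Lim_null_comparison)
      have "\<forall>\<^sub>F h in at 0. norm (h::complex^'n) < \<rho>'/4"
        using \<rho>' by (auto simp: eventually_at intro!: exI[of _ "\<rho>'/4"])
      then show "\<forall>\<^sub>F h in at 0. norm (norm (g (z + h) - g z - A *v h) / norm h) \<le> C * norm h"
      proof eventually_elim
        case (elim h)
        then show ?case using est[of h] \<open>C \<ge> 0\<close> by (cases "h = 0") (auto simp: field_simps power2_eq_square)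
      qed
      show "((\<lambda>h. C * norm h) \<longlongrightarrow> 0) (at (0::complex^'n))"
        by (auto intro!: tendsto_eq_intros)
    qed
  qed simp
  then show thesis using A that by blast
qed

lemma holomorphic_map_uniform_limit:
  fixes f :: "nat \<Rightarrow> complex^'n \<Rightarrow> complex^'m"
  assumes "\<And>z. z \<in> S \<Longrightarrow> \<exists>\<rho>>0. (\<forall>k. holomorphic_map_on (f k) (ball z \<rho>)) \<and> uniform_limit (ball z \<rho>) f g sequentially"
  shows "holomorphic_map_on g S"
proof (rule holomorphic_map_onI)
  fix z assume "z \<in> S"
  then obtain \<rho> where "\<rho> > 0" "\<And>k. holomorphic_map_on (f k) (ball z \<rho>)" "uniform_limit (ball z \<rho>) f g sequentially"
    using assms by meson
  from uniform_limit_has_jacobian[OF this]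
  show "\<exists>A. (g has_derivative (\<lambda>h. A *v h)) (at z)" by metis
qed

section \<open>Order of vanishing\<close>

text \<open>Vanishing to order \<open>m\<close> at the origin; for holomorphic maps this says that the Taylor expansion
  starts in degree at least \<open>m\<close>.\<close>

definition flat :: "nat \<Rightarrow> (complex^'n \<Rightarrow> complex^'m) \<Rightarrow> bool"
  where "flat m f \<longleftrightarrow> (\<exists>C. \<forall>\<^sub>F z in nhds 0. norm (f z) \<le> C * norm z ^ m)"

lemma flatE:
  assumes "flat m f"
  obtains C \<rho> where "C > 0" "\<rho> > 0" "\<And>z. norm z < \<rho> \<Longrightarrow> norm (f z) \<le> C * norm z ^ m"
proof -
  obtain C \<rho> where "\<rho> > 0" and C: "\<And>z. dist z 0 < \<rho> \<Longrightarrow> norm (f z) \<le> C * norm z ^ m"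
    using assms unfolding flat_def eventually_nhds_metric by blast
  have "norm (f z) \<le> max C 1 * norm z ^ m" if "norm z < \<rho>" for z
    by (rule order_trans[OF C mult_right_mono]) (use that in auto)
  then show thesis using that[of "max C 1" \<rho>] \<open>\<rho> > 0\<close> by auto
qed

lemma flatI:
  assumes "\<rho> > 0" "\<And>z. norm z < \<rho> \<Longrightarrow> norm (f z) \<le> C * norm z ^ m"
  shows "flat m f"
  using assms unfolding flat_def eventually_nhds_metric by auto

lemma flat_0: "flat m f \<Longrightarrow> m > 0 \<Longrightarrow> f 0 = 0"
  by (auto elim!: flatE) (metis mult_zero_right norm_le_zero_iff norm_zero power_0_left zero_less_iff_neq_zero less_numeral_extra(3))

lemma flat_zero [simp]: "flat m (\<lambda>z. 0)"
  by (rule flatI[of 1 _ 0]) auto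

lemma flat_mono: assumes "flat m f" "k \<le> m" shows "flat k f"
proof -
  obtain C \<rho> where C: "C > 0" "\<rho> > 0" "\<And>z. norm z < \<rho> \<Longrightarrow> norm (f z) \<le> C * norm z ^ m"
    using assms flatE by blast
  show ?thesis
  proof (rule flatI)
    show "min \<rho> 1 > 0" using C by simp
    fix z :: "complex^'a" assume z: "norm z < min \<rho> 1"
    have "norm z ^ m \<le> norm z ^ k" using z assms(2) by (intro power_decreasing) auto
    then show "norm (f z) \<le> C * norm z ^ k" using C z by (smt (verit) mult_left_mono)
  qed
qed

lemma flat_add: assumes "flat m f" "flat m g" shows "flat m (\<lambda>z. f z + g z)"
proof -
  obtain C D where "\<forall>\<^sub>F z in nhds 0. norm (f z) \<le> C * norm z ^ m" "\<forall>\<^sub>F z in nhds 0. norm (g z) \<le> D * norm z ^ m"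
    using assms unfolding flat_def by blast
  then have "\<forall>\<^sub>F z in nhds 0. norm (f z + g z) \<le> (C + D) * norm z ^ m"
    by eventually_elim (auto simp: distrib_right intro: order_trans[OF norm_triangle_ineq] add_mono)
  then show ?thesis unfolding flat_def by blast
qed

lemma flat_matrix:
  fixes f :: "complex^'n \<Rightarrow> complex^'m"
  assumes "flat m f" shows "flat m (\<lambda>z. A *v f z)"
proof -
  obtain C \<rho> where C: "C > 0" "\<rho> > 0" "\<And>z. norm z < \<rho> \<Longrightarrow> norm (f z) \<le> C * norm z ^ m"
    using assms flatE by blast
  let ?a = "\<Sum>i\<in>UNIV. \<Sum>j\<in>UNIV. cmod (A$i$j)"
  show ?thesis
  proof (rule flatI[OF C(2)])
    fix z :: "complex^'n" assume z: "norm z < \<rho>"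
    have "norm (A *v f z) \<le> ?a * norm (f z)" by (rule norm_matrix_vector_mult_le)
    also have "\<dots> \<le> ?a * (C * norm z ^ m)"
      by (intro mult_left_mono C z sum_nonneg) auto
    finally show "norm (A *v f z) \<le> ?a * C * norm z ^ m" by (simp add: mult_ac)
  qed
qed

lemma flat_uminus: "flat m f \<Longrightarrow> flat m (\<lambda>z. - f z)"
  by (simp add: flat_def)

lemma flat_diff: "flat m f \<Longrightarrow> flat m g \<Longrightarrow> flat m (\<lambda>z. f z - g z)"
  using flat_add[OF _ flat_uminus, of m f g] by simp

lemma flat_compose:
  fixes f :: "complex^'n \<Rightarrow> complex^'m" and g :: "complex^'k \<Rightarrow> complex^'n"
  assumes "flat m f" "flat 1 g" shows "flat m (\<lambda>z. f (g z))"
proof -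
  obtain C \<rho> where C: "C > 0" "\<rho> > 0" "\<And>z. norm z < \<rho> \<Longrightarrow> norm (f z) \<le> C * norm z ^ m"
    using assms flatE by blast
  obtain D \<sigma> where D: "D > 0" "\<sigma> > 0" "\<And>z. norm z < \<sigma> \<Longrightarrow> norm (g z) \<le> D * norm z ^ 1"
    using assms(2) flatE by blast
  show ?thesis
  proof (rule flatI)
    show "min \<sigma> (\<rho> / D) > 0" using C D by simp
    fix z :: "complex^'k" assume z: "norm z < min \<sigma> (\<rho> / D)"
    then have g: "norm (g z) \<le> D * norm z" using D(3)[of z] by simp
    also have "\<dots> < \<rho>" using z D by (simp add: field_simps)
    finally have "norm (f (g z)) \<le> C * norm (g z) ^ m" using C by blast
    also have "\<dots> \<le> C * (D * norm z) ^ m" using g C by (intro mult_left_mono power_mono) auto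
    finally show "norm (f (g z)) \<le> C * D ^ m * norm z ^ m" by (simp add: power_mult_distrib mult_ac)
  qed
qed

lemma flat_second_order:
  fixes f :: "complex^'n \<Rightarrow> complex^'m"
  assumes f: "entire f"
  shows "flat 2 (\<lambda>z. f z - f 0 - complex_jacobian f 0 *v z)"
proof -
  have "bounded (f ` cball 0 1)"
    by (intro compact_imp_bounded compact_continuous_image
        continuous_on_subset[OF holomorphic_map_continuous[OF f]]) auto
  then obtain M where M: "\<And>w. w \<in> cball 0 1 \<Longrightarrow> norm (f w) \<le> M"
    unfolding bounded_iff by blast
  show ?thesis
    by (rule flatI[where \<rho> = "1/4" and C = "8 * real CARD('m) * M"])
       (use second_order_estimate[OF holomorphic_map_subset[OF f subset_UNIV], of 1 0 M] M in auto)
qed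

lemma flat_1_holomorphic:
  fixes f :: "complex^'n \<Rightarrow> complex^'m"
  assumes "entire f" "f 0 = 0" shows "flat 1 f"
proof -
  have id: "flat 1 (\<lambda>z. z)" by (rule flatI[of 1 _ 1]) auto
  have "flat 1 (\<lambda>z. f z - f 0 - complex_jacobian f 0 *v z)"
    by (rule flat_mono[OF flat_second_order]) (use assms in auto)
  from flat_add[OF this flat_matrix[OF id, of "complex_jacobian f 0"]] show ?thesis using assms by simp
qed

lemma flat_2_jacobian:
  fixes f :: "complex^'n \<Rightarrow> complex^'m"
  assumes "entire f" "f 0 = 0" "(f has_derivative (\<lambda>h. A *v h)) (at 0)"
  shows "flat 2 (\<lambda>z. f z - A *v z)"
  using flat_second_order[OF assms(1)] assms(2) has_derivative_complex_jacobian[OF assms(3)] by simp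

text \<open>
  A holomorphic map that vanishes to order \<open>m\<close> has derivative of order \<open>m - 1\<close>: apply Cauchy's
  estimate on the ball around \<open>z\<close> that reaches to the origin.
\<close>

lemma flat_imp_Lipschitz:
  fixes f :: "complex^'n \<Rightarrow> complex^'m"
  assumes f: "holomorphic_map_on f (ball 0 \<rho>)" and "m > 0" "C \<ge> 0"
    and C: "\<And>z. norm z < \<rho> \<Longrightarrow> norm (f z) \<le> C * norm z ^ m"
    and \<sigma>: "0 < \<sigma>" "2 * \<sigma> \<le> \<rho>" and xy: "norm x \<le> \<sigma>" "norm y \<le> \<sigma>"
  shows "norm (f x - f y) \<le> 2 * real CARD('m) * C * 2 ^ m * \<sigma> ^ (m - 1) * norm (x - y)"
proof (rule differentiable_bound[where S = "cball 0 \<sigma>" and f' = "\<lambda>z h. complex_jacobian f z *v h"])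
  fix z :: "complex^'n" assume z: "z \<in> cball 0 \<sigma>"
  then have zr: "z \<in> ball 0 \<rho>" using \<sigma> by auto
  show "(f has_derivative (\<lambda>h. complex_jacobian f z *v h)) (at z within cball 0 \<sigma>)"
    using holomorphic_map_has_derivative[OF f open_ball zr] has_derivative_at_withinI by blast
  have sub: "norm w < 2 * \<sigma>" if "w \<in> ball z \<sigma>" for w
    using that z norm_triangle_sub[of w z] by (auto simp: dist_norm norm_minus_commute)
  have "norm (complex_jacobian f z *v v) \<le> 2 * real CARD('m) * (C * (2 * \<sigma>) ^ m) / \<sigma> * norm v" for v
  proof (rule norm_jacobian_mult_le)
    show "holomorphic_map_on f (ball z \<sigma>)"
      using f by (rule holomorphic_map_subset) (use sub \<sigma> in force)
    show "norm (f w) \<le> C * (2 * \<sigma>) ^ m" if "w \<in> ball z \<sigma>" for w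
    proof -
      have "norm (f w) \<le> C * norm w ^ m" using C[of w] sub[OF that] \<sigma> by auto
      also have "\<dots> \<le> C * (2 * \<sigma>) ^ m" using sub[OF that] \<open>C \<ge> 0\<close> by (intro mult_left_mono power_mono) auto
      finally show ?thesis .
    qed
  qed (rule \<sigma>(1))
  moreover have "2 * real CARD('m) * (C * (2 * \<sigma>) ^ m) / \<sigma> = 2 * real CARD('m) * C * 2 ^ m * \<sigma> ^ (m - 1)"
    using \<open>m > 0\<close> \<sigma> by (cases m) (auto simp: power_mult_distrib)
  ultimately show "onorm (\<lambda>h. complex_jacobian f z *v h) \<le> 2 * real CARD('m) * C * 2 ^ m * \<sigma> ^ (m - 1)"
    by (intro onorm_le) metis
qed (use xy in auto)

text \<open>
  The rule for counting orders in the normal form: if two inner maps agree to order \<open>k\<close>, then composing with a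
  map of order \<open>m\<close> gains \<open>m - 1\<close> orders, by the preceding Lipschitz estimate.
\<close>

lemma flat_difference:
  fixes f :: "complex^'n \<Rightarrow> complex^'m" and a b :: "complex^'k \<Rightarrow> complex^'n"
  assumes f: "entire f" "flat m f" "m > 0"
    and ab: "flat 1 a" "flat 1 b" "flat k (\<lambda>z. a z - b z)"
  shows "flat (m - 1 + k) (\<lambda>z. f (a z) - f (b z))"
proof -
  obtain C \<rho> where C: "C > 0" "\<rho> > 0" "\<And>z. norm z < \<rho> \<Longrightarrow> norm (f z) \<le> C * norm z ^ m"
    using assms flatE by blast
  obtain D1 \<sigma>1 where D1: "D1 > 0" "\<sigma>1 > 0" "\<And>z. norm z < \<sigma>1 \<Longrightarrow> norm (a z) \<le> D1 * norm z ^ 1"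
    using ab(1) flatE by blast
  obtain D2 \<sigma>2 where D2: "D2 > 0" "\<sigma>2 > 0" "\<And>z. norm z < \<sigma>2 \<Longrightarrow> norm (b z) \<le> D2 * norm z ^ 1"
    using ab(2) flatE by blast
  obtain D3 \<sigma>3 where D3: "D3 > 0" "\<sigma>3 > 0" "\<And>z. norm z < \<sigma>3 \<Longrightarrow> norm (a z - b z) \<le> D3 * norm z ^ k"
    using ab(3) flatE by blast
  define D where "D = D1 + D2"
  define K where "K = 2 * real CARD('m) * C * 2 ^ m"
  have "K > 0" "D > 0" using C D1 D2 by (auto simp: K_def D_def)
  show ?thesis
  proof (rule flatI)
    show "min (min \<sigma>1 \<sigma>2) (min \<sigma>3 (\<rho> / (2 * D))) > 0" using C D1 D2 D3 \<open>D > 0\<close> by simp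
    fix z :: "complex^'k" assume z: "norm z < min (min \<sigma>1 \<sigma>2) (min \<sigma>3 (\<rho> / (2 * D)))"
    show "norm (f (a z) - f (b z)) \<le> K * D ^ (m - 1) * D3 * norm z ^ (m - 1 + k)"
    proof (cases "z = 0")
      case True
      have "a 0 = 0" "b 0 = 0" using ab flat_0 by auto
      then show ?thesis using True \<open>K > 0\<close> \<open>D > 0\<close> D3 by auto
    next
      case False
      have "norm (f (a z) - f (b z)) \<le> K * (D * norm z) ^ (m - 1) * norm (a z - b z)"
        unfolding K_def
      proof (rule flat_imp_Lipschitz[OF holomorphic_map_subset[OF f(1)] f(3) _ C(3)])
        show "norm (a z) \<le> D * norm z" using D1(3)[of z] z D2(1) False by (simp add: D_def distrib_right) (smt (verit) mult_nonneg_nonneg norm_ge_zero)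
        show "norm (b z) \<le> D * norm z" using D2(3)[of z] z D1(1) False by (simp add: D_def distrib_right) (smt (verit) mult_nonneg_nonneg norm_ge_zero)
        show "2 * (D * norm z) \<le> \<rho>" using z \<open>D > 0\<close> by (simp add: field_simps)
      qed (use C \<open>D > 0\<close> False in auto)
      also have "\<dots> \<le> K * (D * norm z) ^ (m - 1) * (D3 * norm z ^ k)"
        using D3(3)[of z] z \<open>K > 0\<close> \<open>D > 0\<close> by (intro mult_left_mono) auto
      finally show ?thesis by (simp add: power_mult_distrib power_add mult_ac)
    qed
  qed
qed

section \<open>Partial derivatives and order of vanishing\<close>

lemma axis_eq_cmul: "axis i t = t *s axis i (1::complex)"
  by (simp add: vec_eq_iff axis_def)

lemma complex_partial_eq_jacobian:
  fixes f :: "complex^'n \<Rightarrow> complex^'m"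
  assumes "entire f"
  shows "complex_partial i f z = complex_jacobian f z *v axis i 1"
proof -
  have "(f has_derivative (\<lambda>h. complex_jacobian f z *v h)) (at (z + 0 *s axis i 1))"
    using holomorphic_map_has_derivative[OF assms open_UNIV UNIV_I] by simp
  from DERIV_imp_deriv[OF has_field_derivative_along_line[OF this]]
  show ?thesis by (simp add: complex_partial_def vec_eq_iff flip: axis_eq_cmul)
qed

lemma complex_partial_diff:
  fixes f g :: "complex^'n \<Rightarrow> complex^'m"
  assumes "entire f" "entire g"
  shows "complex_partial i (\<lambda>z. f z - g z) = (\<lambda>z. complex_partial i f z - complex_partial i g z)"
proof
  fix z
  have "((\<lambda>z. f z - g z) has_derivative (\<lambda>h. (complex_jacobian f z - complex_jacobian g z) *v h)) (at z)"
    using has_derivative_diff[OF assms[THEN holomorphic_map_has_derivative, OF open_UNIV UNIV_I, of z]]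
    by (simp add: matrix_vector_mult_diff_rdistrib)
  from has_derivative_complex_jacobian[OF this]
  show "complex_partial i (\<lambda>z. f z - g z) z = complex_partial i f z - complex_partial i g z"
    by (simp add: complex_partial_eq_jacobian holomorphic_map_diff assms matrix_vector_mult_diff_rdistrib)
qed

lemma complex_partial_cmul:
  fixes f :: "complex^'n \<Rightarrow> complex^'m"
  assumes "entire f"
  shows "complex_partial i (\<lambda>z. c *s f z) z = c *s complex_partial i f z"
proof -
  have "(f has_derivative (\<lambda>h. complex_jacobian f z *v h)) (at (z + 0 *s axis i 1))"
    using holomorphic_map_has_derivative[OF assms open_UNIV UNIV_I] by simp
  from has_field_derivative_along_line[OF this]
  have "(\<lambda>t. f (z + axis i t) $ k) field_differentiable at 0" for k
    by (auto simp: field_differentiable_def simp flip: axis_eq_cmul)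
  then show ?thesis by (simp add: complex_partial_def vec_eq_iff)
qed

lemma complex_partial_translate:
  "complex_partial i (\<lambda>z. f (z + h)) z = complex_partial i f (z + h)"
  by (simp add: complex_partial_def add_ac)

lemma entire_translate:
  assumes "entire f" shows "entire (\<lambda>z. f (z + h))"
  by (rule holomorphic_map_compose[OF holomorphic_map_add[OF holomorphic_map_id holomorphic_map_const] assms]) simp

definition difference_quotient ::
  "'n \<Rightarrow> (complex^'n \<Rightarrow> complex^'m) \<Rightarrow> nat \<Rightarrow> complex^'n \<Rightarrow> complex^'m"
  where "difference_quotient i f k z = of_nat (Suc k) *s (f (z + axis i (1 / of_nat (Suc k))) - f z)"

lemma entire_difference_quotient:
  fixes f :: "complex^'n \<Rightarrow> complex^'m"
  assumes "entire f"
  shows "entire (difference_quotient i f k)"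
  unfolding difference_quotient_def[abs_def]
  by (intro holomorphic_map_cmul holomorphic_map_diff entire_translate assms)

text \<open>
  The second order estimate bounds the distance of the difference quotient with step \<open>1 / (k + 1)\<close> from the partial
  derivative by a multiple of \<open>1 / (k + 1)\<close>, uniformly on balls; hence partial derivatives of entire maps are entire.
\<close>

lemma uniform_limit_difference_quotient:
  fixes f :: "complex^'n \<Rightarrow> complex^'m"
  assumes f: "entire f"
  shows "uniform_limit (ball w 1) (difference_quotient i f) (complex_partial i f) sequentially"
proof -
  have "bounded (f ` cball w 2)"
    by (intro compact_imp_bounded compact_continuous_image
        continuous_on_subset[OF holomorphic_map_continuous[OF f]]) auto
  then obtain M where M: "\<And>w'. w' \<in> cball w 2 \<Longrightarrow> norm (f w') \<le> M"
    unfolding bounded_iff by blast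
  define C where "C = 8 * real CARD('m) * M"
  \<comment> \<open>for \<open>k \<ge> 3\<close> the step is at most a quarter of the radius 1, as the second order estimate requires\<close>
  have est: "norm (difference_quotient i f k z - complex_partial i f z) \<le> C * inverse (real (Suc k))"
    if "z \<in> ball w 1" "k \<ge> 3" for z k
  proof -
    define c where "c = (of_nat (Suc k) :: complex)"
    have c: "cmod c = real (Suc k)" unfolding c_def using norm_of_nat by blast
    have c0: "c \<noteq> 0" using c by auto
    let ?v = "axis i (1/c) :: complex^'n"
    have nv: "norm ?v = inverse (real (Suc k))" by (subst axis_eq_cmul) (simp add: norm_vector_scalar_mult c norm_divide inverse_eq_divide)
    have "difference_quotient i f k z - complex_partial i f z = c *s (f (z + ?v) - f z - complex_jacobian f z *v ?v)"
    proof -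
      have "complex_jacobian f z *v ?v = (1/c) *s (complex_jacobian f z *v axis i 1)"
        by (subst axis_eq_cmul) (simp add: matrix_vector_mult_def vec_eq_iff sum_distrib_left mult_ac sum_divide_distrib)
      then show ?thesis using c0
        by (simp add: difference_quotient_def c_def[symmetric] complex_partial_eq_jacobian[OF f] vec_eq_iff field_simps del: of_nat_Suc)
    qed
    then have "norm (difference_quotient i f k z - complex_partial i f z)
        = real (Suc k) * norm (f (z + ?v) - f z - complex_jacobian f z *v ?v)"
      by (simp only: norm_vector_scalar_mult c)
    also have "\<dots> \<le> real (Suc k) * (8 * real CARD('m) * M / 1\<^sup>2 * (norm ?v)\<^sup>2)"
    proof (intro mult_left_mono second_order_estimate)
      show "norm (f w') \<le> M" if "w' \<in> ball z 1" for w'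
        using that \<open>z \<in> ball w 1\<close> dist_triangle[of w w' z] by (intro M) simp
    qed (use that in \<open>auto simp: nv field_simps intro: holomorphic_map_subset[OF f]\<close>)
    also have "\<dots> = C * inverse (real (Suc k))" by (simp add: C_def nv field_simps power2_eq_square del: of_nat_Suc)
    finally show ?thesis .
  qed
  have "(\<lambda>k. C * inverse (real (Suc k))) \<longlonglongrightarrow> C * 0"
    by (intro tendsto_intros LIMSEQ_inverse_real_of_nat)
  then have lim: "(\<lambda>k. C * inverse (real (Suc k))) \<longlonglongrightarrow> 0" by simp
  show ?thesis
  proof (rule uniform_limitI)
    fix e :: real assume "e > 0"
    show "\<forall>\<^sub>F k in sequentially. \<forall>z\<in>ball w 1. dist (difference_quotient i f k z) (complex_partial i f z) < e"
      using order_tendstoD(2)[OF lim \<open>e > 0\<close>] eventually_ge_at_top[of 3]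
    proof eventually_elim
      case (elim k)
      then show ?case using le_less_trans[OF est] unfolding dist_norm by blast
    qed
  qed
qed

lemma entire_complex_partial:
  fixes f :: "complex^'n \<Rightarrow> complex^'m"
  assumes f: "entire f"
  shows "entire (complex_partial i f)"
  by (rule holomorphic_map_uniform_limit[where f = "difference_quotient i f"])
     (use uniform_limit_difference_quotient[OF f] holomorphic_map_subset[OF entire_difference_quotient[OF f]] in
       \<open>blast intro: zero_less_one\<close>)

text \<open>Differentiation commutes with locally uniform limits, hence with the limit of difference quotients
  that is a partial derivative in another direction.\<close>

lemma complex_partial_commute:
  fixes f :: "complex^'n \<Rightarrow> complex^'m"
  assumes f: "entire f"
  shows "complex_partial j (complex_partial i f) = complex_partial i (complex_partial j f)"
proof
  fix w :: "complex^'n"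
  note fi = entire_complex_partial[OF f]
  obtain A where A: "(complex_partial i f has_derivative (\<lambda>h. A *v h)) (at w)"
    and lim: "(\<lambda>k. complex_jacobian (difference_quotient i f k) w) \<longlonglongrightarrow> A"
    using uniform_limit_has_jacobian[OF zero_less_one holomorphic_map_subset[OF entire_difference_quotient[OF f] subset_UNIV]
        uniform_limit_difference_quotient[OF f]] by metis
  have "(\<lambda>k. complex_jacobian (difference_quotient i f k) w *v axis j 1) \<longlonglongrightarrow> A *v axis j 1"
    unfolding matrix_vector_mult_def by (intro tendsto_intros lim)
  moreover have "complex_jacobian (difference_quotient i f k) w *v axis j 1 = difference_quotient i (complex_partial j f) k w" for k
  proof -
    have "complex_jacobian (difference_quotient i f k) w *v axis j 1 = complex_partial j (difference_quotient i f k) w"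
      by (simp add: complex_partial_eq_jacobian entire_difference_quotient f)
    also have "\<dots> = difference_quotient i (complex_partial j f) k w"
      unfolding difference_quotient_def[abs_def]
      by (simp only: complex_partial_cmul[OF holomorphic_map_diff[OF entire_translate[OF f] f]]
          complex_partial_diff[OF entire_translate[OF f] f] complex_partial_translate)
    finally show ?thesis .
  qed
  moreover have "(\<lambda>k. difference_quotient i (complex_partial j f) k w) \<longlonglongrightarrow> complex_partial i (complex_partial j f) w"
    by (rule tendsto_uniform_limitI[OF uniform_limit_difference_quotient[OF fi, where w = w]]) simp
  ultimately have "A *v axis j 1 = complex_partial i (complex_partial j f) w"
    using LIMSEQ_unique by simp
  then show "complex_partial j (complex_partial i f) w = complex_partial i (complex_partial j f) w"
    using has_derivative_complex_jacobian[OF A] by (simp add: complex_partial_eq_jacobian fi)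
qed

lemma entire_iterated_partial:
  fixes f :: "complex^'n \<Rightarrow> complex^'m"
  assumes "entire f" shows "entire ((complex_partial i ^^ k) f)"
  using assms by (induction k) (auto intro: entire_complex_partial)

lemma iterated_partial_commute:
  fixes f :: "complex^'n \<Rightarrow> complex^'m"
  assumes "entire f"
  shows "(complex_partial i ^^ k) (complex_partial j f) = complex_partial j ((complex_partial i ^^ k) f)"
  by (induction k) (simp_all add: complex_partial_commute[OF entire_iterated_partial[OF assms], symmetric])

lemma iterated_partial_diff:
  fixes f g :: "complex^'n \<Rightarrow> complex^'m"
  assumes "entire f" "entire g"
  shows "(complex_partial i ^^ k) (\<lambda>z. f z - g z) = (\<lambda>z. (complex_partial i ^^ k) f z - (complex_partial i ^^ k) g z)"
  by (induction k) (simp_all add: complex_partial_diff entire_iterated_partial assms)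

lemma
  fixes f :: "complex^'n \<Rightarrow> complex^'m"
  assumes f: "entire f"
  shows entire_partials: "entire (foldr (\<lambda>i. complex_partial i ^^ \<alpha> i) is f)"
    and partials_commute: "foldr (\<lambda>i. complex_partial i ^^ \<alpha> i) is (complex_partial j f)
      = complex_partial j (foldr (\<lambda>i. complex_partial i ^^ \<alpha> i) is f)"
  by (induction "is") (simp_all add: entire_iterated_partial f iterated_partial_commute)

text \<open>
  Since partial derivatives commute, a further derivative in direction \<open>j\<close> can be moved to the place of \<open>j\<close> in the
  enumeration of the variables.
\<close>

lemma partials_increment:
  fixes f :: "complex^'n \<Rightarrow> complex^'m"
  assumes f: "entire f" and "distinct is" "j \<in> set is"
  shows "foldr (\<lambda>i. complex_partial i ^^ \<alpha> i) is (complex_partial j f)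
    = foldr (\<lambda>i. complex_partial i ^^ (\<alpha>(j := Suc (\<alpha> j))) i) is f"
  using assms(2,3)
proof (induction "is")
  case (Cons i "is")
  show ?case
  proof (cases "i = j")
    case True
    have "foldr (\<lambda>i. complex_partial i ^^ \<alpha> i) is f = foldr (\<lambda>i. complex_partial i ^^ (\<alpha>(j := Suc (\<alpha> j))) i) is f"
      by (rule foldr_cong) (use Cons.prems True in auto)
    then show ?thesis using True by (simp add: partials_commute[OF f] funpow_swap1)
  next
    case False
    then show ?thesis using Cons by simp
  qed
qed simp

lemma enumeration_exists: "distinct (SOME is. distinct is \<and> set is = (UNIV :: 'n::finite set)) \<and>
    set (SOME is. distinct is \<and> set is = (UNIV :: 'n set)) = UNIV"
  by (rule someI_ex) (use finite_distinct_list[of "UNIV :: 'n set"] in auto)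

lemma multi_partial_complex_partial:
  fixes f :: "complex^'n \<Rightarrow> complex^'m"
  assumes "entire f"
  shows "multi_partial \<alpha> (complex_partial j f) = multi_partial (\<alpha>(j := Suc (\<alpha> j))) f"
  unfolding multi_partial_def by (rule partials_increment[OF assms]) (use enumeration_exists[where 'n='n] in auto)

lemma multi_partial_diff:
  fixes f g :: "complex^'n \<Rightarrow> complex^'m"
  assumes "entire f" "entire g"
  shows "multi_partial \<alpha> (\<lambda>z. f z - g z) z = multi_partial \<alpha> f z - multi_partial \<alpha> g z"
proof -
  have "foldr (\<lambda>i. complex_partial i ^^ \<alpha> i) is (\<lambda>z. f z - g z) =
      (\<lambda>z. foldr (\<lambda>i. complex_partial i ^^ \<alpha> i) is f z - foldr (\<lambda>i. complex_partial i ^^ \<alpha> i) is g z)" for "is"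
    by (induction "is") (simp_all add: iterated_partial_diff entire_partials assms)
  then show ?thesis by (simp add: multi_partial_def)
qed

lemma multi_partial_zero:
  assumes "multi_order \<alpha> = 0" shows "multi_partial \<alpha> f = f"
proof -
  have "\<alpha> i = 0" for i using assms by (simp add: multi_order_def)
  then have "foldr (\<lambda>i. complex_partial i ^^ \<alpha> i) is f = f" for "is" by (induction "is") auto
  then show ?thesis by (simp add: multi_partial_def)
qed

lemma multi_order_increment: "multi_order (\<alpha>(j := Suc (\<alpha> j))) = Suc (multi_order \<alpha>)" for \<alpha> :: "'n::finite \<Rightarrow> nat"
proof -
  have "multi_order (\<alpha>(j := Suc (\<alpha> j))) = (\<Sum>i\<in>UNIV. \<alpha> i + (if i = j then 1 else 0))"
    unfolding multi_order_def by (rule sum.cong) auto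
  also have "\<dots> = Suc (multi_order \<alpha>)"
    by (subst sum.distrib) (simp add: multi_order_def)
  finally show ?thesis .
qed

text \<open>
  Taylor's theorem in the form needed here, with a constant that depends on the map only through a bound
  \<open>M\<close>: by induction the first partial derivatives vanish to order \<open>q\<close>, and the mean value
  inequality gains one order.
\<close>

lemma vanishing_partials_bound:
  assumes "\<rho> > 0"
  shows "\<exists>C>0. \<exists>\<sigma>>0. \<forall>(f :: complex^'n \<Rightarrow> complex^'m) (M::real). entire f \<longrightarrow>
    (\<forall>z. norm (z - z0) < \<rho> \<longrightarrow> norm (f z) \<le> M) \<longrightarrow>
    (\<forall>\<alpha>. multi_order \<alpha> < q \<longrightarrow> multi_partial \<alpha> f z0 = 0) \<longrightarrow>
    (\<forall>z. norm (z - z0) < \<sigma> \<longrightarrow> norm (f z) \<le> C * M * norm (z - z0) ^ q)"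
  using assms
proof (induction q arbitrary: \<rho>)
  case 0
  then show ?case by (intro exI[of _ 1] conjI exI[of _ \<rho>]) auto
next
  case (Suc q)
  obtain C \<sigma> where C: "C > 0" "\<sigma> > 0" and IH:
    "\<And>(f :: complex^'n \<Rightarrow> complex^'m) (M::real) z. entire f \<Longrightarrow>
      (\<And>z. norm (z - z0) < \<rho>/2 \<Longrightarrow> norm (f z) \<le> M) \<Longrightarrow>
      (\<And>\<alpha>. multi_order \<alpha> < q \<Longrightarrow> multi_partial \<alpha> f z0 = 0) \<Longrightarrow>
      norm (z - z0) < \<sigma> \<Longrightarrow> norm (f z) \<le> C * M * norm (z - z0) ^ q"
    using Suc.IH[of "\<rho>/2"] Suc.prems by auto
  define K where "K = real CARD('n) * C * (4 * real CARD('m) / \<rho>)"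
  have "K > 0" using C Suc.prems by (simp add: K_def)
  show ?case
  proof (rule exI[of _ K], rule conjI[OF \<open>K > 0\<close>], rule exI[of _ \<sigma>], rule conjI[OF \<open>\<sigma> > 0\<close>],
      intro allI impI)
    fix f :: "complex^'n \<Rightarrow> complex^'m" and M :: real and z
    assume f: "entire f" and M: "\<forall>z. norm (z - z0) < \<rho> \<longrightarrow> norm (f z) \<le> M"
      and van: "\<forall>\<alpha>. multi_order \<alpha> < Suc q \<longrightarrow> multi_partial \<alpha> f z0 = 0" and z: "norm (z - z0) < \<sigma>"
    have M0: "M \<ge> 0" using M Suc.prems order_trans[OF norm_ge_zero, of "f z0" M] by simp
    have partial: "norm (complex_partial i f w) \<le> C * (4 * real CARD('m) * M / \<rho>) * norm (w - z0) ^ q"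
      if w: "norm (w - z0) < \<sigma>" for i w
    proof (rule IH[OF entire_complex_partial[OF f] _ _ w])
      fix w assume w: "norm (w - z0) < \<rho> / 2"
      have "norm (complex_jacobian f w *v axis i 1) \<le> 2 * real CARD('m) * M / (\<rho>/2) * norm (axis i (1::complex) :: complex^'n)"
      proof (rule norm_jacobian_mult_le)
        fix w' assume "w' \<in> ball w (\<rho>/2)"
        then have "norm (w' - z0) < \<rho>" using w dist_triangle[of w' z0 w] by (simp add: dist_norm norm_minus_commute)
        then show "norm (f w') \<le> M" using M by blast
      qed (use Suc.prems in \<open>auto intro: holomorphic_map_subset[OF f]\<close>)
      then show "norm (complex_partial i f w) \<le> 4 * real CARD('m) * M / \<rho>"
        by (simp add: complex_partial_eq_jacobian[OF f])
    next
      fix \<alpha> :: "'n \<Rightarrow> nat" assume "multi_order \<alpha> < q"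
      then show "multi_partial \<alpha> (complex_partial i f) z0 = 0"
        by (simp add: multi_partial_complex_partial[OF f] van multi_order_increment)
    qed
    have "norm (f z - f z0) \<le> K * M * norm (z - z0) ^ q * norm (z - z0)"
    proof (rule differentiable_bound[where S = "cball z0 (norm (z - z0))" and f' = "\<lambda>w h. complex_jacobian f w *v h"])
      fix w assume w: "w \<in> cball z0 (norm (z - z0))"
      show "(f has_derivative (\<lambda>h. complex_jacobian f w *v h)) (at w within cball z0 (norm (z - z0)))"
        using holomorphic_map_has_derivative[OF f] has_derivative_at_withinI by blast
      show "onorm (\<lambda>h. complex_jacobian f w *v h) \<le> K * M * norm (z - z0) ^ q"
      proof (rule onorm_le)
        fix v :: "complex^'n"
        have "complex_jacobian f w *v v = (\<Sum>i\<in>UNIV. v$i *s complex_partial i f w)"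
          by (simp add: vec_eq_iff complex_partial_eq_jacobian[OF f] matrix_vector_mult_axis_nth)
             (simp add: matrix_vector_mult_def mult.commute)
        then have "norm (complex_jacobian f w *v v) \<le> (\<Sum>i\<in>UNIV. norm (v$i *s complex_partial i f w))"
          using norm_sum by metis
        also have "\<dots> \<le> (\<Sum>i\<in>(UNIV::'n set). norm v * (C * (4 * real CARD('m) * M / \<rho>) * norm (z - z0) ^ q))"
        proof (rule sum_mono)
          fix i :: 'n
          have wz: "norm (w - z0) \<le> norm (z - z0)" using w by (simp add: dist_norm norm_minus_commute)
          then have "norm (complex_partial i f w) \<le> C * (4 * real CARD('m) * M / \<rho>) * norm (w - z0) ^ q"
            by (intro partial) (use z in linarith)
          also have "\<dots> \<le> C * (4 * real CARD('m) * M / \<rho>) * norm (z - z0) ^ q"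
            using wz C M0 Suc.prems by (intro mult_left_mono power_mono) auto
          finally show "norm (v$i *s complex_partial i f w) \<le> norm v * (C * (4 * real CARD('m) * M / \<rho>) * norm (z - z0) ^ q)"
            unfolding norm_vector_scalar_mult by (intro mult_mono Finite_Cartesian_Product.norm_nth_le) auto
        qed
        also have "\<dots> = K * M * norm (z - z0) ^ q * norm v" by (simp add: K_def)
        finally show "norm (complex_jacobian f w *v v) \<le> K * M * norm (z - z0) ^ q * norm v" .
      qed
    qed (auto simp: dist_norm norm_minus_commute)
    moreover have "f z0 = 0"
      using van[rule_format, of "\<lambda>_. 0"] multi_partial_zero[of "\<lambda>_. 0" f] by (simp add: multi_order_def)
    ultimately show "norm (f z) \<le> K * M * norm (z - z0) ^ Suc q" by (simp add: mult_ac)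
  qed
qed

section \<open>Automorphisms\<close>

text \<open>
  Local invertibility at a point, expressed by the derivative. Unlike biholomorphy on open sets it can be checked
  pointwise and composed without keeping track of domains.
\<close>

definition regular_at :: "(complex^'n \<Rightarrow> complex^'n) \<Rightarrow> complex^'n \<Rightarrow> bool"
  where "regular_at f z \<longleftrightarrow> (\<exists>A. invertible A \<and> (f has_derivative (\<lambda>h. A *v h)) (at z))"

lemma regular_at_compose:
  assumes "regular_at f z" "regular_at g (f z)" shows "regular_at (\<lambda>z. g (f z)) z"
proof -
  obtain A B where A: "invertible A" "(f has_derivative (\<lambda>h. A *v h)) (at z)"
    and B: "invertible B" "(g has_derivative (\<lambda>h. B *v h)) (at (f z))"
    using assms unfolding regular_at_def by blast
  have "((\<lambda>z. g (f z)) has_derivative (\<lambda>h. (B ** A) *v h)) (at z)"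
    using diff_chain_at[OF A(2) B(2)] by (simp add: o_def matrix_vector_mul_assoc)
  then show ?thesis unfolding regular_at_def using invertible_mult[OF B(1) A(1)] by blast
qed

lemma regular_at_cong:
  assumes "regular_at f z" "open T" "z \<in> T" "\<And>w. w \<in> T \<Longrightarrow> f w = g w" shows "regular_at g z"
  using assms has_derivative_transform_within_open unfolding regular_at_def by meson

lemma regular_at_funpow: "(\<And>z. regular_at f z) \<Longrightarrow> regular_at (f ^^ k) z"
proof (induction k)
  case 0
  have "invertible (mat 1 :: complex^'a^'a)" unfolding invertible_def by (metis matrix_mul_lid)
  moreover have "((\<lambda>z. z) has_derivative (\<lambda>h. mat 1 *v h)) (at z)"
    by (rule has_derivative_eq_rhs[OF has_derivative_ident]) (simp add: fun_eq_iff)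
  ultimately have "regular_at (\<lambda>z. z) z" unfolding regular_at_def by (intro exI conjI)
  then show ?case by (simp only: funpow.simps id_def)
next
  case (Suc k)
  have "regular_at (\<lambda>z. f ((f ^^ k) z)) z" by (rule regular_at_compose[OF Suc.IH Suc.prems]) (rule Suc.prems)
  then show ?case by (simp add: o_def)
qed

text \<open>
  The image is open by invariance of domain, and the inverse is differentiable by the inverse function theorem;
  its derivative is complex linear as the inverse of a complex matrix.
\<close>

lemma biholomorphic_mapI:
  assumes S: "open S" and inj: "inj_on f S" and reg: "\<And>z. z \<in> S \<Longrightarrow> regular_at f z" and T: "f ` S = T"
  shows "biholomorphic_map f S T"
proof -
  have hol: "holomorphic_map_on f S"
    by (rule holomorphic_map_onI) (use reg in \<open>auto simp: regular_at_def\<close>)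
  have "open T" using invariance_of_domain[OF holomorphic_map_continuous[OF hol] S inj] T by simp
  have "holomorphic_map_on (inv_into S f) T"
  proof (rule holomorphic_map_onI)
    fix w assume "w \<in> T"
    then obtain z where z: "z \<in> S" "w = f z" using T by blast
    obtain A where A: "invertible A" "(f has_derivative (\<lambda>h. A *v h)) (at z)"
      using reg[OF z(1)] unfolding regular_at_def by blast
    obtain B where "A ** B = mat 1" using A(1) unfolding invertible_def by blast
    then have "(\<lambda>h. A *v h) \<circ> (\<lambda>h. B *v h) = id"
      by (auto simp: fun_eq_iff matrix_vector_mul_assoc)
    from has_derivative_inverse_strong[OF S z(1) holomorphic_map_continuous[OF hol] _ A(2) this, of "inv_into S f"]
    show "\<exists>A. (inv_into S f has_derivative (\<lambda>h. A *v h)) (at w)"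
      using inj z by auto
  qed
  then show ?thesis using S \<open>open T\<close> inj T hol unfolding biholomorphic_map_def bij_betw_def by blast
qed

lemma holomorphic_automorphismI:
  assumes "inj f" "surj f" "\<And>z. regular_at f z" shows "holomorphic_automorphism f"
  unfolding holomorphic_automorphism_def by (rule biholomorphic_mapI) (use assms in auto)

lemma holomorphic_automorphismD:
  assumes "holomorphic_automorphism f"
  shows "entire f" "entire (inv f)" "bij f"
  using assms by (auto simp: holomorphic_automorphism_def biholomorphic_map_def)

lemma holomorphic_automorphism_regular:
  assumes "holomorphic_automorphism f" shows "regular_at f z"
proof -
  note f = holomorphic_automorphismD[OF assms]
  have A: "(f has_derivative (\<lambda>h. complex_jacobian f z *v h)) (at z)"
    and B: "(inv f has_derivative (\<lambda>h. complex_jacobian (inv f) (f z) *v h)) (at (f z))"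
    using holomorphic_map_has_derivative[OF f(1)] holomorphic_map_has_derivative[OF f(2)] by auto
  have "((\<lambda>z. inv f (f z)) has_derivative (\<lambda>h. (complex_jacobian (inv f) (f z) ** complex_jacobian f z) *v h)) (at z)"
    using diff_chain_at[OF A B] by (simp add: o_def matrix_vector_mul_assoc)
  moreover have "(\<lambda>z. inv f (f z)) = (\<lambda>z. z)" using f(3) by (simp add: bij_def)
  ultimately have "((\<lambda>z. z) has_derivative (\<lambda>h. (complex_jacobian (inv f) (f z) ** complex_jacobian f z) *v h)) (at z)"
    by simp
  from has_derivative_unique[OF this has_derivative_ident]
  have "complex_jacobian (inv f) (f z) ** complex_jacobian f z = mat 1"
    by (metis matrix_vector_mul_lid matrix_eq)
  then show ?thesis using A invertible_left_inverse unfolding regular_at_def by blast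
qed

lemma holomorphic_automorphism_inv:
  assumes "holomorphic_automorphism f" shows "holomorphic_automorphism (inv f)"
  using holomorphic_automorphismD[OF assms]
  by (auto simp: holomorphic_automorphism_def biholomorphic_map_def bij_imp_bij_inv inv_inv_eq)

lemma holomorphic_automorphism_compose:
  assumes "holomorphic_automorphism f" "holomorphic_automorphism g"
  shows "holomorphic_automorphism (\<lambda>z. g (f z))"
proof (rule holomorphic_automorphismI)
  have "bij (g \<circ> f)" using assms[THEN holomorphic_automorphismD(3)] bij_comp by blast
  then show "inj (\<lambda>z. g (f z))" "surj (\<lambda>z. g (f z))" by (auto simp: bij_def o_def)
  show "regular_at (\<lambda>z. g (f z)) z" for z
    by (rule regular_at_compose[OF assms[THEN holomorphic_automorphism_regular]])
qed

lemma forward_comp_shift: "forward_comp f (Suc m) z = forward_comp (\<lambda>j. f (Suc j)) m (f 1 z)"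
  by (induction m) auto

lemma forward_comp_add: "forward_comp f (k + m) z = forward_comp (\<lambda>j. f (j + k)) m (forward_comp f k z)"
  by (induction m) (auto simp: add.commute)

lemma derivative_along_small_steps:
  fixes f :: "'a::real_normed_vector \<Rightarrow> 'b::real_normed_vector"
  assumes der: "(f has_derivative f') (at z)" and "\<rho> > 0" "e > 0" and v: "v \<noteq> 0"
  obtains t where "t > 0" "t * norm v < \<rho>" "norm (f (z + t *\<^sub>R v) - f z - t *\<^sub>R f' v) \<le> t * e"
proof -
  have "e / norm v > 0" using assms by simp
  then obtain d where d: "d > 0" "\<And>y. norm (y - z) < d \<Longrightarrow> norm (f y - f z - f' (y - z)) \<le> e / norm v * norm (y - z)"
    using der unfolding has_derivative_at_alt by blast
  define t where "t = min d \<rho> / (2 * norm v)"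
  have t: "t > 0" "t * norm v < d" "t * norm v < \<rho>" using d \<open>\<rho> > 0\<close> v by (auto simp: t_def field_simps)
  have "f' (t *\<^sub>R v) = t *\<^sub>R f' v"
    using has_derivative_bounded_linear[OF der] by (simp add: bounded_linear.linear linear_cmul)
  then have "norm (f (z + t *\<^sub>R v) - f z - t *\<^sub>R f' v) \<le> t * e"
    using d(2)[of "z + t *\<^sub>R v"] t v by (simp add: mult.commute)
  then show thesis using that t by blast
qed

lemma derivative_lower_bound:
  assumes der: "(f has_derivative f') (at z)" and "\<rho> > 0"
    and f: "\<And>w. norm (w - z) < \<rho> \<Longrightarrow> c * norm (w - z) \<le> norm (f w - f z)"
  shows "c * norm v \<le> norm (f' v)"
proof (cases "v = 0")
  case False
  have "c * norm v \<le> norm (f' v) + e" if e: "e > 0" for e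
  proof -
    obtain t where t: "t > 0" "t * norm v < \<rho>" "norm (f (z + t *\<^sub>R v) - f z - t *\<^sub>R f' v) \<le> t * e"
      by (rule derivative_along_small_steps[OF der \<open>\<rho> > 0\<close> e False])
    have "c * (t * norm v) \<le> norm (f (z + t *\<^sub>R v) - f z)" using f[of "z + t *\<^sub>R v"] t by simp
    then have "t * (c * norm v) \<le> t * (norm (f' v) + e)"
      using norm_triangle_sub[of "f (z + t *\<^sub>R v) - f z" "t *\<^sub>R f' v"] t by (simp add: algebra_simps)
    then show ?thesis using t by simp
  qed
  then show ?thesis by (rule field_le_epsilon)
qed simp

lemma derivative_upper_bound:
  assumes der: "(f has_derivative f') (at z)" and "\<rho> > 0"
    and f: "\<And>w. norm (w - z) < \<rho> \<Longrightarrow> norm (f w - f z) \<le> c * norm (w - z)"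
  shows "norm (f' v) \<le> c * norm v"
proof (cases "v = 0")
  case False
  have "norm (f' v) \<le> c * norm v + e" if e: "e > 0" for e
  proof -
    obtain t where t: "t > 0" "t * norm v < \<rho>" "norm (f (z + t *\<^sub>R v) - f z - t *\<^sub>R f' v) \<le> t * e"
      by (rule derivative_along_small_steps[OF der \<open>\<rho> > 0\<close> e False])
    have "norm (f (z + t *\<^sub>R v) - f z) \<le> c * (t * norm v)" using f[of "z + t *\<^sub>R v"] t by simp
    then have "t * norm (f' v) \<le> t * (c * norm v + e)"
      using norm_triangle_sub[of "t *\<^sub>R f' v" "f (z + t *\<^sub>R v) - f z"] t by (simp add: norm_minus_commute algebra_simps)
    then show ?thesis using t by simp
  qed
  then show ?thesis by (rule field_le_epsilon)
qed (use has_derivative_bounded_linear[OF der] in \<open>simp add: bounded_linear.linear linear_0\<close>)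

section \<open>Comparison with an attracting automorphism\<close>

text \<open>
  The maps of the family \<open>\<F>\<close> are conjugate to the fixed automorphism \<open>G\<close> (with inverse \<open>H\<close>) through \<open>X\<close> up to
  an error of order \<open>q\<close>. A point contracted by \<open>k\<close> maps of the family moves to distance of order \<open>r^k\<close>, so that
  the error committed at time \<open>k\<close> is at most of order \<open>r^(q k)\<close>; pulling it back by \<open>H^k\<close> costs a factor \<open>L^k\<close>.
  Hence the errors stay summable when \<open>L r^q < 1\<close>.

  The assumptions speak of a family instead of a sequence because the estimates are proved by induction on the number of
  maps, passing to the shifted sequence. The constant \<open>K\<close> solves \<open>K = L (K r^q + C)\<close>, the recursion that
  the accumulated error obeys, and the condition on \<open>\<rho>\<close> makes this error a map with Lipschitz constant at most \<open>1/4\<close>.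
\<close>

locale near_conjugacy =
  fixes \<F> :: "(complex^'n \<Rightarrow> complex^'n) set" and G H X :: "complex^'n \<Rightarrow> complex^'n"
    and r C L K \<rho> :: real and q :: nat
  assumes r: "0 < r" "r < 1" and \<rho>: "0 < \<rho>" and q: "2 \<le> q" and C: "0 < C" and L: "1 \<le> L" "L * r ^ q < 1"
    and K_def: "K = L * C / (1 - L * r ^ q)"
    and small: "2 * real CARD('n) * K * 2 ^ q * \<rho> ^ (q - 1) \<le> 1/4"
    and automorphism: "f \<in> \<F> \<Longrightarrow> holomorphic_automorphism f"
    and contraction: "f \<in> \<F> \<Longrightarrow> norm z < \<rho> \<Longrightarrow> norm (f z) \<le> r * norm z"
    and X: "entire X" "X 0 = 0"
    and X_near_id: "norm z < \<rho> \<Longrightarrow> norm w < \<rho> \<Longrightarrow> norm (X z - X w - (z - w)) \<le> 1/4 * norm (z - w)"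
    and G: "holomorphic_automorphism G" "H = inv G"
    and H_Lipschitz: "norm z < 2 * \<rho> \<Longrightarrow> norm w < 2 * \<rho> \<Longrightarrow> norm (H z - H w) \<le> L * norm (z - w)"
    and G_attracting: "(\<lambda>k. (G ^^ k) z) \<longlonglongrightarrow> 0"
    and near: "f \<in> \<F> \<Longrightarrow> norm z < \<rho> \<Longrightarrow> norm (X (f z) - G (X z)) \<le> C * norm z ^ q"
begin

lemma G_H [simp]: "G (H z) = z" "H (G z) = z"
  using holomorphic_automorphismD(3)[OF G(1)] G(2) by (auto simp: bij_def surj_f_inv_f)

lemma G_H_funpow [simp]: "(G ^^ k) ((H ^^ k) z) = z" "(H ^^ k) ((G ^^ k) z) = z"
  by (induction k arbitrary: z) (auto simp: funpow_swap1[symmetric] simp del: funpow.simps(2) simp add: funpow_Suc_right)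

lemma K_props: "K > 0" "L * (K * r ^ q + C) = K" "C \<le> K"
proof -
  have "1 - L * r ^ q > 0" using L by simp
  then show "K > 0" "L * (K * r ^ q + C) = K"
    using C L by (auto simp: K_def field_simps)
  have "L * r ^ q \<ge> 0" using L r by simp
  have "C \<le> L * C" using L C by simp
  also have "\<dots> \<le> K" unfolding K_def using \<open>L * r ^ q \<ge> 0\<close> L C by (simp add: field_simps)
  finally show "C \<le> K" .
qed

lemma error_small: assumes "norm z < \<rho>" shows "K * norm z ^ q \<le> 1/4 * norm z"
proof -
  have "1 \<le> CARD('n)" by (simp add: Suc_leI)
  then have "1 \<le> 2 * real CARD('n)" by linarith
  then have "2 * real CARD('n) * 2 ^ q \<ge> (1::real)"
    using mult_mono[of 1 "2 * real CARD('n)" 1 "2 ^ q"] by simp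
  then have "K * \<rho> ^ (q - 1) * 1 \<le> K * \<rho> ^ (q - 1) * (2 * real CARD('n) * 2 ^ q)"
    using K_props \<rho> by (intro mult_left_mono) auto
  also have "\<dots> \<le> 1/4" using small by (simp add: mult_ac)
  finally have *: "K * \<rho> ^ (q - 1) \<le> 1/4" by simp
  have "K * norm z ^ q = K * norm z ^ (q - 1) * norm z" using q by (cases q) auto
  also have "\<dots> \<le> K * \<rho> ^ (q - 1) * norm z"
    using K_props assms by (intro mult_right_mono mult_left_mono power_mono) auto
  also have "\<dots> \<le> 1/4 * norm z" using * by (intro mult_right_mono) auto
  finally show ?thesis .
qed

lemma X_bound: "norm z < \<rho> \<Longrightarrow> norm (X z) \<le> 5/4 * norm z"
  using X_near_id[of z 0] X \<rho> norm_triangle_sub[of "X z" z] by simp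

definition approximants :: "(nat \<Rightarrow> complex^'n \<Rightarrow> complex^'n) \<Rightarrow> nat \<Rightarrow> complex^'n \<Rightarrow> complex^'n"
  where "approximants f m z = (H ^^ m) (X (forward_comp f m z))"

abbreviation (input) in_family :: "(nat \<Rightarrow> complex^'n \<Rightarrow> complex^'n) \<Rightarrow> bool"
  where "in_family f \<equiv> (\<forall>j\<ge>1. f j \<in> \<F>)"

lemma approximants_0: "approximants f 0 z = X z"
  by (simp add: approximants_def)

lemma approximants_Suc: "approximants f (Suc m) z = H (approximants (\<lambda>j. f (Suc j)) m (f 1 z))"
  by (simp add: approximants_def forward_comp_shift del: forward_comp.simps(2))

lemma contracted: "f \<in> \<F> \<Longrightarrow> norm z < \<rho> \<Longrightarrow> norm (f z) < \<rho>"
proof -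
  assume *: "f \<in> \<F>" "norm z < \<rho>"
  have "norm (f z) \<le> r * norm z" using contraction * by blast
  also have "\<dots> \<le> norm z" using r by (simp add: mult_left_le_one_le)
  finally show ?thesis using * by simp
qed

lemma forward_comp_contracts:
  assumes "in_family f" "norm z < \<rho>" shows "norm (forward_comp f m z) \<le> r ^ m * norm z"
proof (induction m)
  case (Suc m)
  have "r ^ m * norm z \<le> norm z" using r by (simp add: mult_left_le_one_le power_le_one)
  then have "norm (forward_comp f m z) < \<rho>" using Suc assms by simp
  then have "norm (forward_comp f (Suc m) z) \<le> r * norm (forward_comp f m z)"
    using assms contraction by simp
  also have "\<dots> \<le> r * (r ^ m * norm z)" using Suc r by simp
  finally show ?case by simp
qed simp

lemma error_contracts:
  assumes "f \<in> \<F>" "norm z < \<rho>" shows "norm (f z) ^ q \<le> r ^ q * norm z ^ q"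
  using power_mono[OF contraction[OF assms], of q] by (simp add: power_mult_distrib)

lemma G_X_in_range:
  assumes "f \<in> \<F>" "norm z < \<rho>" shows "norm (G (X z)) < 2 * \<rho>"
proof -
  have "norm (G (X z)) \<le> norm (X (f z)) + norm (X (f z) - G (X z))"
    by (metis norm_minus_commute norm_triangle_sub)
  also have "\<dots> \<le> 5/4 * norm (f z) + C * norm z ^ q"
    using near[OF assms] X_bound[OF contracted[OF assms]] by simp
  also have "C * norm z ^ q \<le> K * norm z ^ q" using K_props by (intro mult_right_mono) auto
  also have "\<dots> \<le> 1/4 * norm z" by (rule error_small[OF assms(2)])
  finally show ?thesis using contracted[OF assms] assms(2) \<rho> by linarith
qed

text \<open>
  Peeling off the first map: with \<open>w = f\<^sub>1 z\<close>, the error at \<open>w\<close> is at most \<open>K |w|^q \<le> K r^q |z|^q\<close> by induction, applying \<open>f\<^sub>1\<close>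
  adds \<open>C |z|^q\<close>, and \<open>H\<close> multiplies the total by at most \<open>L\<close>. The estimate also keeps all points in the range where \<open>H\<close> is
  known to be Lipschitz.
\<close>

lemma approximants_near_X:
  assumes "in_family f" "norm z < \<rho>" shows "norm (approximants f m z - X z) \<le> K * norm z ^ q"
  using assms
proof (induction m arbitrary: f z)
  case 0
  then show ?case using K_props by (simp add: approximants_0)
next
  case (Suc m)
  have f1: "f 1 \<in> \<F>" and z: "norm z < \<rho>" using Suc.prems by auto
  let ?y = "approximants (\<lambda>j. f (Suc j)) m (f 1 z)"
  have y: "norm (?y - X (f 1 z)) \<le> K * norm (f 1 z) ^ q"
    by (rule Suc.IH) (use Suc.prems contracted[OF f1] in auto)
  have "norm ?y \<le> norm (X (f 1 z)) + norm (?y - X (f 1 z))" by (rule norm_triangle_sub)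
  also have "\<dots> \<le> 5/4 * norm (f 1 z) + 1/4 * norm (f 1 z)"
    using y X_bound[OF contracted[OF f1 z]] error_small[OF contracted[OF f1 z]] by simp
  finally have y_range: "norm ?y < 2 * \<rho>" using contracted[OF f1 z] \<rho> by linarith
  have "norm (approximants f (Suc m) z - X z) = norm (H ?y - H (G (X z)))"
    by (simp add: approximants_Suc)
  also have "\<dots> \<le> L * norm (?y - G (X z))"
    by (rule H_Lipschitz[OF y_range G_X_in_range[OF f1 z]])
  also have "norm (?y - G (X z)) \<le> norm (?y - X (f 1 z)) + norm (X (f 1 z) - G (X z))"
    using norm_triangle_ineq[of "?y - X (f 1 z)" "X (f 1 z) - G (X z)"] by simp
  also have "\<dots> \<le> K * (r ^ q * norm z ^ q) + C * norm z ^ q"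
    by (intro add_mono near f1 z order_trans[OF y] mult_left_mono error_contracts) (use K_props in auto)
  also have "\<dots> = (K * r ^ q + C) * norm z ^ q" by (simp add: algebra_simps)
  finally have "norm (approximants f (Suc m) z - X z) \<le> L * (K * r ^ q + C) * norm z ^ q"
    using L by (simp add: mult.assoc mult_left_mono)
  then show ?case by (simp only: K_props)
qed

lemma approximants_bound:
  assumes "in_family f" "norm z < \<rho>" shows "norm (approximants f m z) \<le> 3/2 * norm z"
  using approximants_near_X[OF assms, of m] error_small[OF assms(2)] X_bound[OF assms(2)]
    norm_triangle_sub[of "approximants f m z" "X z"] by simp

lemma approximants_step:
  assumes "in_family f" "norm z < \<rho>"
  shows "norm (approximants f (Suc m) z - approximants f m z) \<le> C * L * (L * r ^ q) ^ m * norm z ^ q"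
  using assms
proof (induction m arbitrary: f z)
  case 0
  have f1: "f 1 \<in> \<F>" and z: "norm z < \<rho>" using 0 by auto
  have "norm (approximants f (Suc 0) z - approximants f 0 z) = norm (H (X (f 1 z)) - H (G (X z)))"
    by (simp add: approximants_Suc approximants_0)
  also have "\<dots> \<le> L * norm (X (f 1 z) - G (X z))"
    by (intro H_Lipschitz G_X_in_range[OF f1 z] le_less_trans[OF X_bound[OF contracted[OF f1 z]]])
       (use contracted[OF f1 z] \<rho> in simp)
  also have "\<dots> \<le> L * (C * norm z ^ q)" using near[OF f1 z] L by simp
  finally show ?case by (simp add: mult_ac)
next
  case (Suc m)
  have f1: "f 1 \<in> \<F>" and z: "norm z < \<rho>" using Suc.prems by auto
  let ?f = "\<lambda>j. f (Suc j)" and ?w = "f 1 z"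
  have fam: "in_family ?f" using Suc.prems by auto
  note w = contracted[OF f1 z]
  have range: "norm (approximants ?f k ?w) < 2 * \<rho>" for k
    using approximants_bound[OF fam w, of k] w \<rho> by linarith
  have "norm (approximants f (Suc (Suc m)) z - approximants f (Suc m) z)
      = norm (H (approximants ?f (Suc m) ?w) - H (approximants ?f m ?w))"
    by (simp only: approximants_Suc[of f])
  also have "\<dots> \<le> L * norm (approximants ?f (Suc m) ?w - approximants ?f m ?w)"
    by (intro H_Lipschitz range)
  also have "\<dots> \<le> L * (C * L * (L * r ^ q) ^ m * (r ^ q * norm z ^ q))"
    by (intro mult_left_mono order_trans[OF Suc.IH[OF fam w]] error_contracts f1 z) (use C L r in auto)
  finally show ?case by (simp add: mult_ac)
qed

definition conjugation :: "(nat \<Rightarrow> complex^'n \<Rightarrow> complex^'n) \<Rightarrow> complex^'n \<Rightarrow> complex^'n"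
  where "conjugation f z = X z + (\<Sum>m. approximants f (Suc m) z - approximants f m z)"

lemma approximants_uniform_limit:
  assumes "in_family f"
  shows "uniform_limit (ball 0 \<rho>) (approximants f) (conjugation f) sequentially"
proof -
  have "uniform_limit (ball 0 \<rho>) (\<lambda>n z. \<Sum>m<n. approximants f (Suc m) z - approximants f m z)
      (\<lambda>z. \<Sum>m. approximants f (Suc m) z - approximants f m z) sequentially"
  proof (rule Weierstrass_m_test)
    fix m z assume z: "z \<in> ball (0::complex^'n) \<rho>"
    have "norm (approximants f (Suc m) z - approximants f m z) \<le> C * L * (L * r ^ q) ^ m * norm z ^ q"
      using approximants_step[OF assms] z by simp
    also have "\<dots> \<le> C * L * (L * r ^ q) ^ m * \<rho> ^ q"
      using z C L r by (intro mult_left_mono power_mono) auto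
    finally show "norm (approximants f (Suc m) z - approximants f m z) \<le> C * L * (L * r ^ q) ^ m * \<rho> ^ q" .
  next
    show "summable (\<lambda>m. C * L * (L * r ^ q) ^ m * \<rho> ^ q)"
      using L r by (intro summable_mult summable_mult2 summable_geometric) simp
  qed
  from uniform_limit_add[OF uniform_limit_const this, of "X"]
  have "uniform_limit (ball 0 \<rho>) (\<lambda>n z. X z + (\<Sum>m<n. approximants f (Suc m) z - approximants f m z)) (conjugation f) sequentially"
    unfolding conjugation_def[abs_def] .
  moreover have "X z + (\<Sum>m<n. approximants f (Suc m) z - approximants f m z) = approximants f n z" for n z
    using sum_lessThan_telescope[of "\<lambda>m. approximants f m z" n] by (simp add: approximants_0)
  ultimately show ?thesis by simp
qed

lemma approximants_tendsto:
  "in_family f \<Longrightarrow> norm z < \<rho> \<Longrightarrow> (\<lambda>m. approximants f m z) \<longlonglongrightarrow> conjugation f z"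
  using tendsto_uniform_limitI[OF approximants_uniform_limit] by simp

lemma conjugation_equivariant:
  assumes f: "in_family f" and z: "norm z < \<rho>"
  shows "G (conjugation f z) = conjugation (\<lambda>j. f (Suc j)) (f 1 z)"
proof (rule LIMSEQ_unique)
  have "isCont G x" for x
    using holomorphic_map_continuous[OF holomorphic_automorphismD(1)[OF G(1)]]
    by (simp add: continuous_on_eq_continuous_at)
  then show "(\<lambda>m. G (approximants f (Suc m) z)) \<longlonglongrightarrow> G (conjugation f z)"
    by (rule isCont_tendsto_compose) (rule LIMSEQ_Suc[OF approximants_tendsto[OF f z]])
  show "(\<lambda>m. G (approximants f (Suc m) z)) \<longlonglongrightarrow> conjugation (\<lambda>j. f (Suc j)) (f 1 z)"
    using approximants_tendsto[of "\<lambda>j. f (Suc j)" "f 1 z"] f contracted[of "f 1" z] z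
    by (simp add: approximants_Suc)
qed

lemma conjugation_equivariant_funpow:
  assumes f: "in_family f" and z: "norm z < \<rho>"
  shows "(G ^^ k) (conjugation f z) = conjugation (\<lambda>j. f (j + k)) (forward_comp f k z)"
  using assms
proof (induction k arbitrary: f z)
  case (Suc k)
  have "(G ^^ Suc k) (conjugation f z) = (G ^^ k) (conjugation (\<lambda>j. f (Suc j)) (f 1 z))"
    using conjugation_equivariant[OF Suc.prems] by (simp only: funpow_Suc_right o_apply)
  also have "\<dots> = conjugation (\<lambda>j. f (Suc (j + k))) (forward_comp (\<lambda>j. f (Suc j)) k (f 1 z))"
    using Suc.IH[of "\<lambda>j. f (Suc j)" "f 1 z"] Suc.prems contracted[of "f 1" z] by simp
  finally show ?case by (simp only: forward_comp_shift[symmetric] add_Suc_right)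
qed simp

lemma entire_approximants:
  assumes "in_family f" shows "entire (approximants f m)"
proof -
  have H: "entire H" using holomorphic_automorphismD(2)[OF G(1)] G(2) by simp
  show ?thesis using assms
  proof (induction m arbitrary: f)
    case 0
    then show ?case using X by (simp add: approximants_0[abs_def])
  next
    case (Suc m)
    have "entire (\<lambda>z. approximants (\<lambda>j. f (Suc j)) m (f 1 z))"
      by (rule holomorphic_map_compose[OF holomorphic_automorphismD(1)[OF automorphism] Suc.IH]) (use Suc.prems in auto)
    from holomorphic_map_compose[OF this H]
    show ?case by (simp add: approximants_Suc[abs_def])
  qed
qed

lemma holomorphic_conjugation:
  assumes "in_family f" shows "holomorphic_map_on (conjugation f) (ball 0 \<rho>)"
proof (rule holomorphic_map_uniform_limit[where f = "approximants f"])
  fix z :: "complex^'n" assume "z \<in> ball 0 \<rho>"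
  then obtain e where "e > 0" "ball z e \<subseteq> ball 0 \<rho>" using open_ball open_contains_ball by blast
  then show "\<exists>e>0. (\<forall>k. holomorphic_map_on (approximants f k) (ball z e)) \<and>
      uniform_limit (ball z e) (approximants f) (conjugation f) sequentially"
    using approximants_uniform_limit[OF assms] uniform_limit_on_subset
      holomorphic_map_subset[OF entire_approximants[OF assms]] by blast
qed

lemma conjugation_near_X:
  assumes "in_family f" "norm z < \<rho>" shows "norm (conjugation f z - X z) \<le> K * norm z ^ q"
proof (rule tendsto_upperbound)
  show "(\<lambda>m. norm (approximants f m z - X z)) \<longlonglongrightarrow> norm (conjugation f z - X z)"
    by (intro tendsto_intros approximants_tendsto assms)
qed (use approximants_near_X[OF assms] in auto)

lemma conjugation_near_id:
  assumes f: "in_family f" and xy: "norm x < \<rho>/2" "norm y < \<rho>/2"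
  shows "norm (conjugation f x - conjugation f y - (x - y)) \<le> 1/2 * norm (x - y)"
proof -
  let ?R = "\<lambda>z. conjugation f z - X z"
  have "norm (?R x - ?R y) \<le> 2 * real CARD('n) * K * 2 ^ q * (\<rho>/2) ^ (q - 1) * norm (x - y)"
    by (rule flat_imp_Lipschitz[OF holomorphic_map_diff[OF holomorphic_conjugation[OF f] holomorphic_map_subset[OF X(1)]]])
       (use xy conjugation_near_X[OF f] K_props q \<rho> in auto)
  also have "\<dots> \<le> 2 * real CARD('n) * K * 2 ^ q * \<rho> ^ (q - 1) * norm (x - y)"
    using \<rho> K_props by (intro mult_right_mono mult_left_mono power_mono) auto
  also have "\<dots> \<le> 1/4 * norm (x - y)" using small by (intro mult_right_mono) auto
  finally have "norm (?R x - ?R y) \<le> 1/4 * norm (x - y)" .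
  moreover have "norm (X x - X y - (x - y)) \<le> 1/4 * norm (x - y)" using X_near_id xy \<rho> by simp
  ultimately have "norm ((?R x - ?R y) + (X x - X y - (x - y))) \<le> 1/2 * norm (x - y)"
    using norm_triangle_ineq[of "?R x - ?R y" "X x - X y - (x - y)"] by linarith
  then show ?thesis by (simp add: algebra_simps)
qed

lemma conjugation_0: assumes "in_family f" shows "conjugation f 0 = 0"
  using conjugation_near_X[OF assms, of 0] \<rho> X q by (simp add: power_0_left)

lemma conjugation_inj:
  assumes f: "in_family f" and xy: "norm x < \<rho>/2" "norm y < \<rho>/2" and "conjugation f x = conjugation f y"
  shows "x = y"
  using conjugation_near_id[OF f xy] assms(4) by (simp add: norm_minus_commute)

lemma regular_conjugation:
  assumes f: "in_family f" and z: "norm z < \<rho>/2" shows "regular_at (conjugation f) z"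
proof -
  define A where "A = complex_jacobian (conjugation f) z"
  have der: "(conjugation f has_derivative (\<lambda>h. A *v h)) (at z)"
    unfolding A_def by (rule holomorphic_map_has_derivative[OF holomorphic_conjugation[OF f]]) (use z \<rho> in auto)
  have "1/2 * norm v \<le> norm (A *v v)" for v
  proof (rule derivative_lower_bound[OF der])
    show "0 < \<rho>/2 - norm z" using z by simp
    fix w assume "norm (w - z) < \<rho>/2 - norm z"
    then have "norm w < \<rho>/2" using norm_triangle_sub[of w z] by linarith
    from conjugation_near_id[OF f this z]
    show "1/2 * norm (w - z) \<le> norm (conjugation f w - conjugation f z)"
      using norm_triangle_sub[of "w - z" "conjugation f w - conjugation f z"]
      by (simp add: norm_minus_commute)
  qed
  then have "norm v \<le> 2 * norm (A *v v)" for v by (simp add: field_simps)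
  then have "\<forall>v. A *v v = 0 \<longrightarrow> v = 0" by (metis mult_zero_right norm_le_zero_iff norm_zero)
  then have "invertible A" using invertible_left_inverse matrix_left_invertible_ker by blast
  then show ?thesis unfolding regular_at_def using der by blast
qed

text \<open>
  The equation \<open>\<Phi> x = y\<close> is the fixed point equation of \<open>x \<mapsto> y - (\<Phi> x - x)\<close>, which contracts by \<open>1/2\<close>.
\<close>

lemma conjugation_covers:
  assumes f: "in_family f" and y: "norm y \<le> \<rho>/8"
  obtains x where "norm x < \<rho>/2" "conjugation f x = y"
proof -
  let ?T = "\<lambda>x. y - (conjugation f x - x)"
  have half: "norm (?T x - ?T x') \<le> 1/2 * norm (x - x')" if "norm x < \<rho>/2" "norm x' < \<rho>/2" for x x'
    using conjugation_near_id[OF f that] by (simp add: algebra_simps norm_minus_commute)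
  have "\<exists>!x\<in>cball 0 (\<rho>/4). ?T x = x"
  proof (rule Banach_fix)
    show "complete (cball (0::complex^'n) (\<rho>/4))" by (simp add: complete_eq_closed)
    show "cball (0::complex^'n) (\<rho>/4) \<noteq> {}" using \<rho> by simp
    show "?T ` cball 0 (\<rho>/4) \<subseteq> cball 0 (\<rho>/4)"
    proof clarify
      fix x :: "complex^'n" assume x: "x \<in> cball 0 (\<rho>/4)"
      have "norm (?T x - ?T 0) \<le> 1/2 * norm x" using half[of x 0] x \<rho> by simp
      then have "norm (?T x) \<le> norm y + 1/2 * norm x"
        using norm_triangle_sub[of "?T x" "?T 0"] conjugation_0[OF f] by simp
      then show "?T x \<in> cball 0 (\<rho>/4)" using x y by simp
    qed
    show "dist (?T x) (?T x') \<le> 1/2 * dist x x'" if "x \<in> cball 0 (\<rho>/4)" "x' \<in> cball 0 (\<rho>/4)" for x x'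
      using half[of x x'] that \<rho> by (simp add: dist_norm)
  qed auto
  then obtain x where "x \<in> cball 0 (\<rho>/4)" "?T x = x" by blast
  then show thesis using that[of x] \<rho> by simp
qed

text \<open>
  Once an orbit has entered the small ball, all later maps contract it. In particular the basin is open.
\<close>

lemma basin_eq:
  assumes f: "in_family f"
  shows "basin_of_attraction f 0 = (\<Union>k. {z. norm (forward_comp f k z) < \<rho>/2})"
proof (intro equalityI subsetI)
  fix z assume "z \<in> basin_of_attraction f 0"
  then have "(\<lambda>k. norm (forward_comp f k z)) \<longlonglongrightarrow> 0"
    by (simp add: basin_of_attraction_def tendsto_norm_zero)
  then have "\<forall>\<^sub>F k in sequentially. norm (forward_comp f k z) < \<rho>/2"
    using order_tendstoD(2) \<rho> half_gt_zero by blast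
  then show "z \<in> (\<Union>k. {z. norm (forward_comp f k z) < \<rho>/2})"
    unfolding eventually_sequentially by blast
next
  fix z assume "z \<in> (\<Union>k. {z. norm (forward_comp f k z) < \<rho>/2})"
  then obtain k where "norm (forward_comp f k z) < \<rho>/2" by blast
  then have k: "norm (forward_comp f k z) < \<rho>" using \<rho> by simp
  let ?w = "forward_comp f k z"
  have "(\<lambda>m. r ^ m * norm ?w) \<longlonglongrightarrow> 0 * norm ?w"
    using r by (intro tendsto_mult_right[OF LIMSEQ_realpow_zero]) simp_all
  then have lim: "(\<lambda>m. r ^ m * norm ?w) \<longlonglongrightarrow> 0" by simp
  have "norm (forward_comp (\<lambda>j. f (j + k)) m ?w) \<le> r ^ m * norm ?w" for m
    by (rule forward_comp_contracts) (use f k in auto)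
  then have "(\<lambda>m. forward_comp (\<lambda>j. f (j + k)) m ?w) \<longlonglongrightarrow> 0"
    by (rule Lim_null_comparison[OF always_eventually[OF allI] lim])
  then have "(\<lambda>m. forward_comp f (m + k) z) \<longlonglongrightarrow> 0"
    by (simp add: forward_comp_add add.commute[of _ k])
  then show "z \<in> basin_of_attraction f 0"
    unfolding basin_of_attraction_def by (simp add: LIMSEQ_offset[of _ k])
qed

lemma forward_comp_automorphism:
  assumes "in_family f" shows "holomorphic_automorphism (forward_comp f k)"
proof (induction k)
  case 0
  then show ?case
    by (simp add: holomorphic_automorphism_def biholomorphic_map_def) (simp add: id_def bij_id[unfolded id_def])
next
  case (Suc k)
  from holomorphic_automorphism_compose[OF Suc automorphism[of "f (Suc k)"]] assms
  show ?case by (simp add: o_def)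
qed

lemma forward_comp_stays:
  assumes f: "in_family f" and "norm (forward_comp f k z) < \<rho>/2" "k \<le> l"
  shows "norm (forward_comp f l z) < \<rho>/2"
proof -
  let ?w = "forward_comp f k z"
  obtain m where l: "l = k + m" using assms(3) le_Suc_ex by blast
  have "norm (forward_comp (\<lambda>j. f (j + k)) m ?w) \<le> r ^ m * norm ?w"
    by (rule forward_comp_contracts) (use f assms(2) \<rho> in auto)
  also have "\<dots> \<le> norm ?w" using r by (simp add: mult_left_le_one_le power_le_one)
  finally show ?thesis using assms(2) by (simp add: l forward_comp_add)
qed

text \<open>
  The conjugation extends from a neighbourhood of the origin to the whole basin: follow the orbit for \<open>k\<close> steps until it is
  close to the origin, apply the conjugation of the remaining sequence, and pull back with \<open>H^k\<close>. By equivariance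
  the choice of \<open>k\<close> does not matter.
\<close>

definition pulled_back :: "(nat \<Rightarrow> complex^'n \<Rightarrow> complex^'n) \<Rightarrow> nat \<Rightarrow> complex^'n \<Rightarrow> complex^'n"
  where "pulled_back f k z = (H ^^ k) (conjugation (\<lambda>j. f (j + k)) (forward_comp f k z))"

lemma pulled_back_eq:
  assumes f: "in_family f" and k: "norm (forward_comp f k z) < \<rho>/2" and "k \<le> l"
  shows "pulled_back f l z = pulled_back f k z"
proof -
  obtain m where l: "l = k + m" using assms(3) le_Suc_ex by blast
  let ?f = "\<lambda>j. f (j + k)"
  have "(G ^^ m) (conjugation ?f (forward_comp f k z)) = conjugation (\<lambda>j. ?f (j + m)) (forward_comp ?f m (forward_comp f k z))"
    by (rule conjugation_equivariant_funpow) (use f k \<rho> in auto)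
  then have "conjugation (\<lambda>j. f (j + l)) (forward_comp f l z) = (G ^^ m) (conjugation ?f (forward_comp f k z))"
    by (simp add: l forward_comp_add add_ac)
  then have "pulled_back f l z = (H ^^ (k + m)) ((G ^^ m) (conjugation ?f (forward_comp f k z)))"
    by (simp add: pulled_back_def l)
  then show ?thesis by (simp add: pulled_back_def funpow_add)
qed

definition entry_time :: "(nat \<Rightarrow> complex^'n \<Rightarrow> complex^'n) \<Rightarrow> complex^'n \<Rightarrow> nat"
  where "entry_time f z = (LEAST k. norm (forward_comp f k z) < \<rho>/2)"

lemma pulled_back_entry_time:
  assumes f: "in_family f" and k: "norm (forward_comp f k z) < \<rho>/2"
  shows "pulled_back f (entry_time f z) z = pulled_back f k z"
proof -
  have "norm (forward_comp f (entry_time f z) z) < \<rho>/2" "entry_time f z \<le> k"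
    unfolding entry_time_def by (rule LeastI[of _ k], rule k) (rule Least_le, rule k)
  then show ?thesis using pulled_back_eq[OF f] by metis
qed

text \<open>
  Two points of the basin enter the small ball together after a common number of steps, which gives injectivity.
  For surjectivity, \<open>G^k w\<close> is eventually so small that it has a preimage under the conjugation of the remaining
  sequence, and the first \<open>k\<close> maps are invertible.
\<close>

theorem biholomorphic_basin:
  assumes f: "in_family f"
  shows "biholomorphic (basin_of_attraction f 0) (UNIV :: (complex^'n) set)"
proof -
  let ?\<Omega> = "basin_of_attraction f 0" and ?\<Phi> = "\<lambda>z. pulled_back f (entry_time f z) z"
  have H: "holomorphic_automorphism H" using holomorphic_automorphism_inv[OF G(1)] G(2) by simp
  have fam: "in_family (\<lambda>j. f (j + k))" for k using f by simp
  have near_open: "open {z. norm (forward_comp f k z) < \<rho>/2}" for k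
    using holomorphic_map_continuous[OF holomorphic_automorphismD(1)[OF forward_comp_automorphism[OF f]]]
    by (intro open_Collect_less continuous_intros)
  have "biholomorphic_map ?\<Phi> ?\<Omega> UNIV"
  proof (rule biholomorphic_mapI)
    show "open ?\<Omega>" unfolding basin_eq[OF f] using near_open by blast
    show "inj_on ?\<Phi> ?\<Omega>"
    proof (rule inj_onI)
      fix z w assume zw: "z \<in> ?\<Omega>" "w \<in> ?\<Omega>" and eq: "?\<Phi> z = ?\<Phi> w"
      obtain k1 k2 where k12: "norm (forward_comp f k1 z) < \<rho>/2" "norm (forward_comp f k2 w) < \<rho>/2"
        using zw unfolding basin_eq[OF f] by blast
      define k where "k = max k1 k2"
      have k: "norm (forward_comp f k z) < \<rho>/2" "norm (forward_comp f k w) < \<rho>/2"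
        using forward_comp_stays[OF f k12(1)] forward_comp_stays[OF f k12(2)] by (auto simp: k_def)
      have "pulled_back f k z = pulled_back f k w"
        using eq pulled_back_entry_time[OF f] k by simp
      then have "conjugation (\<lambda>j. f (j + k)) (forward_comp f k z) = conjugation (\<lambda>j. f (j + k)) (forward_comp f k w)"
        unfolding pulled_back_def by (metis G_H_funpow(1))
      then have "forward_comp f k z = forward_comp f k w" using conjugation_inj[OF fam k] by simp
      then show "z = w"
        using holomorphic_automorphismD(3)[OF forward_comp_automorphism[OF f]] by (simp add: bij_def inj_eq)
    qed
    show "regular_at ?\<Phi> z" if "z \<in> ?\<Omega>" for z
    proof -
      obtain k where k: "norm (forward_comp f k z) < \<rho>/2"
        using \<open>z \<in> ?\<Omega>\<close> unfolding basin_eq[OF f] by blast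
      have "regular_at (\<lambda>z. (H ^^ k) (conjugation (\<lambda>j. f (j + k)) (forward_comp f k z))) z"
        by (rule regular_at_compose[OF regular_at_compose[OF
              holomorphic_automorphism_regular[OF forward_comp_automorphism[OF f]]
              regular_conjugation[OF fam k]] regular_at_funpow[OF holomorphic_automorphism_regular[OF H]]])
      then show ?thesis
        by (rule regular_at_cong[OF _ near_open[of k]])
           (use k pulled_back_entry_time[OF f] in \<open>auto simp: pulled_back_def\<close>)
    qed
    show "?\<Phi> ` ?\<Omega> = UNIV"
    proof (intro equalityI subset_UNIV subsetI)
      fix w :: "complex^'n"
      have "(\<lambda>k. norm ((G ^^ k) w)) \<longlonglongrightarrow> 0" using G_attracting tendsto_norm_zero by blast
      then obtain k where "norm ((G ^^ k) w) < \<rho>/8"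
        using order_tendstoD(2)[of _ 0 sequentially "\<rho>/8"] \<rho> unfolding eventually_sequentially by auto
      then obtain x where x: "norm x < \<rho>/2" "conjugation (\<lambda>j. f (j + k)) x = (G ^^ k) w"
        using conjugation_covers[OF fam, of "(G ^^ k) w"] by (metis less_imp_le)
      obtain z where z: "forward_comp f k z = x"
        using holomorphic_automorphismD(3)[OF forward_comp_automorphism[OF f]] by (metis bij_pointE)
      have "?\<Phi> z = pulled_back f k z" using pulled_back_entry_time[OF f] z x by simp
      also have "\<dots> = w" by (simp add: pulled_back_def z x)
      finally show "w \<in> ?\<Phi> ` ?\<Omega>" unfolding basin_eq[OF f] using z x by blast
    qed
  qed
  then show ?thesis unfolding biholomorphic_def by blast
qed

end

section \<open>Triangular automorphisms\<close>

text \<open>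
  The variables carry a rank, and \<open>earlier rk i\<close> keeps those of rank smaller than \<open>i\<close>. A strictly triangular map is one whose
  \<open>i\<close>-th component is a function of these variables only.
\<close>

definition earlier :: "('n \<Rightarrow> nat) \<Rightarrow> 'n \<Rightarrow> complex^'n \<Rightarrow> complex^'n"
  where "earlier rk i z = (\<chi> j. if rk j < rk i then z $ j else 0)"

definition strictly_triangular :: "('n \<Rightarrow> nat) \<Rightarrow> (complex^'n \<Rightarrow> complex^'n) \<Rightarrow> bool"
  where "strictly_triangular rk g \<longleftrightarrow> (\<forall>i z. g z $ i = g (earlier rk i z) $ i)"

lemma earlier_cong: "(\<And>j. rk j < rk i \<Longrightarrow> z $ j = w $ j) \<Longrightarrow> earlier rk i z = earlier rk i w"
  by (simp add: earlier_def vec_eq_iff)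

lemma earlier_diff: "earlier rk i (z - w) = earlier rk i z - earlier rk i w"
  and earlier_idem [simp]: "earlier rk i (earlier rk i z) = earlier rk i z"
  and earlier_0 [simp]: "earlier rk i 0 = 0"
  by (auto simp: earlier_def vec_eq_iff)

lemma earlier_matrix: "earlier rk i z = (\<chi> j l. if j = l \<and> rk j < rk i then 1 else 0) *v z"
proof -
  have "(\<Sum>l\<in>UNIV. (if j = l \<and> rk j < rk i then 1 else 0) * z $ l) = (\<Sum>l\<in>UNIV. if l = j then (if rk j < rk i then z $ j else 0) else 0)" for j
    by (rule sum.cong) auto
  then show ?thesis by (simp add: earlier_def vec_eq_iff matrix_vector_mult_def)
qed

lemma strictly_triangular_add:
  assumes "strictly_triangular rk f" "strictly_triangular rk g"
  shows "strictly_triangular rk (\<lambda>z. f z + g z)"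
  unfolding strictly_triangular_def
proof (intro allI)
  fix i z
  have "f z $ i = f (earlier rk i z) $ i" "g z $ i = g (earlier rk i z) $ i"
    using assms unfolding strictly_triangular_def by blast+
  then show "(f z + g z) $ i = (f (earlier rk i z) + g (earlier rk i z)) $ i" by simp
qed

lemma strictly_triangular_derivative:
  assumes k: "entire k" "strictly_triangular rk k" and "earlier rk i v = 0"
  shows "(complex_jacobian k z *v v) $ i = 0"
proof -
  define P :: "complex^'a^'a" where "P = (\<chi> j l. if j = l \<and> rk j < rk i then 1 else 0)"
  have P: "earlier rk i z = P *v z" for z by (simp add: earlier_matrix P_def)
  note der = holomorphic_map_has_derivative[OF k(1) open_UNIV UNIV_I]
  have "((\<lambda>w. P *v w) has_derivative (\<lambda>h. P *v h)) (at z)"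
    by (rule bounded_linear.has_derivative[OF matrix_vector_mul_bounded_linear has_derivative_ident])
  from diff_chain_at[OF this der]
  have "((\<lambda>w. k (earlier rk i w)) has_derivative (\<lambda>h. complex_jacobian k (earlier rk i z) *v earlier rk i h)) (at z)"
    by (simp add: o_def P)
  from bounded_linear.has_derivative[OF bounded_linear_vec_nth this, of i]
  have "((\<lambda>w. k w $ i) has_derivative (\<lambda>h. (complex_jacobian k (earlier rk i z) *v earlier rk i h) $ i)) (at z)"
    using k(2) by (simp add: strictly_triangular_def flip: )
  moreover have "((\<lambda>w. k w $ i) has_derivative (\<lambda>h. (complex_jacobian k z *v h) $ i)) (at z)"
    by (rule bounded_linear.has_derivative[OF bounded_linear_vec_nth der])
  ultimately have "(\<lambda>h. (complex_jacobian k z *v h) $ i) = (\<lambda>h. (complex_jacobian k (earlier rk i z) *v earlier rk i h) $ i)"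
    using has_derivative_unique by blast
  from fun_cong[OF this, of v] show ?thesis using assms(3) by simp
qed

text \<open>
  Injectivity, surjectivity and invertibility of the derivative are all proved by solving for the
  variables one after the other in the order of the rank.
\<close>

lemma triangular_automorphism:
  fixes k :: "complex^'n \<Rightarrow> complex^'n"
  assumes k: "entire k" "strictly_triangular rk k" and d: "\<And>i. d i \<noteq> 0"
  shows "holomorphic_automorphism (\<lambda>z. (\<chi> i. d i * z $ i) + k z)" (is "holomorphic_automorphism ?G")
proof (rule holomorphic_automorphismI)
  have kE: "k z $ i = k w $ i" if "\<And>j. rk j < rk i \<Longrightarrow> z $ j = w $ j" for z w i
  proof -
    have "earlier rk i z = earlier rk i w" using that by (rule earlier_cong)
    then show ?thesis using k(2) unfolding strictly_triangular_def by metis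
  qed
  show "inj ?G"
  proof (rule injI)
    fix z w assume eq: "?G z = ?G w"
    have "z $ i = w $ i" for i
    proof (induction "rk i" arbitrary: i rule: less_induct)
      case less
      have "k z $ i = k w $ i" by (rule kE) (use less in blast)
      moreover have "d i * z $ i + k z $ i = d i * w $ i + k w $ i"
        using eq by (simp add: vec_eq_iff)
      ultimately show ?case using d by simp
    qed
    then show "z = w" by (simp add: vec_eq_iff)
  qed
  show "surj ?G"
  proof -
    have "\<exists>z. ?G z = w" for w
    proof -
      have "\<exists>z. \<forall>i. rk i < b \<longrightarrow> ?G z $ i = w $ i" for b
      proof (induction b)
        case (Suc b)
        then obtain z where z: "\<And>i. rk i < b \<Longrightarrow> ?G z $ i = w $ i" by blast
        define z' where "z' = (\<chi> i. if rk i < b then z $ i else (w $ i - k z $ i) / d i)"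
        have kz: "k z' $ i = k z $ i" if "rk i \<le> b" for i
          by (rule kE) (use that in \<open>simp add: z'_def\<close>)
        have "?G z' $ i = w $ i" if "rk i < Suc b" for i
        proof (cases "rk i < b")
          case True
          then show ?thesis using z[OF True] kz[of i] by (simp add: z'_def)
        next
          case False
          then show ?thesis using kz[of i] that d by (simp add: z'_def)
        qed
        then show ?case by blast
      qed simp
      then obtain z where "\<forall>i. rk i < Suc (Max (range rk)) \<longrightarrow> ?G z $ i = w $ i" by meson
      then have "?G z = w" by (simp add: vec_eq_iff less_Suc_eq_le)
      then show ?thesis by blast
    qed
    then show ?thesis unfolding surj_def by metis
  qed
  show "regular_at ?G z" for z
  proof -
    define D :: "complex^'n^'n" where "D = (\<chi> i j. if i = j then d i else 0)"
    have D: "D *v z = (\<chi> i. d i * z $ i)" for z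
      by (simp add: D_def matrix_vector_mult_def vec_eq_iff if_distrib[of "\<lambda>x. x * _"] cong: if_cong)
    let ?A = "D + complex_jacobian k z"
    have "((\<lambda>w. D *v w) has_derivative (\<lambda>h. D *v h)) (at z)"
      by (rule bounded_linear.has_derivative[OF matrix_vector_mul_bounded_linear has_derivative_ident])
    from has_derivative_add[OF this holomorphic_map_has_derivative[OF k(1) open_UNIV UNIV_I]]
    have der: "(?G has_derivative (\<lambda>h. ?A *v h)) (at z)"
      by (simp add: D matrix_vector_mult_add_rdistrib)
    have "v = 0" if v: "?A *v v = 0" for v
    proof -
      have "v $ i = 0" for i
      proof (induction "rk i" arbitrary: i rule: less_induct)
        case less
        have "earlier rk i v = 0" using less by (simp add: earlier_def vec_eq_iff)
        then have "(complex_jacobian k z *v v) $ i = 0" by (rule strictly_triangular_derivative[OF k])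
        moreover have "(D *v v) $ i + (complex_jacobian k z *v v) $ i = 0"
          using v by (simp add: matrix_vector_mult_add_rdistrib vec_eq_iff)
        ultimately show ?case using d by (simp add: D)
      qed
      then show ?thesis by (simp add: vec_eq_iff)
    qed
    then have "invertible ?A" using invertible_left_inverse matrix_left_invertible_ker by blast
    then show ?thesis using der unfolding regular_at_def by blast
  qed
qed

lemma contracting_recursion_tendsto_0:
  fixes x :: "nat \<Rightarrow> complex"
  assumes d: "cmod d < 1" and b: "b \<longlonglongrightarrow> 0" and rec: "\<And>m. x (Suc m) = d * x m + b m"
  shows "x \<longlonglongrightarrow> 0"
proof (rule LIMSEQ_I)
  fix e :: real assume e: "e > 0"
  let ?l = "cmod d"
  have "\<forall>\<^sub>F m in sequentially. norm (b m) < e/2 * (1 - ?l)"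
    using order_tendstoD(2)[OF tendsto_norm_zero[OF b], of "e/2 * (1 - ?l)"] d e by simp
  then obtain M where M: "\<And>m. m \<ge> M \<Longrightarrow> norm (b m) < e/2 * (1 - ?l)" unfolding eventually_sequentially by blast
  have bound: "norm (x (M + j)) \<le> ?l ^ j * norm (x M) + e/2" for j
  proof (induction j)
    case (Suc j)
    have "norm (x (M + Suc j)) \<le> ?l * norm (x (M + j)) + norm (b (M + j))"
      using rec[of "M + j"] norm_triangle_ineq[of "d * x (M + j)" "b (M + j)"] by (simp add: norm_mult)
    also have "\<dots> \<le> ?l * (?l ^ j * norm (x M) + e/2) + e/2 * (1 - ?l)"
      using Suc M[of "M + j"] by (intro add_mono mult_left_mono) auto
    finally show ?case by (simp add: algebra_simps diff_divide_distrib)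
  qed (use e in simp)
  have "(\<lambda>j. ?l ^ j * norm (x M)) \<longlonglongrightarrow> 0 * norm (x M)"
    using d by (intro tendsto_mult_right[OF LIMSEQ_realpow_zero]) simp_all
  then have "\<forall>\<^sub>F j in sequentially. ?l ^ j * norm (x M) < e/2"
    using order_tendstoD(2)[of _ 0 sequentially "e/2"] e by simp
  then obtain J where J: "\<And>j. j \<ge> J \<Longrightarrow> ?l ^ j * norm (x M) < e/2" unfolding eventually_sequentially by blast
  have "norm (x m - 0) < e" if "m \<ge> M + J" for m
  proof -
    have "J \<le> m - M" using that by linarith
    from J[OF this] show ?thesis using bound[of "m - M"] that by simp
  qed
  then show "\<exists>no. \<forall>n\<ge>no. norm (x n - 0) < e" by blast
qed

text \<open>
  In the order of the rank, each coordinate of an orbit obeys a contracting affine recursion whose inhomogeneous part depends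
  on the earlier coordinates and therefore tends to zero.
\<close>

lemma triangular_attracting:
  fixes k :: "complex^'n \<Rightarrow> complex^'n"
  assumes k: "entire k" "strictly_triangular rk k" "k 0 = 0" and d: "\<And>i. cmod (d i) < 1"
  shows "(\<lambda>m. ((\<lambda>z. (\<chi> i. d i * z $ i) + k z) ^^ m) z) \<longlonglongrightarrow> 0"
proof -
  let ?z = "\<lambda>m. ((\<lambda>z. (\<chi> i. d i * z $ i) + k z) ^^ m) z"
  have cont: "isCont k 0"
    using holomorphic_map_continuous[OF k(1)] by (simp add: continuous_on_eq_continuous_at)
  have "(\<lambda>m. ?z m $ i) \<longlonglongrightarrow> 0" for i
  proof (induction "rk i" arbitrary: i rule: less_induct)
    case less
    have "(\<lambda>m. earlier rk i (?z m)) \<longlonglongrightarrow> 0"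
    proof (rule vec_tendstoI)
      fix j
      show "(\<lambda>m. earlier rk i (?z m) $ j) \<longlonglongrightarrow> 0 $ j"
        using less[of j] by (cases "rk j < rk i") (simp_all add: earlier_def)
    qed
    from isCont_tendsto_compose[OF cont this]
    have "(\<lambda>m. k (earlier rk i (?z m)) $ i) \<longlonglongrightarrow> 0"
      using tendsto_vec_nth k(3) by fastforce
    moreover have "k (earlier rk i (?z m)) $ i = k (?z m) $ i" for m
      by (rule sym) (rule k(2)[unfolded strictly_triangular_def, rule_format])
    ultimately have b: "(\<lambda>m. k (?z m) $ i) \<longlonglongrightarrow> 0" by (simp only:)
    show ?case by (rule contracting_recursion_tendsto_0[where d = "d i", OF d b]) simp
  qed
  then show ?thesis by (intro vec_tendstoI) simp
qed

section \<open>Triangular normal form\<close>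

lemma flat_components:
  fixes U :: "'n \<Rightarrow> complex^'k \<Rightarrow> complex^'n"
  assumes "\<And>i. flat m (U i)" shows "flat m (\<lambda>z. \<chi> i. U i z $ i)"
proof -
  have "\<forall>i. \<exists>C. \<forall>\<^sub>F z in nhds 0. norm (U i z) \<le> C * norm z ^ m"
    using assms unfolding flat_def by blast
  then obtain C where "\<And>i. \<forall>\<^sub>F z in nhds 0. norm (U i z) \<le> C i * norm z ^ m" by metis
  then have "\<forall>\<^sub>F z in nhds 0. \<forall>i. norm (U i z) \<le> C i * norm z ^ m" by (simp add: eventually_all_finite)
  then have "\<forall>\<^sub>F z in nhds 0. norm (\<chi> i. U i z $ i) \<le> (\<Sum>i\<in>UNIV. C i) * norm z ^ m"
  proof eventually_elim
    case (elim z)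
    have "norm (\<chi> i. U i z $ i) \<le> (\<Sum>i\<in>UNIV. norm (U i z $ i))"
      using norm_le_sum_components[of "\<chi> i. U i z $ i"] by simp
    also have "\<dots> \<le> (\<Sum>i\<in>UNIV. C i * norm z ^ m)"
      using elim Finite_Cartesian_Product.norm_nth_le order_trans by (intro sum_mono) blast
    finally show ?case by (simp add: sum_distrib_right)
  qed
  then show ?thesis unfolding flat_def by blast
qed

definition col_sum :: "complex^'n^'n \<Rightarrow> 'n \<Rightarrow> real"
  where "col_sum T l = (\<Sum>j\<in>UNIV. cmod (T $ j $ l))"

definition l1 :: "complex^'n \<Rightarrow> real"
  where "l1 z = (\<Sum>j\<in>UNIV. cmod (z $ j))"

lemma l1_nonneg: "l1 z \<ge> 0"
  by (simp add: l1_def sum_nonneg)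

lemma norm_le_l1: "norm z \<le> l1 z"
  unfolding l1_def by (rule norm_le_sum_components)

lemma l1_le_norm: "l1 z \<le> real CARD('n) * norm z" for z :: "complex^'n"
  unfolding l1_def using sum_bounded_above[of UNIV "\<lambda>j. cmod (z $ j)" "norm z"]
  by (simp add: Finite_Cartesian_Product.norm_nth_le)

lemma l1_matrix_le:
  assumes "\<And>l. z $ l \<noteq> 0 \<Longrightarrow> col_sum T l \<le> c" shows "l1 (T *v z) \<le> c * l1 z"
proof -
  have "l1 (T *v z) \<le> (\<Sum>j\<in>UNIV. \<Sum>l\<in>UNIV. cmod (T $ j $ l) * cmod (z $ l))"
    unfolding l1_def matrix_vector_mult_def
    by (intro sum_mono) (auto intro!: order_trans[OF norm_sum] simp: norm_mult)
  also have "\<dots> = (\<Sum>l\<in>UNIV. col_sum T l * cmod (z $ l))"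
    by (subst sum.swap) (simp add: col_sum_def sum_distrib_right)
  also have "\<dots> \<le> (\<Sum>l\<in>UNIV. c * cmod (z $ l))"
  proof (rule sum_mono)
    fix l show "col_sum T l * cmod (z $ l) \<le> c * cmod (z $ l)"
      using assms[of l] by (cases "z $ l = 0") (auto intro: mult_right_mono)
  qed
  finally show ?thesis by (simp add: l1_def sum_distrib_left)
qed

text \<open>
  Besides \<open>T\<close> being triangular and contracting in the \<open>l1\<close> norm (whose operator norm is the largest column sum), the sums of the columns
  of the same or later rank are at most as large as the modulus of the \<open>i\<close>-th eigenvalue, up to a factor that one further contraction by
  \<open>\<rho>\<close> turns into \<open>\<theta> < 1\<close>. This replaces the exact sorting of the eigenvalues by modulus.
\<close>

locale graded_triangular =
  fixes T :: "complex^'n^'n" and rk :: "'n \<Rightarrow> nat" and \<rho> \<theta> :: real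
  assumes \<rho>: "0 < \<rho>" "\<rho> < 1" and \<theta>: "0 < \<theta>" "\<theta> < 1"
    and triangular: "T $ i $ l \<noteq> 0 \<Longrightarrow> i = l \<or> rk l < rk i"
    and diagonal: "T $ i $ i \<noteq> 0"
    and contracting: "col_sum T l \<le> \<rho>"
    and graded: "rk i \<le> rk l \<Longrightarrow> col_sum T l * \<rho> \<le> \<theta> * cmod (T $ i $ i)"
begin

abbreviation iter :: "nat \<Rightarrow> complex^'n \<Rightarrow> complex^'n"
  where "iter k \<equiv> (\<lambda>z. T *v z) ^^ k"

lemma iter_Suc': "iter (Suc k) z = iter k (T *v z)"
  by (simp add: funpow_swap1)

lemma iter_diff: "iter k (z - w) = iter k z - iter k w"
  by (induction k) (auto simp: matrix_vector_mult_diff_distrib)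

lemma l1_iter: "l1 (iter k z) \<le> \<rho> ^ k * l1 z"
proof (induction k)
  case (Suc k)
  have "l1 (T *v iter k z) \<le> \<rho> * l1 (iter k z)" by (rule l1_matrix_le) (rule contracting)
  also have "\<dots> \<le> \<rho> * (\<rho> ^ k * l1 z)" using Suc \<rho> by simp
  finally show ?case by simp
qed simp

lemma earlier_invariant:
  assumes "earlier rk i w = 0" shows "earlier rk i (T *v w) = 0"
proof -
  have w: "w $ l = 0" if "rk l < rk i" for l
    using assms that by (auto simp: earlier_def vec_eq_iff split: if_splits)
  have "(T *v w) $ j = 0" if "rk j < rk i" for j
    unfolding matrix_vector_mult_def using triangular[of j] w that by (auto intro!: sum.neutral) fastforce
  then show ?thesis by (simp add: earlier_def vec_eq_iff)
qed

text \<open>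
  The subspace where the variables earlier than \<open>i\<close> vanish is invariant, and on it \<open>T\<close> contracts at a rate
  comparable with its \<open>i\<close>-th eigenvalue.
\<close>

lemma l1_iter_later:
  assumes "earlier rk i w = 0"
  shows "l1 (iter k w) \<le> (\<theta> * cmod (T $ i $ i) / \<rho>) ^ k * l1 w \<and> earlier rk i (iter k w) = 0"
proof (induction k)
  case (Suc k)
  let ?c = "\<theta> * cmod (T $ i $ i) / \<rho>"
  have "l1 (T *v iter k w) \<le> ?c * l1 (iter k w)"
  proof (rule l1_matrix_le)
    fix l assume l: "iter k w $ l \<noteq> 0"
    have "rk i \<le> rk l"
      using Suc l by (auto simp: earlier_def vec_eq_iff split: if_splits) (meson not_le)
    from graded[OF this] show "col_sum T l \<le> ?c" using \<rho> by (simp add: field_simps)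
  qed
  also have "\<dots> \<le> ?c * (?c ^ k * l1 w)" using Suc \<rho> \<theta> by (intro mult_left_mono) auto
  finally show ?case using Suc earlier_invariant by simp
qed (use assms in simp)

lemma earlier_T: "earlier rk i (T *v earlier rk i z) = earlier rk i (T *v z)"
proof -
  have "earlier rk i (T *v (z - earlier rk i z)) = 0"
    by (rule earlier_invariant) (simp add: earlier_diff)
  then show ?thesis by (simp add: matrix_vector_mult_diff_distrib earlier_diff)
qed

lemma l1_earlier_diff: "l1 (z - earlier rk i z) \<le> l1 z" and l1_earlier: "l1 (earlier rk i z) \<le> l1 z"
  unfolding l1_def by (intro sum_mono; simp add: earlier_def)+

lemma entire_iter: "entire (iter k)"
proof (induction k)
  case (Suc k)
  from holomorphic_map_compose[OF this holomorphic_map_matrix[of T UNIV]] show ?case by (simp add: o_def)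
qed (simp add: id_def)

text \<open>
  The formal solution \<open>\<Sum> \<mu>^(-k-1) E \<circ> T^k\<close> of \<open>\<mu> u - u \<circ> T = E\<close> diverges in general because \<open>E \<circ> T^k\<close> may decay more
  slowly than \<open>\<mu>^k\<close>. Subtracting from \<open>E \<circ> T^k\<close> its values on the span of the earlier coordinates leaves a
  difference of values at points whose distance decays like the later eigenvalues, that is at most like \<open>\<mu>^k\<close> up
  to a factor that the vanishing of \<open>E\<close> to second order compensates. What has been subtracted
  only changes the right-hand side by a function of the earlier coordinates.
\<close>

lemma solve_component:
  fixes E :: "complex^'n \<Rightarrow> complex^'m"
  assumes E: "entire E" "flat m E" and m: "m \<ge> 2"
  obtains u where "entire u" "flat m u"
    "\<And>z. E z - T $ i $ i *s u z + u (T *v z) = E (earlier rk i z) - T $ i $ i *s u (earlier rk i z) + u (T *v earlier rk i z)"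
proof -
  define \<mu> where "\<mu> = T $ i $ i"
  have \<mu>: "\<mu> \<noteq> 0" using diagonal by (simp add: \<mu>_def)
  define P where "P = earlier rk i"
  define w where "w k z = E (iter k z) - E (iter k (P z))" for k z
  define t where "t k z = (1/\<mu>) ^ Suc k *s w k z" for k z
  define u where "u z = (\<Sum>k. t k z)" for z
  obtain C \<sigma> where C: "C > 0" "\<sigma> > 0" "\<And>z. norm z < \<sigma> \<Longrightarrow> norm (E z) \<le> C * norm z ^ m"
    using E(2) flatE by blast
  define B where "B = 2 * real CARD('m) * C * 2 ^ m"
  have "B > 0" using C by (simp add: B_def)
  have Lip: "norm (E x - E y) \<le> B * s ^ (m - 1) * norm (x - y)"
    if "norm x \<le> s" "norm y \<le> s" "0 < s" "2 * s \<le> \<sigma>" for x y s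
    unfolding B_def
    by (rule flat_imp_Lipschitz[OF holomorphic_map_subset[OF E(1)] _ _ C(3)]) (use that m C in auto)
  \<comment> \<open>The two points at which \<open>E\<close> is evaluated have size at most \<open>\<rho>^k\<close> and distance at most \<open>(\<theta> |\<mu>| / \<rho>)^k\<close>, up to the size of \<open>z\<close>;
    the Lipschitz constant of \<open>E\<close> on the smaller scale contributes \<open>\<rho>^(k (m - 1)) \<le> \<rho>^k\<close>.\<close>
  have term_bound: "norm (t k z) \<le> B / cmod \<mu> * \<theta> ^ k * l1 z ^ m" if small: "2 * (\<rho> ^ k * l1 z) \<le> \<sigma>" for k z
  proof (cases "l1 z = 0")
    case True
    then have "z = 0" using norm_le_l1[of z] by simp
    then have "w k z = 0" by (simp add: w_def P_def)
    then show ?thesis using True m by (simp add: t_def power_0_left)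
  next
    case False
    then have z: "l1 z > 0" using l1_nonneg[of z] by simp
    let ?s = "\<rho> ^ k * l1 z"
    have "norm (w k z) \<le> B * ?s ^ (m - 1) * norm (iter k z - iter k (P z))"
      unfolding w_def
    proof (rule Lip)
      show "norm (iter k z) \<le> ?s" using norm_le_l1 l1_iter order_trans by blast
      have "l1 (iter k (P z)) \<le> \<rho> ^ k * l1 (P z)" by (rule l1_iter)
      also have "\<dots> \<le> ?s" using l1_earlier[of i z] \<rho> by (simp add: P_def)
      finally show "norm (iter k (P z)) \<le> ?s" using norm_le_l1 order_trans by blast
    qed (use z \<rho> small in auto)
    also have "\<dots> \<le> B * ?s ^ (m - 1) * ((\<theta> * cmod \<mu> / \<rho>) ^ k * l1 z)"
    proof (rule mult_left_mono)
      have "norm (iter k z - iter k (P z)) \<le> l1 (iter k (z - P z))"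
        by (simp add: iter_diff norm_le_l1)
      also have "\<dots> \<le> (\<theta> * cmod \<mu> / \<rho>) ^ k * l1 (z - P z)"
        unfolding \<mu>_def by (rule conjunct1[OF l1_iter_later[of i]]) (simp add: P_def earlier_diff)
      also have "\<dots> \<le> (\<theta> * cmod \<mu> / \<rho>) ^ k * l1 z"
        using l1_earlier_diff[of z i] \<rho> \<theta> by (intro mult_left_mono) (auto simp: P_def)
      finally show "norm (iter k z - iter k (P z)) \<le> (\<theta> * cmod \<mu> / \<rho>) ^ k * l1 z" .
    qed (use \<open>B > 0\<close> z \<rho> in simp)
    also have "B * ?s ^ (m - 1) * ((\<theta> * cmod \<mu> / \<rho>) ^ k * l1 z)
        = B * ((\<rho> ^ (m - 2)) ^ k * (\<theta> * cmod \<mu>) ^ k * l1 z ^ m)"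
    proof -
      obtain m' where m': "m = Suc (Suc m')" using m by (metis Suc_le_D numeral_2_eq_2 Suc_le_mono)
      have "(\<rho> ^ k) ^ (m - 1) * (1 / \<rho>) ^ k = (\<rho> ^ (m - 2)) ^ k"
        using \<rho> by (simp add: m' power_mult_distrib power_divide flip: power_mult) (simp add: power_add mult.commute)
      moreover have "B * ?s ^ (m - 1) * ((\<theta> * cmod \<mu> / \<rho>) ^ k * l1 z)
          = B * (((\<rho> ^ k) ^ (m - 1) * (1 / \<rho>) ^ k) * (\<theta> * cmod \<mu>) ^ k * l1 z ^ m)"
        by (simp add: m' power_mult_distrib power_divide mult_ac)
      ultimately show ?thesis by simp
    qed
    also have "\<dots> \<le> B * (1 * (\<theta> * cmod \<mu>) ^ k * l1 z ^ m)"
      using \<rho> \<theta> \<open>B > 0\<close> z by (intro mult_left_mono mult_right_mono power_le_one) auto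
    finally have "norm (w k z) \<le> B * (\<theta> * cmod \<mu>) ^ k * l1 z ^ m"
      by (simp add: mult_ac)
    then have "norm (t k z) \<le> (1 / cmod \<mu>) ^ Suc k * (B * (\<theta> * cmod \<mu>) ^ k * l1 z ^ m)"
      unfolding t_def norm_vector_scalar_mult norm_power norm_divide norm_one by (intro mult_left_mono) auto
    also have "\<dots> = B / cmod \<mu> * \<theta> ^ k * l1 z ^ m"
      using \<mu> by (simp add: power_mult_distrib power_divide field_simps)
    finally show ?thesis .
  qed
  have sum\<theta>: "summable (\<lambda>k. \<theta> ^ k)" using \<theta> by (intro summable_geometric) simp
  have ev_small: "\<forall>\<^sub>F k in sequentially. 2 * (\<rho> ^ k * R) \<le> \<sigma>" for R
  proof -
    have "(\<lambda>k. 2 * (\<rho> ^ k * R)) \<longlonglongrightarrow> 2 * (0 * R)"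
      by (intro tendsto_intros LIMSEQ_realpow_zero) (use \<rho> in auto)
    then have "\<forall>\<^sub>F k in sequentially. 2 * (\<rho> ^ k * R) < \<sigma>" using order_tendstoD(2) C(2) by fastforce
    then show ?thesis by eventually_elim simp
  qed
  have unif: "uniform_limit (ball z0 1) (\<lambda>n z. \<Sum>k<n. t k z) u sequentially" for z0
  proof -
    define R where "R = real CARD('n) * (norm z0 + 1)"
    have R: "l1 z \<le> R" if "z \<in> ball z0 1" for z
    proof -
      have "norm z \<le> norm z0 + 1" using that norm_triangle_sub[of z z0] by (simp add: dist_norm norm_minus_commute)
      then show ?thesis unfolding R_def using l1_le_norm[of z] by (meson mult_left_mono of_nat_0_le_iff order_trans)
    qed
    have "uniform_limit (ball z0 1) (\<lambda>n z. \<Sum>k<n. t k z) (\<lambda>z. \<Sum>k. t k z) sequentially"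
    proof (rule Weierstrass_m_test_ev)
      show "summable (\<lambda>k. B / cmod \<mu> * \<theta> ^ k * R ^ m)" by (intro summable_mult summable_mult2 sum\<theta>)
      show "\<forall>\<^sub>F k in sequentially. \<forall>z\<in>ball z0 1. norm (t k z) \<le> B / cmod \<mu> * \<theta> ^ k * R ^ m"
        using ev_small[of R]
      proof eventually_elim
        case (elim k)
        show ?case
        proof
          fix z assume z: "z \<in> ball z0 1"
          have "\<rho> ^ k * l1 z \<le> \<rho> ^ k * R" using R[OF z] \<rho> by simp
          then have "norm (t k z) \<le> B / cmod \<mu> * \<theta> ^ k * l1 z ^ m" using elim by (intro term_bound) linarith
          also have "\<dots> \<le> B / cmod \<mu> * \<theta> ^ k * R ^ m"
            using R[OF z] l1_nonneg[of z] \<open>B > 0\<close> \<theta> by (intro mult_left_mono power_mono) auto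
          finally show "norm (t k z) \<le> B / cmod \<mu> * \<theta> ^ k * R ^ m" .
        qed
      qed
    qed
    then show ?thesis by (simp add: u_def[abs_def])
  qed
  have P_hol: "entire P" unfolding P_def earlier_matrix[abs_def] by simp
  have t_hol: "entire (t k)" for k
    unfolding t_def[abs_def] w_def
    by (intro holomorphic_map_cmul holomorphic_map_diff holomorphic_map_compose[OF entire_iter E(1)]
        holomorphic_map_compose[OF holomorphic_map_compose[OF P_hol entire_iter] E(1)]) auto
  have sum_hol: "entire (\<lambda>z. \<Sum>k<n. t k z)" for n
    by (induction n) (auto intro!: holomorphic_map_add t_hol)
  have u_hol: "entire u"
    by (rule holomorphic_map_uniform_limit[where f = "\<lambda>n z. \<Sum>k<n. t k z"])
       (use unif holomorphic_map_subset[OF sum_hol subset_UNIV] zero_less_one in blast)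
  have summ: "summable (\<lambda>k. t k z)" for z
  proof (rule summable_comparison_test_ev)
    show "\<forall>\<^sub>F k in sequentially. norm (t k z) \<le> B / cmod \<mu> * \<theta> ^ k * l1 z ^ m"
      using ev_small[of "l1 z"] by eventually_elim (rule term_bound)
    show "summable (\<lambda>k. B / cmod \<mu> * \<theta> ^ k * l1 z ^ m)" by (intro summable_mult summable_mult2 sum\<theta>)
  qed
  have u_flat: "flat m u"
  proof (rule flatI)
    let ?n = "real CARD('n)"
    show "\<sigma> / (2 * ?n) > 0" using C by simp
    fix z :: "complex^'n" assume z: "norm z < \<sigma> / (2 * ?n)"
    have "2 * l1 z \<le> \<sigma>" using z l1_le_norm[of z] by (simp add: field_simps)
    moreover have "\<rho> ^ k * l1 z \<le> l1 z" for k
      by (rule mult_left_le_one_le) (use \<rho> in \<open>auto simp: l1_nonneg power_le_one\<close>)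
    ultimately have small: "2 * (\<rho> ^ k * l1 z) \<le> \<sigma>" for k by (meson mult_left_mono order_trans zero_le_numeral)
    have sm: "summable (\<lambda>k. B / cmod \<mu> * \<theta> ^ k * l1 z ^ m)" by (intro summable_mult summable_mult2 sum\<theta>)
    have "norm (u z) \<le> (\<Sum>k. B / cmod \<mu> * \<theta> ^ k * l1 z ^ m)"
      unfolding u_def by (rule norm_suminf_le[OF term_bound[OF small] sm])
    also have "\<dots> = B / cmod \<mu> * (\<Sum>k. \<theta> ^ k) * l1 z ^ m"
      by (rule sums_unique[OF sums_mult2[OF sums_mult[OF summable_sums[OF sum\<theta>]]], symmetric])
    also have "\<dots> \<le> B / cmod \<mu> * (\<Sum>k. \<theta> ^ k) * (?n * norm z) ^ m"
      using \<open>B > 0\<close> \<theta> l1_nonneg[of z] l1_le_norm[of z] suminf_nonneg[OF sum\<theta>]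
      by (intro mult_left_mono power_mono) auto
    finally show "norm (u z) \<le> B / cmod \<mu> * (\<Sum>k. \<theta> ^ k) * ?n ^ m * norm z ^ m"
      by (simp add: power_mult_distrib mult_ac)
  qed
  have "E z - \<mu> *s u z + u (T *v z) = E (P z) - \<mu> *s u (P z) + u (T *v P z)" for z
  proof -
    have uP: "u (P z) = 0" by (simp add: u_def t_def w_def P_def)
    \<comment> \<open>The values subtracted from \<open>E (T^(k+1) z)\<close> on both sides agree because the earlier coordinates of \<open>T z\<close> only
      depend on the earlier coordinates of \<open>z\<close>.\<close>
    have shift: "t k (T *v z) - t k (T *v P z) = \<mu> *s t (Suc k) z" for k
    proof -
      have "w k (T *v z) - w k (T *v P z) = w (Suc k) z"
        unfolding w_def iter_Suc' by (simp add: P_def earlier_T)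
      moreover have "t k (T *v z) - t k (T *v P z) = (1/\<mu>) ^ Suc k *s (w k (T *v z) - w k (T *v P z))"
        by (simp add: t_def vector_ssub_ldistrib)
      moreover have "\<mu> *s t (Suc k) z = (1/\<mu>) ^ Suc k *s w (Suc k) z"
        using \<mu> by (simp add: t_def vector_smult_assoc)
      ultimately show ?thesis by metis
    qed
    have cm: "bounded_linear (\<lambda>v. \<mu> *s (v :: complex^'m))"
      by (rule bounded_linear_intro[of _ "cmod \<mu>"])
         (simp_all add: vector_add_ldistrib vec_eq_iff norm_vector_scalar_mult)
    have "u (T *v z) - u (T *v P z) = (\<Sum>k. \<mu> *s t (Suc k) z)"
      unfolding u_def shift[symmetric] by (rule suminf_diff[OF summ summ])
    also have "\<dots> = \<mu> *s (\<Sum>k. t (Suc k) z)"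
      by (rule bounded_linear.suminf[OF cm, symmetric]) (rule iffD2[OF summable_Suc_iff[of "\<lambda>k. t k z"] summ])
    also have "(\<Sum>k. t (Suc k) z) = u z - t 0 z"
      unfolding u_def using suminf_split_head[OF summ] by simp
    also have "\<mu> *s (u z - t 0 z) = \<mu> *s u z - (E z - E (P z))"
      using \<mu> by (simp add: vector_ssub_ldistrib t_def w_def vector_smult_assoc)
    finally show ?thesis using uP by (simp add: algebra_simps)
  qed
  then show thesis using that[OF u_hol u_flat] by (simp add: \<mu>_def P_def)
qed

text \<open>The equation is solved component by component, in the order of the rank: row \<open>i\<close> of \<open>T h\<close> only involves the components of \<open>h\<close> of
  smaller rank besides \<open>h_i\<close> itself.\<close>

lemma homological_equation:
  fixes E :: "complex^'n \<Rightarrow> complex^'n"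
  assumes E: "entire E" "flat m E" and m: "m \<ge> 2"
  obtains h g where "entire h" "flat m h" "entire g" "flat m g"
    "strictly_triangular rk g" "\<And>z. T *v h z - h (T *v z) + g z = E z"
proof -
  let ?g = "\<lambda>h z. E z - T *v h z + h (T *v z)"
  have T_row: "(T *v x) $ i = (T *v y) $ i" if "\<And>l. l = i \<or> rk l < rk i \<Longrightarrow> x $ l = y $ l" for x y i
    unfolding matrix_vector_mult_def using triangular[of i] that by (auto intro!: sum.cong) metis
  have "\<exists>h. entire h \<and> flat m h \<and> (\<forall>i z. rk i \<ge> b \<longrightarrow> h z $ i = 0) \<and>
      (\<forall>i z. rk i < b \<longrightarrow> ?g h z $ i = ?g h (earlier rk i z) $ i)" for b
  proof (induction b)
    case 0
    show ?case by (intro exI[of _ "\<lambda>z. 0"]) auto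
  next
    case (Suc b)
    then obtain h where h: "entire h" "flat m h" "\<And>i z. rk i \<ge> b \<Longrightarrow> h z $ i = 0"
      "\<And>i z. rk i < b \<Longrightarrow> ?g h z $ i = ?g h (earlier rk i z) $ i" by blast
    let ?E = "\<lambda>z. E z - T *v h z"
    have E': "entire ?E" "flat m ?E"
      using holomorphic_map_diff[OF E(1) holomorphic_map_compose[OF h(1) holomorphic_map_matrix[of T UNIV]]]
        flat_diff[OF E(2) flat_matrix[OF h(2)]] by auto
    have "\<forall>i. \<exists>u. entire u \<and> flat m u \<and> (\<forall>z. ?E z - T $ i $ i *s u z + u (T *v z)
       = ?E (earlier rk i z) - T $ i $ i *s u (earlier rk i z) + u (T *v earlier rk i z))"
      using solve_component[OF E' m] by (metis (no_types, lifting))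
    then obtain u where u: "\<And>i. entire (u i)" "\<And>i. flat m (u i)"
      "\<And>i z. ?E z - T $ i $ i *s u i z + u i (T *v z)
       = ?E (earlier rk i z) - T $ i $ i *s u i (earlier rk i z) + u i (T *v earlier rk i z)"
      by metis
    define U where "U i = (if rk i = b then u i else h)" for i
    define h' where "h' z = (\<chi> i. U i z $ i)" for z
    have h'_hol: "entire h'" unfolding h'_def
      by (rule holomorphic_map_components[where k = "\<lambda>i. i"]) (auto simp: U_def u h)
    have h'_flat: "flat m h'" unfolding h'_def by (rule flat_components) (auto simp: U_def u h)
    have "?g h' z $ i = ?g h' (earlier rk i z) $ i" if i: "rk i < Suc b" for i z
    proof (cases "rk i = b")
      case True
      have "(T *v h' z) $ i = (T *v h z) $ i + T $ i $ i * u i z $ i" for z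
      proof -
        have "(T *v h' z) $ i = (T *v (h z + axis i (u i z $ i))) $ i"
          by (rule T_row) (use True h(3)[of i] in \<open>auto simp: h'_def U_def axis_def\<close>)
        also have "\<dots> = (T *v h z) $ i + T $ i $ i * u i z $ i"
          by (simp add: matrix_vector_right_distrib matrix_vector_mult_def axis_def if_distrib[of "\<lambda>x. _ * x"] sum.distrib distrib_left cong: if_cong)
        finally show ?thesis .
      qed
      moreover have "h' w $ i = u i w $ i" for w using True by (simp add: h'_def U_def)
      ultimately show ?thesis using arg_cong[OF u(3)[of z i], of "\<lambda>v. v $ i"]
        by (simp add: algebra_simps)
    next
      case False
      then have i: "rk i < b" using i by simp
      have "(T *v h' z) $ i = (T *v h z) $ i" for z
        by (rule T_row) (use i in \<open>auto simp: h'_def U_def\<close>)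
      moreover have "h' w $ i = h w $ i" for w using i by (simp add: h'_def U_def)
      ultimately show ?thesis using h(4)[OF i, of z] by simp
    qed
    moreover have "h' z $ i = 0" if "rk i \<ge> Suc b" for i z
      using that h(3) by (simp add: h'_def U_def)
    ultimately show ?case using h'_hol h'_flat by blast
  qed
  from this[of "Suc (Max (range rk))"] obtain h where h: "entire h" "flat m h"
    "\<And>i z. ?g h z $ i = ?g h (earlier rk i z) $ i"
    by (auto simp: less_Suc_eq_le)
  have T1: "flat 1 (\<lambda>z. T *v z)" by (rule flat_1_holomorphic) auto
  show thesis
  proof (rule that[OF h(1,2)])
    show "entire (?g h)"
      by (rule holomorphic_map_add[OF holomorphic_map_diff])
         (rule E(1) holomorphic_map_compose[OF holomorphic_map_matrix h(1) subset_UNIV]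
           holomorphic_map_compose[OF h(1) holomorphic_map_matrix subset_UNIV])+
    show "flat m (?g h)" by (intro flat_add flat_diff E flat_matrix h flat_compose[OF h(2) T1])
    show "strictly_triangular rk (?g h)" unfolding strictly_triangular_def using h(3) by blast
  qed simp
qed

text \<open>
  Poincare's successive elimination: if \<open>X\<close> conjugates \<open>F\<close> to \<open>T + g\<close> up to an error \<open>E\<close> of order \<open>m\<close>, then adding to \<open>X\<close>
  and \<open>g\<close> the solution of the homological equation for \<open>E\<close> leaves an error of order \<open>m + 1\<close>.
\<close>

lemma triangular_normal_form:
  assumes F: "entire F" "F 0 = 0" "(F has_derivative (\<lambda>h. T *v h)) (at 0)" and m: "m \<ge> 2"
  obtains X g where "entire X" "flat 2 (\<lambda>z. X z - z)"
    "entire g" "flat 2 g" "strictly_triangular rk g"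
    "flat m (\<lambda>z. X (F z) - (T *v X z + g (X z)))"
proof -
  have F2: "flat 2 (\<lambda>z. F z - T *v z)" by (rule flat_2_jacobian[OF F])
  have F1: "flat 1 F" by (rule flat_1_holomorphic[OF F(1,2)])
  have T1: "flat 1 (\<lambda>z. T *v z)" by (rule flat_1_holomorphic) auto
  have id1: "flat 1 (\<lambda>z. z)" by (rule flat_1_holomorphic) auto
  have "\<exists>X g. entire X \<and> flat 2 (\<lambda>z. X z - z) \<and> entire g \<and> flat 2 g \<and>
      strictly_triangular rk g \<and> flat m (\<lambda>z. X (F z) - (T *v X z + g (X z)))"
    using m
  proof (induction m rule: dec_induct)
    case base
    show ?case
      by (intro exI[of _ "\<lambda>z. z"] exI[of _ "\<lambda>z. 0"]) (use F2 in \<open>simp add: strictly_triangular_def\<close>)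
  next
    case (step m)
    then obtain X g where X: "entire X" "flat 2 (\<lambda>z. X z - z)"
      and g: "entire g" "flat 2 g" "strictly_triangular rk g"
      and err: "flat m (\<lambda>z. X (F z) - (T *v X z + g (X z)))" by blast
    let ?E = "\<lambda>z. X (F z) - (T *v X z + g (X z))"
    have E_hol: "entire ?E"
      by (rule holomorphic_map_diff[OF _ holomorphic_map_add])
         (rule holomorphic_map_compose[OF F(1) X(1) subset_UNIV] holomorphic_map_compose[OF X(1) g(1) subset_UNIV]
           holomorphic_map_compose[OF X(1) holomorphic_map_matrix subset_UNIV])+
    obtain h k where h: "entire h" "flat m h" and k: "entire k" "flat m k"
        "strictly_triangular rk k" and eq: "\<And>z. T *v h z - h (T *v z) + k z = ?E z"
      by (rule homological_equation[OF E_hol err step(1)]) (rule that; assumption)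
    let ?X = "\<lambda>z. X z + h z" and ?g = "\<lambda>z. g z + k z"
    have h2: "flat 2 h" and k2: "flat 2 k" using flat_mono[OF h(2)] flat_mono[OF k(2)] step(1) by auto
    have X2: "flat 2 (\<lambda>z. ?X z - z)" using flat_add[OF X(2) h2] by (simp add: algebra_simps)
    have X1: "flat 1 X" "flat 1 ?X"
      using flat_add[OF flat_mono[OF X(2)] id1] flat_add[OF flat_mono[OF X2] id1] by auto
    have "flat (m - 1 + 2) (\<lambda>z. h (F z) - h (T *v z))"
      by (rule flat_difference[OF h _ F1 T1 F2]) (use step in simp)
    moreover have "flat (2 - 1 + m) (\<lambda>z. g (?X z) - g (X z))"
      by (rule flat_difference[OF g(1,2) _ X1(2,1)]) (use h(2) in auto)
    moreover have "flat (m - 1 + 2) (\<lambda>z. k (?X z) - k z)"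
      by (rule flat_difference[OF k(1,2) _ X1(2) id1 X2]) (use step in simp)
    moreover have "m - 1 + 2 = Suc m" "2 - 1 + m = Suc m" using step by auto
    ultimately have "flat (Suc m) (\<lambda>z. (h (F z) - h (T *v z)) - (g (?X z) - g (X z)) - (k (?X z) - k z))"
      by - (rule flat_diff[OF flat_diff]; simp)
    also have "(\<lambda>z. (h (F z) - h (T *v z)) - (g (?X z) - g (X z)) - (k (?X z) - k z))
        = (\<lambda>z. ?X (F z) - (T *v ?X z + ?g (?X z)))"
    proof
      fix z
      show "(h (F z) - h (T *v z)) - (g (?X z) - g (X z)) - (k (?X z) - k z) = ?X (F z) - (T *v ?X z + ?g (?X z))"
        using eq[of z] by (simp add: matrix_vector_right_distrib algebra_simps)
    qed
    finally have "flat (Suc m) (\<lambda>z. ?X (F z) - (T *v ?X z + ?g (?X z)))" .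
    moreover have "entire ?X" "entire ?g" "flat 2 ?g" "strictly_triangular rk ?g"
      using X h g k k2 by (auto intro: holomorphic_map_add flat_add strictly_triangular_add)
    ultimately show ?case using X2
      by (intro exI[of _ ?X] exI[of _ ?g]) simp
  qed
  then show thesis using that by blast
qed

end

section \<open>Triangularization with almost sorted eigenvalues\<close>

text \<open>
  The vector \<open>p(A) u\<close>, evaluated by Horner's scheme.
\<close>

definition poly_action :: "complex^'n^'n \<Rightarrow> complex poly \<Rightarrow> complex^'n \<Rightarrow> complex^'n"
  where "poly_action A p u = fold_coeffs (\<lambda>a v. a *s u + A *v v) p 0"

lemma poly_action_0 [simp]: "poly_action A 0 u = 0"
  by (simp add: poly_action_def)

lemma poly_action_pCons [simp]: "poly_action A (pCons a p) u = a *s u + A *v poly_action A p u"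
proof (cases "a = 0 \<and> p = 0")
  case False
  then show ?thesis by (auto simp: poly_action_def fold_coeffs_def cCons_def)
qed simp

lemma poly_action_add: "poly_action A (p + q) u = poly_action A p u + poly_action A q u"
proof (induction p arbitrary: q)
  case (pCons a p)
  show ?case by (cases q) (simp add: pCons vector_sadd_rdistrib matrix_vector_right_distrib)
qed simp

lemma poly_action_smult: "poly_action A (smult c p) u = c *s poly_action A p u"
  by (induction p) (simp_all add: vector_add_ldistrib vector_smult_assoc vector_scalar_commute)

lemma poly_action_linear_factor:
  "poly_action A ([:- c, 1:] * p) u = A *v poly_action A p u - c *s poly_action A p u"
proof -
  have "[:- c, 1:] * p = smult (- c) p + pCons 0 p" by simp
  then show ?thesis by (simp only: poly_action_add poly_action_smult poly_action_pCons) simp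
qed

lemma poly_action_monom: "poly_action A (monom c i) u = c *s ((\<lambda>v. A *v v) ^^ i) u"
proof (induction i)
  case (Suc i)
  then show ?case by (simp add: monom_Suc vector_scalar_commute)
qed (simp add: monom_0)

lemma poly_action_sum: "poly_action A (\<Sum>i\<in>I. p i) u = (\<Sum>i\<in>I. poly_action A (p i) u)"
  by (induction I rule: infinite_finite_induct) (simp_all add: poly_action_add)

text \<open>
  The \<open>n + 1\<close> vectors \<open>u, A u, \<dots>, A^n u\<close> are linearly dependent, or two of them coincide.
\<close>

lemma annihilating_polynomial:
  obtains p where "p \<noteq> 0" "poly_action A p u = 0"
proof -
  define f where "f i = ((\<lambda>v. A *v v) ^^ i) u" for i
  let ?n = "CARD('a)"
  show thesis
  proof (cases "inj_on f {..?n}")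
    case False
    then obtain i j where ij: "i \<noteq> j" "f i = f j" unfolding inj_on_def by blast
    let ?p = "monom 1 i + monom (-1) j :: complex poly"
    have "coeff ?p i = 1" using ij by simp
    then have "?p \<noteq> 0" by (metis coeff_0 zero_neq_one)
    moreover have "poly_action A ?p u = 0"
      using ij(2) by (simp add: poly_action_add poly_action_monom f_def)
    ultimately show thesis by (rule that)
  next
    case True
    have "vec.dim (UNIV :: (complex^'a) set) < card (f ` {..?n})"
      using True by (simp add: card_image card_cart_basis)
    then have "vec.dependent (f ` {..?n})"
      by (metis finite_atMost finite_imageI subset_UNIV vec.dim_subset_UNIV vec.independent_card_le_dim not_le)
    then obtain a v where a: "(\<Sum>w\<in>f ` {..?n}. a w *s w) = 0" "v \<in> f ` {..?n}" "a v \<noteq> 0"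
      using vec.dependent_finite[of "f ` {..?n}"] by auto
    let ?p = "\<Sum>i\<le>?n. monom (a (f i)) i"
    obtain i where i: "i \<le> ?n" "v = f i" using a by auto
    have "coeff ?p i = a (f i)" using i by (simp add: coeff_sum)
    then have "?p \<noteq> 0" using a(3) i by (metis coeff_0)
    moreover have "poly_action A ?p u = 0"
      using a(1) sum.reindex[OF True, of "\<lambda>w. a w *s w"]
      by (simp add: poly_action_sum poly_action_monom flip: f_def)
    ultimately show thesis by (rule that)
  qed
qed

text \<open>Eigenvalues of the map that \<open>A\<close> induces on the quotient by an invariant subspace \<open>W\<close>.\<close>

definition quotient_eigenvalues :: "complex^'n^'n \<Rightarrow> (complex^'n) set \<Rightarrow> complex set"
  where "quotient_eigenvalues A W = {c. \<exists>v. v \<notin> W \<and> A *v v - c *s v \<in> W}"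

text \<open>
  Splitting off linear factors from a polynomial \<open>p\<close> with \<open>p(A) u \<in> W\<close>, there is a last factor at which the vector is
  still outside \<open>W\<close>.
\<close>

lemma quotient_eigenvalue_exists:
  assumes W: "vec.subspace W" and u: "u \<notin> W"
  shows "quotient_eigenvalues A W \<noteq> {}"
proof -
  have "quotient_eigenvalues A W \<noteq> {}" if "p \<noteq> 0" "poly_action A p u \<in> W" for p
    using that
  proof (induction "degree p" arbitrary: p rule: less_induct)
    case less
    show ?case
    proof (cases "degree p = 0")
      case True
      then obtain c where p: "p = [:c:]" using degree_eq_zeroE by blast
      then have "c \<noteq> 0" "c *s u \<in> W" using less.prems by auto
      then have "(1/c) *s (c *s u) \<in> W" using W vec.subspace_scale by blast
      then show ?thesis using u \<open>c \<noteq> 0\<close> by (simp add: vector_smult_assoc)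
    next
      case False
      then obtain c where "poly p c = 0"
        using False fundamental_theorem_of_algebra[of p] constant_degree[of p] by auto
      then obtain q where q: "p = [:- c, 1:] * q" using poly_eq_0_iff_dvd by (metis dvdE)
      then have "q \<noteq> 0" using less.prems by auto
      then have deg: "degree q < degree p" unfolding q by (subst degree_mult_eq) auto
      show ?thesis
      proof (cases "poly_action A q u \<in> W")
        case True
        then show ?thesis using less.hyps deg \<open>q \<noteq> 0\<close> by blast
      next
        case False
        moreover have "A *v poly_action A q u - c *s poly_action A q u \<in> W"
          using less.prems(2) unfolding q poly_action_linear_factor .
        ultimately show ?thesis unfolding quotient_eigenvalues_def by blast
      qed
    qed
  qed
  moreover obtain p where "p \<noteq> 0" "poly_action A p u = 0" by (rule annihilating_polynomial)
  ultimately show ?thesis using vec.subspace_0[OF W] by metis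
qed

text \<open>
  The span of the first \<open>k\<close> vectors of a sequence, with explicit coefficients, since the triangular matrix is made of them.
\<close>

definition lin_span :: "(nat \<Rightarrow> complex^'n) \<Rightarrow> nat \<Rightarrow> (complex^'n) set"
  where "lin_span b k = range (\<lambda>x. \<Sum>i<k. x i *s b i)"

lemma lin_spanI: "(\<Sum>i<k. x i *s b i) \<in> lin_span b k"
  by (auto simp: lin_span_def)

lemma subspace_lin_span: "vec.subspace (lin_span b k)"
proof (rule vec.subspaceI)
  show "0 \<in> lin_span b k" using lin_spanI[of "\<lambda>_. 0" b k] by simp
next
  fix v w assume "v \<in> lin_span b k" "w \<in> lin_span b k"
  then obtain x y where "v = (\<Sum>i<k. x i *s b i)" "w = (\<Sum>i<k. y i *s b i)" unfolding lin_span_def by blast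
  then have "v + w = (\<Sum>i<k. (x i + y i) *s b i)" by (simp add: vector_sadd_rdistrib sum.distrib)
  then show "v + w \<in> lin_span b k" by (simp add: lin_spanI del: vector_sadd_rdistrib)
next
  fix c v assume "v \<in> lin_span b k"
  then obtain x where "v = (\<Sum>i<k. x i *s b i)" unfolding lin_span_def by blast
  then have "c *s v = (\<Sum>i<k. (c * x i) *s b i)" by (simp add: vec.scale_sum_right vector_smult_assoc)
  then show "c *s v \<in> lin_span b k" by (simp add: lin_spanI)
qed

lemma lin_span_Suc: "v \<in> lin_span b (Suc k) \<longleftrightarrow> (\<exists>c. v - c *s b k \<in> lin_span b k)"
proof
  assume "v \<in> lin_span b (Suc k)"
  then obtain x where "v = (\<Sum>i<k. x i *s b i) + x k *s b k" unfolding lin_span_def by auto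
  then have "v - x k *s b k = (\<Sum>i<k. x i *s b i)" by simp
  then show "\<exists>c. v - c *s b k \<in> lin_span b k" using lin_spanI by metis
next
  assume "\<exists>c. v - c *s b k \<in> lin_span b k"
  then obtain c x where "v - c *s b k = (\<Sum>i<k. x i *s b i)" unfolding lin_span_def by blast
  then have "v = (\<Sum>i<k. x i *s b i) + c *s b k" by (simp add: algebra_simps)
  also have "\<dots> = (\<Sum>i<Suc k. (x(k := c)) i *s b i)" by simp
  finally show "v \<in> lin_span b (Suc k)" using lin_spanI by metis
qed

lemma lin_span_cong: "(\<And>i. i < k \<Longrightarrow> b i = b' i) \<Longrightarrow> lin_span b k = lin_span b' k"
  by (simp add: lin_span_def)

lemma lin_span_proper:
  assumes "k < CARD('n)" obtains u :: "complex^'n" where "u \<notin> lin_span b k"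
proof -
  have "lin_span b k \<subseteq> vec.span (b ` {..<k})"
    unfolding lin_span_def by (auto intro!: vec.span_sum intro: vec.span_scale vec.span_base)
  moreover have "vec.span (b ` {..<k}) \<noteq> UNIV"
  proof
    assume "vec.span (b ` {..<k}) = UNIV"
    then have "vec.dim (UNIV :: (complex^'n) set) \<le> card (b ` {..<k})"
      by (metis finite_imageI finite_lessThan vec.dim_le_card order_refl)
    also have "\<dots> \<le> k" using card_image_le[of "{..<k}" b] by simp
    finally show False using assms by (simp add: card_cart_basis)
  qed
  ultimately show thesis using that by blast
qed

lemma lin_span_independent:
  assumes "\<And>j. j < k \<Longrightarrow> b j \<notin> lin_span b j" "(\<Sum>i<k. x i *s b i) = 0" "i < k"
  shows "x i = 0"
  using assms
proof (induction k)
  case (Suc k)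
  have xk: "x k = 0"
  proof (rule ccontr)
    assume "x k \<noteq> 0"
    have "(\<Sum>i<k. x i *s b i) + x k *s b k = 0" using Suc.prems(2) by simp
    then have "x k *s b k = - (\<Sum>i<k. x i *s b i)" by (simp add: eq_neg_iff_add_eq_0 add.commute)
    then have "b k = (- 1 / x k) *s (\<Sum>i<k. x i *s b i)"
      using \<open>x k \<noteq> 0\<close> by (simp add: vec_eq_iff field_simps)
    then have "b k \<in> lin_span b k" using subspace_lin_span vec.subspace_scale lin_spanI by metis
    then show False using Suc.prems(1) by blast
  qed
  show ?case
  proof (cases "i = k")
    case False
    then show ?thesis using Suc xk by simp
  qed (use xk in simp)
qed simp

text \<open>
  Enlarging the span by an eigenvector modulo \<open>W\<close> creates no new eigenvalues: subtracting a suitable multiple of \<open>b k\<close> from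
  an eigenvector modulo the larger span removes the component of the remainder along \<open>b k\<close>, as long as its
  eigenvalue \<open>c\<close> differs from \<open>\<mu>\<close>.
\<close>

lemma quotient_eigenvalues_Suc:
  assumes b: "A *v b k - \<mu> *s b k \<in> lin_span b k" and c: "c \<in> quotient_eigenvalues A (lin_span b (Suc k))" "c \<noteq> \<mu>"
  shows "c \<in> quotient_eigenvalues A (lin_span b k)"
proof -
  note sub = subspace_lin_span[of b k]
  obtain v where v: "v \<notin> lin_span b (Suc k)" "A *v v - c *s v \<in> lin_span b (Suc k)"
    using c(1) unfolding quotient_eigenvalues_def by blast
  obtain a where a: "A *v v - c *s v - a *s b k \<in> lin_span b k" using v(2) lin_span_Suc by blast
  define t where "t = a / (\<mu> - c)"
  have t: "t * (\<mu> - c) = a" using c(2) by (simp add: t_def)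
  define v' where "v' = v - t *s b k"
  have "v' \<notin> lin_span b k" using v(1) lin_span_Suc unfolding v'_def by blast
  moreover have "A *v v' - c *s v' = (A *v v - c *s v - a *s b k) - t *s (A *v b k - \<mu> *s b k)"
    unfolding t[symmetric] v'_def
    by (simp add: vec_eq_iff matrix_vector_mult_diff_distrib vector_scalar_commute[symmetric] algebra_simps)
  then have "A *v v' - c *s v' \<in> lin_span b k"
    using vec.subspace_diff[OF sub a vec.subspace_scale[OF sub b]] by metis
  ultimately show ?thesis unfolding quotient_eigenvalues_def by blast
qed

text \<open>
  The basis is built from the last vector to the first. Each new vector is an eigenvector modulo the span of the preceding
  ones, for an eigenvalue whose modulus is within a factor \<open>1 + \<epsilon>\<close> of the smallest possible; by the preceding lemma
  the eigenvalues that remain for later steps were already available, so they cannot be much smaller.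
  Scaling the new vector down makes the off-diagonal entries of its column small.
\<close>

lemma ordered_triangular_basis:
  fixes A :: "complex^'n^'n"
  assumes A: "\<And>v. s * norm v \<le> norm (A *v v)" "\<And>v. norm (A *v v) \<le> r * norm v" and "s > 0" "\<epsilon> > 0"
    and "k \<le> CARD('n)"
  shows "\<exists>b \<mu> c. (\<forall>j<k. b j \<notin> lin_span b j \<and> A *v b j = \<mu> j *s b j + (\<Sum>i<j. c i j *s b i) \<and>
            (\<Sum>i<j. cmod (c i j)) \<le> \<epsilon> \<and> s \<le> cmod (\<mu> j) \<and> cmod (\<mu> j) \<le> r \<and>
            (\<forall>i<j. cmod (\<mu> i) \<le> (1 + \<epsilon>) * cmod (\<mu> j))) \<and>
          (\<forall>a \<in> quotient_eigenvalues A (lin_span b k). s \<le> cmod a \<and> cmod a \<le> r \<and>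
            (\<forall>i<k. cmod (\<mu> i) \<le> (1 + \<epsilon>) * cmod a))"
  using assms(5)
proof (induction k)
  case 0
  have "s \<le> cmod a \<and> cmod a \<le> r" if a: "a \<in> quotient_eigenvalues A (lin_span b 0)" for a b
  proof -
    obtain v where "v \<noteq> 0" "A *v v = a *s v"
      using a by (auto simp: quotient_eigenvalues_def lin_span_def)
    then show ?thesis using A[of v] by (simp add: norm_vector_scalar_mult)
  qed
  then show ?case by auto
next
  case (Suc k)
  then obtain b \<mu> c where IH: "\<And>j. j < k \<Longrightarrow> b j \<notin> lin_span b j \<and> A *v b j = \<mu> j *s b j + (\<Sum>i<j. c i j *s b i) \<and>
            (\<Sum>i<j. cmod (c i j)) \<le> \<epsilon> \<and> s \<le> cmod (\<mu> j) \<and> cmod (\<mu> j) \<le> r \<and>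
            (\<forall>i<j. cmod (\<mu> i) \<le> (1 + \<epsilon>) * cmod (\<mu> j))"
    and eig: "\<And>a. a \<in> quotient_eigenvalues A (lin_span b k) \<Longrightarrow> s \<le> cmod a \<and> cmod a \<le> r \<and>
            (\<forall>i<k. cmod (\<mu> i) \<le> (1 + \<epsilon>) * cmod a)"
    by (auto simp: Suc_le_eq) blast
  let ?W = "lin_span b k" and ?E = "cmod ` quotient_eigenvalues A (lin_span b k)"
  obtain u where "u \<notin> ?W" using lin_span_proper[of k b] Suc.prems by auto
  then have ne: "?E \<noteq> {}" using quotient_eigenvalue_exists[OF subspace_lin_span] by simp
  have bdd: "bdd_below ?E" by (rule bdd_belowI[of _ 0]) auto
  have "s \<le> Inf ?E" by (rule cInf_greatest[OF ne]) (use eig in auto)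
  then have "Inf ?E < (1 + \<epsilon>) * Inf ?E" using \<open>s > 0\<close> \<open>\<epsilon> > 0\<close> by (simp add: algebra_simps)
  then obtain m where m: "m \<in> quotient_eigenvalues A ?W" "cmod m < (1 + \<epsilon>) * Inf ?E"
    using cInf_lessD[OF ne] by blast
  have m_min: "cmod m \<le> (1 + \<epsilon>) * cmod a" if "a \<in> quotient_eigenvalues A ?W" for a
  proof -
    have "Inf ?E \<le> cmod a" using that by (intro cInf_lower[OF _ bdd]) auto
    then have "(1 + \<epsilon>) * Inf ?E \<le> (1 + \<epsilon>) * cmod a" using \<open>\<epsilon> > 0\<close> by simp
    then show ?thesis using m(2) by simp
  qed
  obtain v where v: "v \<notin> ?W" "A *v v - m *s v \<in> ?W" using m(1) unfolding quotient_eigenvalues_def by blast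
  obtain x where x: "A *v v - m *s v = (\<Sum>i<k. x i *s b i)" using v(2) unfolding lin_span_def by blast
  define X where "X = (\<Sum>i<k. cmod (x i))"
  have "X \<ge> 0" by (simp add: X_def sum_nonneg)
  \<comment> \<open>the factor that scales the coefficients of the new column down to a sum of at most \<open>\<epsilon>\<close>\<close>
  define t where "t = \<epsilon> / (1 + X)"
  have t: "t > 0" "t * X \<le> \<epsilon>"
    using \<open>X \<ge> 0\<close> \<open>\<epsilon> > 0\<close> by (auto simp: t_def field_simps)
  let ?t = "complex_of_real t"
  define b' where "b' = b(k := ?t *s v)"
  define \<mu>' where "\<mu>' = \<mu>(k := m)"
  define c' where "c' i j = (if j = k then ?t * x i else c i j)" for i j
  have span: "lin_span b' j = lin_span b j" if "j \<le> k" for j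
    by (rule lin_span_cong) (use that in \<open>simp add: b'_def\<close>)
  have new: "A *v b' k - m *s b' k = (\<Sum>i<k. c' i k *s b' i)"
  proof -
    have "A *v b' k - m *s b' k = ?t *s (A *v v - m *s v)"
      by (simp add: b'_def vector_scalar_commute vec_eq_iff algebra_simps)
    also have "\<dots> = (\<Sum>i<k. c' i k *s b' i)"
      unfolding x vec.scale_sum_right by (rule sum.cong) (auto simp: c'_def b'_def vector_smult_assoc)
    finally show ?thesis .
  qed
  have new_in: "A *v b' k - m *s b' k \<in> lin_span b' k" unfolding new by (rule lin_spanI)
  have conj1: "b' j \<notin> lin_span b' j \<and> A *v b' j = \<mu>' j *s b' j + (\<Sum>i<j. c' i j *s b' i) \<and>
            (\<Sum>i<j. cmod (c' i j)) \<le> \<epsilon> \<and> s \<le> cmod (\<mu>' j) \<and> cmod (\<mu>' j) \<le> r \<and>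
            (\<forall>i<j. cmod (\<mu>' i) \<le> (1 + \<epsilon>) * cmod (\<mu>' j))" if j: "j < Suc k" for j
  proof (cases "j = k")
    case True
    have "b' k \<notin> lin_span b k"
    proof
      assume "b' k \<in> lin_span b k"
      then have "(1 / ?t) *s b' k \<in> lin_span b k" using vec.subspace_scale[OF subspace_lin_span] by blast
      then show False using v(1) t by (simp add: b'_def vector_smult_assoc)
    qed
    moreover have "A *v b' k = \<mu>' k *s b' k + (\<Sum>i<k. c' i k *s b' i)"
      using new by (simp add: \<mu>'_def algebra_simps)
    moreover have "(\<Sum>i<k. cmod (c' i k)) \<le> \<epsilon>"
      using t by (simp add: c'_def norm_mult X_def flip: sum_distrib_left)
    ultimately show ?thesis using True eig[OF m(1)] span by (simp add: \<mu>'_def)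
  next
    case False
    then have "j < k" using j by simp
    moreover have "(\<Sum>i<j. c' i j *s b' i) = (\<Sum>i<j. c i j *s b i)"
      by (rule sum.cong) (use \<open>j < k\<close> in \<open>auto simp: c'_def b'_def\<close>)
    ultimately show ?thesis using IH[of j] span[of j] by (simp add: c'_def b'_def \<mu>'_def)
  qed
  have conj2: "s \<le> cmod a \<and> cmod a \<le> r \<and> (\<forall>i<Suc k. cmod (\<mu>' i) \<le> (1 + \<epsilon>) * cmod a)"
    if "a \<in> quotient_eigenvalues A (lin_span b' (Suc k))" for a
  proof -
    have a: "a \<in> quotient_eigenvalues A ?W"
    proof (cases "a = m")
      case False
      show ?thesis using quotient_eigenvalues_Suc[OF new_in that False] span by simp
    qed (use m in simp)
    then show ?thesis using eig[OF a] m_min[OF a] by (auto simp: \<mu>'_def less_Suc_eq)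
  qed
  show ?case
    by (rule exI[of _ b'], rule exI[of _ \<mu>'], rule exI[of _ c']) (use conj1 conj2 in blast)
qed

lemma graded_triangularization:
  fixes A :: "complex^'n^'n"
  assumes A: "\<And>v. s * norm v \<le> norm (A *v v)" "\<And>v. norm (A *v v) \<le> r * norm v" and s: "s > 0" and r: "0 < r" "r < 1"
  obtains S T :: "complex^'n^'n" and rk \<rho> \<theta> where "invertible S" "A ** S = S ** T" "graded_triangular T rk \<rho> \<theta>"
proof -
  \<comment> \<open>The columns of \<open>T\<close> sum up to at most \<open>r + \<epsilon>\<close>, and those of rank at least that of \<open>i\<close> to at most
    \<open>(1 + \<epsilon>) |\<mu>\<^sub>i| + \<epsilon> \<le> (1 + \<epsilon> + \<epsilon> / s) |\<mu>\<^sub>i|\<close>; the product of the two factors tends to \<open>r < 1\<close>.\<close>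
  have "((\<lambda>\<epsilon>. (1 + \<epsilon> + \<epsilon> / s) * (r + \<epsilon>)) \<longlongrightarrow> (1 + 0 + 0 / s) * (r + 0)) (at_right 0)"
    by (intro tendsto_intros) (use s in auto)
  then have "\<forall>\<^sub>F \<epsilon> in at_right 0. (1 + \<epsilon> + \<epsilon> / s) * (r + \<epsilon>) < 1"
    using order_tendstoD(2) r by fastforce
  moreover have "\<forall>\<^sub>F \<epsilon> in at_right (0::real). \<epsilon> > 0" by (rule eventually_at_right_less)
  ultimately have "\<forall>\<^sub>F \<epsilon> in at_right 0. \<epsilon> > 0 \<and> (1 + \<epsilon> + \<epsilon> / s) * (r + \<epsilon>) < 1" by eventually_elim simp
  then obtain \<epsilon> where \<epsilon>: "\<epsilon> > 0" "(1 + \<epsilon> + \<epsilon> / s) * (r + \<epsilon>) < 1"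
    using eventually_happens'[OF trivial_limit_at_right_real] by blast
  define \<theta> where "\<theta> = (1 + \<epsilon> + \<epsilon> / s) * (r + \<epsilon>)"
  let ?n = "CARD('n)"
  obtain b \<mu> c where basis: "\<And>j. j < ?n \<Longrightarrow> b j \<notin> lin_span b j \<and> A *v b j = \<mu> j *s b j + (\<Sum>i<j. c i j *s b i) \<and>
            (\<Sum>i<j. cmod (c i j)) \<le> \<epsilon> \<and> s \<le> cmod (\<mu> j) \<and> cmod (\<mu> j) \<le> r \<and>
            (\<forall>i<j. cmod (\<mu> i) \<le> (1 + \<epsilon>) * cmod (\<mu> j))"
    using ordered_triangular_basis[OF A s \<epsilon>(1) order_refl] by blast
  obtain h where h: "bij_betw h (UNIV :: 'n set) {0..<?n}" using ex_bij_betw_finite_nat[of "UNIV :: 'n set"] by auto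
  then have h_less: "h i < ?n" for i using bij_betwE by fastforce
  have h_inj: "h i = h j \<longleftrightarrow> i = j" for i j using h by (auto simp: bij_betw_def inj_on_def)
  have reindex: "(\<Sum>j\<in>UNIV. f (h j)) = (\<Sum>i<?n. f i)" for f :: "nat \<Rightarrow> 'b::comm_monoid_add"
    using sum.reindex_bij_betw[OF h, of f] by (simp add: atLeast0LessThan)
  have restrict: "(\<Sum>i<?n. if i < l then f i else 0) = (\<Sum>i<l. f i)" if "l < ?n" for l and f :: "nat \<Rightarrow> 'b::comm_monoid_add"
    by (rule sum.mono_neutral_cong_right) (use that in auto)
  define T :: "complex^'n^'n" where "T = (\<chi> j l. if j = l then \<mu> (h l) else if h j < h l then c (h j) (h l) else 0)"
  define S :: "complex^'n^'n" where "S = (\<chi> a l. b (h l) $ a)"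
  have S_mult: "S *v v = (\<Sum>l\<in>UNIV. v $ l *s b (h l))" for v
    by (simp add: S_def matrix_vector_mult_def vec_eq_iff mult.commute)
  have "invertible S"
  proof -
    have "v = 0" if "S *v v = 0" for v
    proof -
      define x where "x i = v $ (inv_into UNIV h i)" for i
      have x: "x (h l) = v $ l" for l using h by (simp add: x_def bij_betw_def)
      have "(\<Sum>i<?n. x i *s b i) = 0"
        using that reindex[of "\<lambda>i. x i *s b i"] by (simp add: S_mult x)
      then have "x i = 0" if "i < ?n" for i
        using lin_span_independent[of ?n b x i] basis that by blast
      then show ?thesis using x h_less by (metis vec_eq_iff zero_index)
    qed
    then show ?thesis using invertible_left_inverse matrix_left_invertible_ker by blast
  qed
  moreover have "A ** S = S ** T"
  proof -
    have "(A ** S) *v axis l 1 = (S ** T) *v axis l 1" for l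
    proof -
      have "S *v axis l 1 = b (h l)"
        by (simp add: vec_eq_iff matrix_vector_mult_axis_nth S_def)
      then have "(A ** S) *v axis l 1 = A *v b (h l)" by (simp flip: matrix_vector_mul_assoc)
      also have "\<dots> = \<mu> (h l) *s b (h l) + (\<Sum>i<h l. c i (h l) *s b i)" using basis[OF h_less] by blast
      also have "(\<Sum>i<h l. c i (h l) *s b i) = (\<Sum>j\<in>UNIV. if h j < h l then c (h j) (h l) *s b (h j) else 0)"
        by (simp only: reindex[of "\<lambda>i. if i < h l then c i (h l) *s b i else 0"] restrict[OF h_less])
      also have "\<mu> (h l) *s b (h l) = (\<Sum>j\<in>UNIV. if j = l then \<mu> (h l) *s b (h j) else 0)" by simp
      also have "(\<Sum>j\<in>UNIV. if j = l then \<mu> (h l) *s b (h j) else 0) + (\<Sum>j\<in>UNIV. if h j < h l then c (h j) (h l) *s b (h j) else 0)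
          = (\<Sum>j\<in>UNIV. T $ j $ l *s b (h j))"
        unfolding sum.distrib[symmetric] by (rule sum.cong) (auto simp: T_def)
      also have "\<dots> = S *v (T *v axis l 1)" by (simp add: S_mult matrix_vector_mult_axis_nth)
      finally show ?thesis by (simp add: matrix_vector_mul_assoc)
    qed
    then show ?thesis by (simp add: vec_eq_iff matrix_vector_mult_axis_nth[symmetric] del: matrix_vector_mul_assoc)
  qed
  \<comment> \<open>The basis was built from the last vector to the first, so the rank reverses the numbering.\<close>
  moreover have "graded_triangular T (\<lambda>i. ?n - h i) (r + \<epsilon>) \<theta>"
  proof
    have col: "col_sum T l \<le> cmod (\<mu> (h l)) + \<epsilon>" for l
    proof -
      have "col_sum T l = (\<Sum>j\<in>UNIV. (if j = l then cmod (\<mu> (h l)) else 0) + (if h j < h l then cmod (c (h j) (h l)) else 0))"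
        unfolding col_sum_def by (rule sum.cong) (auto simp: T_def)
      also have "\<dots> = cmod (\<mu> (h l)) + (\<Sum>i<h l. cmod (c i (h l)))"
        by (simp add: sum.distrib reindex[of "\<lambda>i. if i < h l then cmod (c i (h l)) else 0"] restrict[OF h_less])
      also have "\<dots> \<le> cmod (\<mu> (h l)) + \<epsilon>" using basis[OF h_less] by simp
      finally show ?thesis .
    qed
    have "0 < \<epsilon> / s" using \<epsilon> s by simp
    then have "(r + \<epsilon>) * 1 \<le> (r + \<epsilon>) * (1 + \<epsilon> + \<epsilon> / s)" using \<epsilon> r by (intro mult_left_mono) auto
    then have le: "r + \<epsilon> \<le> \<theta>" by (simp add: \<theta>_def mult.commute)
    have "\<theta> < 1" using \<epsilon>(2) by (simp add: \<theta>_def)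
    then show "0 < r + \<epsilon>" "r + \<epsilon> < 1" "0 < \<theta>" "\<theta> < 1" using \<epsilon>(1) r le by linarith+
    show "i = l \<or> ?n - h l < ?n - h i" if "T $ i $ l \<noteq> 0" for i l
      using that h_less[of i] h_less[of l] by (auto simp: T_def split: if_splits)
    show "T $ i $ i \<noteq> 0" for i using basis[OF h_less, of i] s by (auto simp: T_def)
    show "col_sum T l \<le> r + \<epsilon>" for l using col[of l] basis[OF h_less, of l] by simp
    show "col_sum T l * (r + \<epsilon>) \<le> \<theta> * cmod (T $ i $ i)" if "?n - h i \<le> ?n - h l" for i l
    proof -
      let ?m = "cmod (\<mu> (h i))"
      have "h l \<le> h i" using that h_less[of i] h_less[of l] by linarith
      then have "cmod (\<mu> (h l)) \<le> (1 + \<epsilon>) * ?m"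
      proof (cases "h l = h i")
        case True
        then show ?thesis using \<epsilon> by (simp add: distrib_right)
      next
        case False
        then show ?thesis using basis[OF h_less[of i]] \<open>h l \<le> h i\<close> by simp
      qed
      moreover have "\<epsilon> \<le> \<epsilon> / s * ?m"
      proof -
        have "\<epsilon> / s * s \<le> \<epsilon> / s * ?m" using basis[OF h_less[of i]] \<open>0 < \<epsilon> / s\<close> by (intro mult_left_mono) auto
        then show ?thesis using s by simp
      qed
      ultimately have "col_sum T l \<le> (1 + \<epsilon> + \<epsilon> / s) * ?m" using col[of l] by (simp add: algebra_simps)
      then have "col_sum T l * (r + \<epsilon>) \<le> (1 + \<epsilon> + \<epsilon> / s) * ?m * (r + \<epsilon>)"
        using \<epsilon> r by (intro mult_right_mono) auto
      then show ?thesis by (simp add: \<theta>_def T_def mult_ac)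
    qed
  qed
  ultimately show thesis using that by blast
qed

section \<open>Basins of sequences with equal jets\<close>

lemma matrix_automorphism:
  fixes S S' :: "complex^'n^'n"
  assumes "S' ** S = mat 1" "S ** S' = mat 1"
  shows "holomorphic_automorphism (\<lambda>z. S *v z)"
proof (rule holomorphic_automorphismI)
  have inv: "S' *v (S *v z) = z" "S *v (S' *v z) = z" for z
    by (simp_all add: matrix_vector_mul_assoc assms)
  show "inj (\<lambda>z. S *v z)" by (metis injI inv(1))
  show "surj (\<lambda>z. S *v z)" by (metis surjI inv(2))
  have "invertible S" using assms unfolding invertible_def by blast
  then show "regular_at (\<lambda>z. S *v z) z" for z unfolding regular_at_def
    by (intro exI[of _ S] conjI bounded_linear.has_derivative[OF matrix_vector_mul_bounded_linear has_derivative_ident])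
qed

context graded_triangular
begin

text \<open>
  The off-diagonal part of \<open>T\<close> is itself strictly triangular and can be joined with \<open>g\<close>; the diagonal entries are less than \<open>1\<close>
  in modulus because the column sums are.
\<close>

lemma triangular_map:
  assumes g: "entire g" "flat 2 g" "strictly_triangular rk g"
  shows "holomorphic_automorphism (\<lambda>z. T *v z + g z)" and "(\<lambda>m. ((\<lambda>z. T *v z + g z) ^^ m) z) \<longlonglongrightarrow> 0"
proof -
  define N where "N = (\<chi> i j. if i = j then 0 else T $ i $ j)"
  define k where "k z = N *v z + g z" for z
  have eq: "(\<lambda>z. T *v z + g z) = (\<lambda>z. (\<chi> i. T $ i $ i * z $ i) + k z)"
  proof
    fix z
    have "(T *v z) $ i = T $ i $ i * z $ i + (N *v z) $ i" for i
    proof -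
      have "(T *v z) $ i = (\<Sum>j\<in>UNIV. (if j = i then T $ i $ i * z $ i else 0) + N $ i $ j * z $ j)"
        unfolding matrix_vector_mult_def by (simp add: N_def) (rule sum.cong, auto)
      then show ?thesis unfolding sum.distrib by (simp add: matrix_vector_mult_def)
    qed
    then show "T *v z + g z = (\<chi> i. T $ i $ i * z $ i) + k z" by (simp add: k_def vec_eq_iff)
  qed
  have k_hol: "entire k" unfolding k_def[abs_def] by (intro holomorphic_map_add g(1) holomorphic_map_matrix)
  have "strictly_triangular rk (\<lambda>z. N *v z)"
    unfolding strictly_triangular_def matrix_vector_mult_def
  proof (intro allI)
    fix i z
    have "N $ i $ j * z $ j = N $ i $ j * earlier rk i z $ j" for j
      using triangular[of i j] by (auto simp: N_def earlier_def)
    then have "(\<Sum>j\<in>UNIV. N $ i $ j * z $ j) = (\<Sum>j\<in>UNIV. N $ i $ j * earlier rk i z $ j)"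
      by (rule sum.cong[OF refl])
    then show "(\<chi> i. \<Sum>j\<in>UNIV. N $ i $ j * z $ j) $ i = (\<chi> ia. \<Sum>j\<in>UNIV. N $ ia $ j * earlier rk i z $ j) $ i"
      by (simp only: vec_lambda_beta)
  qed
  then have k_tri: "strictly_triangular rk k" unfolding k_def[abs_def] by (rule strictly_triangular_add) (rule g(3))
  have k0: "k 0 = 0" using flat_0[OF g(2)] by (simp add: k_def)
  have "cmod (T $ i $ i) \<le> col_sum T i" for i unfolding col_sum_def by (rule member_le_sum) auto
  then have "cmod (T $ i $ i) < 1" for i using contracting[of i] \<rho> by (meson le_less_trans order_trans)
  then show "holomorphic_automorphism (\<lambda>z. T *v z + g z)" "(\<lambda>m. ((\<lambda>z. T *v z + g z) ^^ m) z) \<longlonglongrightarrow> 0"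
    unfolding eq using triangular_automorphism[OF k_hol k_tri diagonal] triangular_attracting[OF k_hol k_tri k0] by auto
qed

end

text \<open>
  Transporting the triangular normal form back to the original coordinates keeps the linear part of the model
  equal to the linear part \<open>A\<close> of \<open>F\<close>, so that the bounds on \<open>A\<close> in the Euclidean norm are not lost.
\<close>

lemma attracting_model:
  fixes F :: "complex^'n \<Rightarrow> complex^'n"
  assumes F: "entire F" "F 0 = 0" "(F has_derivative (\<lambda>h. A *v h)) (at 0)"
    and A: "\<And>v. s * norm v \<le> norm (A *v v)" "\<And>v. norm (A *v v) \<le> r * norm v"
    and s: "s > 0" and r: "0 < r" "r < 1" and m: "m \<ge> 2"
  obtains X G where "entire X" "flat 2 (\<lambda>z. X z - z)" "holomorphic_automorphism G"
    "flat 2 (\<lambda>z. G z - A *v z)" "\<And>z. (\<lambda>k. (G ^^ k) z) \<longlonglongrightarrow> 0" "flat m (\<lambda>z. X (F z) - G (X z))"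
proof -
  obtain S T :: "complex^'n^'n" and rk \<rho> \<theta> where S: "invertible S" "A ** S = S ** T" and gt: "graded_triangular T rk \<rho> \<theta>"
    by (rule graded_triangularization[OF A s r]) (rule that; assumption)
  interpret graded_triangular T rk \<rho> \<theta> by (rule gt)
  obtain S' :: "complex^'n^'n" where S': "S ** S' = mat 1" "S' ** S = mat 1" using S(1) unfolding invertible_def by blast
  have cancel [simp]: "S' *v (S *v z) = z" "S *v (S' *v z) = z" for z
    by (simp_all add: matrix_vector_mul_assoc S')
  have TS': "S *v (T *v (S' *v z)) = A *v z" for z
  proof -
    have "S ** T ** S' = A" by (metis S(2) S'(1) matrix_mul_assoc matrix_mul_rid)
    then show ?thesis by (simp add: matrix_vector_mul_assoc matrix_mul_assoc)
  qed
  define F' where "F' z = S' *v F (S *v z)" for z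
  have F'_hol: "entire F'" unfolding F'_def
    by (rule holomorphic_map_compose[OF holomorphic_map_compose[OF holomorphic_map_matrix F(1) subset_UNIV] holomorphic_map_matrix subset_UNIV])
  have F'_0: "F' 0 = 0" by (simp add: F'_def F(2))
  have derF': "(F' has_derivative (\<lambda>h. T *v h)) (at 0)"
  proof -
    have "((\<lambda>z. S *v z) has_derivative (\<lambda>h. S *v h)) (at 0)"
      by (rule bounded_linear.has_derivative[OF matrix_vector_mul_bounded_linear has_derivative_ident])
    from diff_chain_at[OF this, of F "\<lambda>h. A *v h"] F(3)
    have "((\<lambda>z. F (S *v z)) has_derivative (\<lambda>h. A *v (S *v h))) (at 0)" by (simp add: o_def)
    from bounded_linear.has_derivative[OF matrix_vector_mul_bounded_linear this, of S']
    have "(F' has_derivative (\<lambda>h. S' *v (A *v (S *v h)))) (at 0)" unfolding F'_def .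
    moreover have "S' *v (A *v (S *v h)) = T *v h" for h
    proof -
      have "A *v (S *v h) = S *v (T *v h)" by (simp add: matrix_vector_mul_assoc S(2))
      then show ?thesis by simp
    qed
    ultimately show ?thesis by simp
  qed
  obtain X' g where X': "entire X'" "flat 2 (\<lambda>z. X' z - z)"
    and g: "entire g" "flat 2 g" "strictly_triangular rk g"
    and conj: "flat m (\<lambda>z. X' (F' z) - (T *v X' z + g (X' z)))"
    by (rule triangular_normal_form[OF F'_hol F'_0 derF' m]) (rule that; assumption)
  define G' where "G' z = T *v z + g z" for z
  have G': "holomorphic_automorphism G'" "(\<lambda>k. (G' ^^ k) z) \<longlonglongrightarrow> 0" for z
    unfolding G'_def[abs_def] by (rule triangular_map[OF g])+
  define G where "G z = S *v G' (S' *v z)" for z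
  define X where "X z = S *v X' (S' *v z)" for z
  have S'1: "flat 1 (\<lambda>z. S' *v z)" by (rule flat_1_holomorphic) auto
  have conj_flat: "flat i (\<lambda>z. S *v f (S' *v z))" if "flat i f" for i f
    by (rule flat_matrix[OF flat_compose[OF that S'1]])
  show thesis
  proof (rule that)
    show "entire X" unfolding X_def
      by (rule holomorphic_map_compose[OF holomorphic_map_compose[OF holomorphic_map_matrix X'(1) subset_UNIV] holomorphic_map_matrix subset_UNIV])
    have "(\<lambda>z. X z - z) = (\<lambda>z. S *v (X' (S' *v z) - S' *v z))"
      by (simp add: X_def matrix_vector_mult_diff_distrib)
    then show "flat 2 (\<lambda>z. X z - z)" using conj_flat[OF X'(2)] by simp
    show "holomorphic_automorphism G" unfolding G_def
      by (rule holomorphic_automorphism_compose[OF holomorphic_automorphism_compose[OF matrix_automorphism[OF S'] G'(1)] matrix_automorphism[OF S'(2,1)]])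
    have "(\<lambda>z. G z - A *v z) = (\<lambda>z. S *v g (S' *v z))"
      by (simp add: G_def G'_def matrix_vector_right_distrib TS')
    then show "flat 2 (\<lambda>z. G z - A *v z)" using conj_flat[OF g(2)] by simp
    show "(\<lambda>k. (G ^^ k) z) \<longlonglongrightarrow> 0" for z
    proof -
      have "(G ^^ k) z = S *v (G' ^^ k) (S' *v z)" for k by (induction k) (simp_all add: G_def)
      moreover have "(\<lambda>k. S *v (G' ^^ k) (S' *v z)) \<longlonglongrightarrow> S *v 0"
        by (rule bounded_linear.tendsto[OF matrix_vector_mul_bounded_linear G'(2)])
      ultimately show ?thesis by simp
    qed
    have "(\<lambda>z. X (F z) - G (X z)) = (\<lambda>z. S *v (X' (F' (S' *v z)) - (T *v X' (S' *v z) + g (X' (S' *v z)))))"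
      by (simp add: X_def G_def G'_def F'_def matrix_vector_mult_diff_distrib)
    then show "flat m (\<lambda>z. X (F z) - G (X z))" using conj_flat[OF conj] by simp
  qed
qed

lemma flat_2_has_derivative:
  assumes "flat 2 f" shows "(f has_derivative (\<lambda>h. 0)) (at 0)"
proof -
  obtain C \<rho> where C: "C > 0" "\<rho> > 0" "\<And>z. norm z < \<rho> \<Longrightarrow> norm (f z) \<le> C * norm z ^ 2"
    using assms flatE by blast
  have "f 0 = 0" using flat_0[OF assms] by simp
  have "((\<lambda>h. norm (f (0 + h) - f 0 - 0) / norm h) \<longlongrightarrow> 0) (at 0)"
  proof (rule Lim_null_comparison)
    have "\<forall>\<^sub>F h in at 0. norm (h::complex^'a) < \<rho>"
      using C by (auto simp: eventually_at intro!: exI[of _ \<rho>])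
    then show "\<forall>\<^sub>F h in at 0. norm (norm (f (0 + h) - f 0 - 0) / norm h) \<le> C * norm h"
    proof eventually_elim
      case (elim h)
      then show ?case using C(3)[of h] \<open>f 0 = 0\<close> C by (cases "h = 0") (auto simp: field_simps power2_eq_square)
    qed
    show "((\<lambda>h. C * norm h) \<longlongrightarrow> 0) (at (0::complex^'a))" by (auto intro!: tendsto_eq_intros)
  qed
  then show ?thesis unfolding has_derivative_at by simp
qed

lemma flat_2_small_Lipschitz:
  fixes f :: "complex^'n \<Rightarrow> complex^'m"
  assumes "entire f" "flat 2 f" "e > 0"
  obtains \<sigma> where "\<sigma> > 0" "\<And>x y. norm x < \<sigma> \<Longrightarrow> norm y < \<sigma> \<Longrightarrow> norm (f x - f y) \<le> e * norm (x - y)"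
proof -
  obtain C \<rho> where C: "C > 0" "\<rho> > 0" "\<And>z. norm z < \<rho> \<Longrightarrow> norm (f z) \<le> C * norm z ^ 2"
    using assms(2) flatE by blast
  define K where "K = 2 * real CARD('m) * C * 2 ^ 2"
  have "K > 0" using C by (simp add: K_def)
  define \<sigma> where "\<sigma> = min (\<rho> / 2) (e / K)"
  have \<sigma>: "\<sigma> > 0" "2 * \<sigma> \<le> \<rho>" "K * \<sigma> \<le> e"
    using C \<open>K > 0\<close> assms(3) by (auto simp: \<sigma>_def min_def field_simps)
  show thesis
  proof (rule that[OF \<sigma>(1)])
    fix x y :: "complex^'n" assume xy: "norm x < \<sigma>" "norm y < \<sigma>"
    have "norm (f x - f y) \<le> K * \<sigma> ^ (2 - 1) * norm (x - y)"
      unfolding K_def by (rule flat_imp_Lipschitz[OF holomorphic_map_subset[OF assms(1)] _ _ C(3)])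
        (use xy C \<sigma> in auto)
    also have "\<dots> \<le> e * norm (x - y)" using \<sigma> by (intro mult_right_mono) auto
    finally show "norm (f x - f y) \<le> e * norm (x - y)" .
  qed
qed

text \<open>
  The inverse of the model has derivative of norm at most \<open>1 / s\<close> at the origin. The constant \<open>L\<close> is chosen halfway between
  \<open>1 / s\<close> and \<open>1 / r^q\<close>; near the origin it is a Lipschitz constant of the inverse, and the remaining constants are
  adapted to it.
\<close>

lemma basin_at_origin:
  fixes F :: "nat \<Rightarrow> complex^'n \<Rightarrow> complex^'n"
  assumes F: "\<And>j. j \<ge> 1 \<Longrightarrow> holomorphic_automorphism (F j)" "\<And>j. j \<ge> 1 \<Longrightarrow> F j 0 = 0"
    and bounds: "\<And>j z. j \<ge> 1 \<Longrightarrow> norm z < \<delta> \<Longrightarrow> s * norm z \<le> norm (F j z)"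
      "\<And>j z. j \<ge> 1 \<Longrightarrow> norm z < \<delta> \<Longrightarrow> norm (F j z) \<le> r * norm z"
    and agree: "\<And>j z. j \<ge> 1 \<Longrightarrow> norm z < \<sigma> \<Longrightarrow> norm (F j z - F 1 z) \<le> D * norm z ^ q"
    and pos: "0 < r" "r < 1" "0 < s" "s < 1" "0 < \<delta>" "0 < \<sigma>" and q: "q \<ge> 2" "r ^ q < s"
  shows "biholomorphic (basin_of_attraction F 0) (UNIV :: (complex^'n) set)"
proof -
  have F1: "entire (F 1)" "F 1 0 = 0" using F holomorphic_automorphismD(1) by auto
  define A where "A = complex_jacobian (F 1) 0"
  have derA: "(F 1 has_derivative (\<lambda>h. A *v h)) (at 0)"
    unfolding A_def by (rule holomorphic_map_has_derivative[OF F1(1)]) auto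
  have A: "s * norm v \<le> norm (A *v v)" "norm (A *v v) \<le> r * norm v" for v
    using derivative_lower_bound[OF derA, of \<delta> s] derivative_upper_bound[OF derA, of \<delta> r]
      bounds[of 1] F1(2) pos by auto
  obtain X G where X: "entire X" "flat 2 (\<lambda>z. X z - z)" and G: "holomorphic_automorphism G"
    "flat 2 (\<lambda>z. G z - A *v z)" "\<And>z. (\<lambda>k. (G ^^ k) z) \<longlonglongrightarrow> 0" and XG: "flat q (\<lambda>z. X (F 1 z) - G (X z))"
    by (rule attracting_model[OF F1 derA A pos(3,1,2) q(1)]) (rule that; assumption)
  define H where "H = inv G"
  have H: "entire H" "\<And>z. G (H z) = z" "\<And>z. H (G z) = z"
    using holomorphic_automorphismD[OF G(1)] by (auto simp: H_def bij_def surj_f_inv_f)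
  have G0: "G 0 = 0" using flat_0[OF G(2)] by simp
  have X0: "X 0 = 0" using flat_0[OF X(2)] by simp
  have H0: "H 0 = 0" using H(3)[of 0] G0 by simp
  define B where "B = complex_jacobian H 0"
  have derB: "(H has_derivative (\<lambda>h. B *v h)) (at 0)"
    unfolding B_def by (rule holomorphic_map_has_derivative[OF H(1)]) auto
  have derG: "(G has_derivative (\<lambda>h. A *v h)) (at 0)"
  proof -
    have "((\<lambda>z. G z - A *v z) has_derivative (\<lambda>h. 0)) (at 0)" by (rule flat_2_has_derivative[OF G(2)])
    moreover have "((\<lambda>z. A *v z) has_derivative (\<lambda>h. A *v h)) (at 0)"
      by (rule bounded_linear.has_derivative[OF matrix_vector_mul_bounded_linear has_derivative_ident])
    ultimately show ?thesis using has_derivative_add[of "\<lambda>z. G z - A *v z" "\<lambda>h. 0" "at 0" "\<lambda>z. A *v z"] by simp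
  qed
  have B: "norm (B *v v) \<le> 1 / s * norm v" for v
  proof -
    have "((\<lambda>z. G (H z)) has_derivative (\<lambda>h. A *v (B *v h))) (at 0)"
      using diff_chain_at[OF derB, of G "\<lambda>h. A *v h"] derG H0 by (simp add: o_def)
    then have "((\<lambda>z. z) has_derivative (\<lambda>h. A *v (B *v h))) (at 0)" by (simp add: H)
    from has_derivative_unique[OF this has_derivative_ident] have "A *v (B *v v) = v" by metis
    then show ?thesis using A(1)[of "B *v v"] pos by (simp add: field_simps)
  qed
  define L where "L = (1 / s + 1 / r ^ q) / 2"
  have rq: "r ^ q > 0" using pos by simp
  then have "1 / s < 1 / r ^ q" using q pos by (simp add: frac_less2)
  then have L: "1 / s < L" "L < 1 / r ^ q" by (auto simp: L_def)
  have "1 < 1 / s" using pos by simp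
  then have L': "1 \<le> L" "L * r ^ q < 1" using L rq by (auto simp: field_simps)
  obtain \<sigma>H where \<sigma>H: "\<sigma>H > 0" "\<And>x y. norm x < \<sigma>H \<Longrightarrow> norm y < \<sigma>H \<Longrightarrow>
      norm ((H x - B *v x) - (H y - B *v y)) \<le> (L - 1 / s) * norm (x - y)"
    using flat_2_small_Lipschitz[OF holomorphic_map_diff[OF H(1) holomorphic_map_matrix] flat_2_jacobian[OF H(1) H0 derB], of "L - 1/s"] L
    by auto
  have H_Lip: "norm (H x - H y) \<le> L * norm (x - y)" if "norm x < \<sigma>H" "norm y < \<sigma>H" for x y
  proof -
    have "H x - H y = ((H x - B *v x) - (H y - B *v y)) + B *v (x - y)" by (simp add: matrix_vector_mult_diff_distrib)
    then have "norm (H x - H y) \<le> norm ((H x - B *v x) - (H y - B *v y)) + norm (B *v (x - y))"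
      using norm_triangle_ineq by metis
    also have "\<dots> \<le> (L - 1 / s) * norm (x - y) + 1 / s * norm (x - y)" by (rule add_mono[OF \<sigma>H(2)[OF that] B])
    finally show ?thesis by (simp add: algebra_simps)
  qed
  obtain \<sigma>X where \<sigma>X: "\<sigma>X > 0" "\<And>x y. norm x < \<sigma>X \<Longrightarrow> norm y < \<sigma>X \<Longrightarrow> norm ((X x - x) - (X y - y)) \<le> 1/4 * norm (x - y)"
    using flat_2_small_Lipschitz[OF holomorphic_map_diff[OF X(1) holomorphic_map_id] X(2), of "1/4"] by auto
  obtain C1 \<sigma>1 where C1: "C1 > 0" "\<sigma>1 > 0" "\<And>z. norm z < \<sigma>1 \<Longrightarrow> norm (X (F 1 z) - G (X z)) \<le> C1 * norm z ^ q"
    using XG flatE by blast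
  define C where "C = 5/4 * \<bar>D\<bar> + C1"
  define K where "K = L * C / (1 - L * r ^ q)"
  have "C > 0" using C1 by (simp add: C_def)
  then have "K > 0" using L' by (auto simp: K_def)
  define M where "M = 2 * real CARD('n) * K * 2 ^ q"
  have "M > 0" using \<open>K > 0\<close> by (simp add: M_def)
  define \<rho> where "\<rho> = min (min (min \<delta> \<sigma>) (min (\<sigma>H / 2) \<sigma>X)) (min (min \<sigma>1 1) (1 / (4 * M)))"
  have \<rho>: "\<rho> > 0" "\<rho> \<le> \<delta>" "\<rho> \<le> \<sigma>" "2 * \<rho> \<le> \<sigma>H" "\<rho> \<le> \<sigma>X" "\<rho> \<le> \<sigma>1" "\<rho> \<le> 1" "\<rho> \<le> 1 / (4 * M)"
    using pos \<sigma>H \<sigma>X C1 \<open>M > 0\<close> by (auto simp: \<rho>_def)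
  have "near_conjugacy (F ` {1..}) G H X r C L K \<rho> q"
  proof
    have "\<rho> ^ (q - 1) \<le> \<rho> ^ 1" using \<rho> q by (intro power_decreasing) auto
    then have "M * \<rho> ^ (q - 1) \<le> M * (1 / (4 * M))" using \<rho> \<open>M > 0\<close> by (intro mult_left_mono) auto
    also have "M * (1 / (4 * M)) = 1/4" using \<open>M > 0\<close> by simp
    finally show "2 * real CARD('n) * K * 2 ^ q * \<rho> ^ (q - 1) \<le> 1/4" by (simp only: M_def)
    show "norm (X z - X w - (z - w)) \<le> 1/4 * norm (z - w)" if "norm z < \<rho>" "norm w < \<rho>" for z w
      using \<sigma>X(2)[of z w] that \<rho> by (simp add: algebra_simps)
    show "norm (H z - H w) \<le> L * norm (z - w)" if "norm z < 2 * \<rho>" "norm w < 2 * \<rho>" for z w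
      using H_Lip[of z w] that \<rho> by simp
    show "norm (f z) \<le> r * norm z" if "f \<in> F ` {1..}" "norm z < \<rho>" for f z
      using bounds(2) that \<rho> by auto
    show "norm (X (f z) - G (X z)) \<le> C * norm z ^ q" if f: "f \<in> F ` {1..}" and z: "norm z < \<rho>" for f z
    proof -
      obtain j where j: "j \<ge> 1" "f = F j" using f by auto
      have "norm (F i z) \<le> norm z" if "i \<ge> 1" for i
        using bounds(2)[OF that, of z] z \<rho> pos mult_right_mono[of r 1 "norm z"] by simp
      then have range: "norm (F i z) < \<sigma>X" if "i \<ge> 1" for i using z \<rho> that by (meson le_less_trans less_le_trans)
      have "norm (X (F j z) - X (F 1 z)) \<le> 5/4 * norm (F j z - F 1 z)"
        using \<sigma>X(2)[OF range[OF j(1)] range[of 1]]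
          norm_triangle_sub[of "X (F j z) - X (F 1 z)" "F j z - F 1 z"] by (simp add: algebra_simps)
      also have "\<dots> \<le> 5/4 * (\<bar>D\<bar> * norm z ^ q)"
      proof -
        have "norm (F j z - F 1 z) \<le> D * norm z ^ q" using agree[OF j(1)] z \<rho> by simp
        also have "\<dots> \<le> \<bar>D\<bar> * norm z ^ q" by (intro mult_right_mono) auto
        finally show ?thesis by simp
      qed
      finally have "norm (X (F j z) - X (F 1 z)) \<le> 5/4 * (\<bar>D\<bar> * norm z ^ q)" .
      moreover have "norm (X (F 1 z) - G (X z)) \<le> C1 * norm z ^ q" using C1(3) z \<rho> by simp
      ultimately have "norm (X (F j z) - G (X z)) \<le> 5/4 * (\<bar>D\<bar> * norm z ^ q) + C1 * norm z ^ q"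
        using norm_triangle_ineq[of "X (F j z) - X (F 1 z)" "X (F 1 z) - G (X z)"] by simp
      then show ?thesis by (simp add: C_def j(2) algebra_simps)
    qed
  qed (use pos q \<rho> \<open>C > 0\<close> L' F X(1) X0 G in \<open>auto simp: K_def H_def\<close>)
  from near_conjugacy.biholomorphic_basin[OF this] show ?thesis by simp
qed

lemma biholomorphic_translate:
  fixes S :: "(complex^'n) set"
  assumes "biholomorphic S U"
  shows "biholomorphic ((\<lambda>z. z - a) -` S) U"
proof -
  obtain \<Phi> where \<Phi>: "open S" "open U" "bij_betw \<Phi> S U" "holomorphic_map_on \<Phi> S" "holomorphic_map_on (inv_into S \<Phi>) U"
    using assms unfolding biholomorphic_def biholomorphic_map_def by blast
  let ?S = "(\<lambda>z. z - a) -` S" and ?\<Phi> = "\<lambda>z. \<Phi> (z - a)"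
  have "?S = (\<lambda>z. z + a) ` S" by (force intro: image_eqI[of _ _ "_ - a"])
  then have "bij_betw (\<lambda>z. z - a) ?S S" by (intro bij_betw_byWitness[where f' = "\<lambda>z. z + a"]) auto
  from bij_betw_trans[OF this \<Phi>(3)] have bij: "bij_betw ?\<Phi> ?S U" by (simp add: o_def)
  have inv: "inv_into ?S ?\<Phi> w = inv_into S \<Phi> w + a" if "w \<in> U" for w
  proof (rule inv_into_f_eq)
    show "inj_on ?\<Phi> ?S" using bij by (rule bij_betw_imp_inj_on)
    show "inv_into S \<Phi> w + a \<in> ?S" "\<Phi> (inv_into S \<Phi> w + a - a) = w"
      using \<Phi>(3) that by (auto simp: bij_betw_def inv_into_into f_inv_into_f)
  qed
  have "biholomorphic_map ?\<Phi> ?S U"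
    unfolding biholomorphic_map_def
  proof (intro conjI bij \<Phi>(2))
    show "open ?S" by (intro open_vimage \<Phi>(1) continuous_intros)
    show "holomorphic_map_on ?\<Phi> ?S"
      by (rule holomorphic_map_compose[OF holomorphic_map_diff[OF holomorphic_map_id holomorphic_map_const] \<Phi>(4)]) auto
    have hol: "holomorphic_map_on (\<lambda>w. inv_into S \<Phi> w + a) U"
      by (intro holomorphic_map_add \<Phi>(5) holomorphic_map_const)
    show "holomorphic_map_on (inv_into ?S ?\<Phi>) U"
      unfolding holomorphic_map_on_def
    proof
      fix w assume w: "w \<in> U"
      then obtain A where A: "((\<lambda>w. inv_into S \<Phi> w + a) has_derivative (\<lambda>h. A *v h)) (at w within U)"
        using hol unfolding holomorphic_map_on_def by blast
      have "(inv_into ?S ?\<Phi> has_derivative (\<lambda>h. A *v h)) (at w within U)"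
        by (rule has_derivative_transform[OF w _ A]) (rule inv)
      then show "\<exists>A. (inv_into ?S ?\<Phi> has_derivative (\<lambda>h. A *v h)) (at w within U)" ..
    qed
  qed
  then show ?thesis unfolding biholomorphic_def by blast
qed

text \<open>
  The strict bounds on a punctured ball force \<open>s < r\<close>, so that \<open>r ^ q < s\<close> entails \<open>q \<ge> 2\<close>. The coincidence of the derivatives
  up to order \<open>q - 1\<close> becomes a bound on the differences \<open>f\<^sub>j - f\<^sub>1\<close> that is uniform in \<open>j\<close>, because these are uniformly
  bounded near the fixed point.
\<close>

theorem biholomorphic_basin_of_attraction:
  fixes z0 :: "complex^'n"
  assumes pos: "0 < r" "r < 1" "0 < s" "s < 1" "0 < \<delta>" and q: "q \<ge> 1" "r ^ q < s"
    and adm: "admissible_sequence z0 r s \<delta> q f"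
  shows "biholomorphic (basin_of_attraction f z0) (UNIV :: (complex^'n) set)"
proof -
  have aut: "holomorphic_automorphism (f j)" and fix0: "f j z0 = z0" if "j \<ge> 1" for j
    using adm that unfolding admissible_sequence_def by blast+
  have strict: "s * norm (z - z0) < norm (f j z - z0) \<and> norm (f j z - z0) < r * norm (z - z0)"
    if "j \<ge> 1" "0 < norm (z - z0)" "norm (z - z0) < \<delta>" for j z
    using adm that unfolding admissible_sequence_def by blast
  have bounds: "s * norm (z - z0) \<le> norm (f j z - z0)" "norm (f j z - z0) \<le> r * norm (z - z0)"
    if "j \<ge> 1" "norm (z - z0) < \<delta>" for j z
    using strict[OF that(1), of z] that fix0[OF that(1)] by (cases "z = z0"; force)+
  have partials: "multi_partial \<alpha> (f 1) z0 = multi_partial \<alpha> (f j) z0"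
    if "j \<ge> 1" "1 \<le> multi_order \<alpha>" "multi_order \<alpha> \<le> q - 1" for j \<alpha>
    using adm that unfolding admissible_sequence_def by blast
  have "s < r"
  proof -
    define v :: "complex^'n" where "v = complex_of_real (\<delta>/2) *s axis (SOME i. True) 1"
    have v: "norm v = \<delta>/2" using pos by (simp add: v_def norm_vector_scalar_mult)
    have "0 < norm (z0 + v - z0)" "norm (z0 + v - z0) < \<delta>" unfolding add_diff_cancel_left' v using pos by simp_all
    from strict[OF order_refl this]
    have "s * norm v < norm (f 1 (z0 + v) - z0) \<and> norm (f 1 (z0 + v) - z0) < r * norm v"
      by simp
    then have "s * norm v < r * norm v" by linarith
    then show ?thesis using v pos by simp
  qed
  then have q2: "q \<ge> 2" using q by (cases "q = 1") auto
  obtain C \<sigma> where C: "C > 0" "\<sigma> > 0" and van: "\<forall>(g :: complex^'n \<Rightarrow> complex^'n) (M::real). entire g \<longrightarrow>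
    (\<forall>z. norm (z - z0) < \<delta> \<longrightarrow> norm (g z) \<le> M) \<longrightarrow>
    (\<forall>\<alpha>. multi_order \<alpha> < q \<longrightarrow> multi_partial \<alpha> g z0 = 0) \<longrightarrow>
    (\<forall>z. norm (z - z0) < \<sigma> \<longrightarrow> norm (g z) \<le> C * M * norm (z - z0) ^ q)"
    using vanishing_partials_bound[OF pos(5)] by blast
  have agree: "norm (f j z - f 1 z) \<le> C * (2 * \<delta>) * norm (z - z0) ^ q" if j: "j \<ge> 1" and z: "norm (z - z0) < \<sigma>" for j z
  proof (rule van[rule_format, of "\<lambda>z. f j z - f 1 z", OF _ _ _ z])
    show "entire (\<lambda>z. f j z - f 1 z)"
      using j by (intro holomorphic_map_diff holomorphic_automorphismD(1) aut) auto
    show "norm (f j z - f 1 z) \<le> 2 * \<delta>" if z: "norm (z - z0) < \<delta>" for z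
    proof -
      have "norm (f i z - z0) \<le> \<delta>" if "i \<ge> 1" for i
        using bounds(2)[OF that z] z pos mult_right_mono[of r 1 "norm (z - z0)"] by simp
      from this[OF j] this[of 1] show ?thesis
        using norm_triangle_ineq4[of "f j z - z0" "f 1 z - z0"] by simp
    qed
    fix \<alpha> :: "'n \<Rightarrow> nat" assume \<alpha>: "multi_order \<alpha> < q"
    have "multi_partial \<alpha> (f j) z0 = multi_partial \<alpha> (f 1) z0"
    proof (cases "multi_order \<alpha> = 0")
      case True
      then show ?thesis using fix0[OF j] fix0[of 1] by (simp add: multi_partial_zero)
    next
      case False
      then show ?thesis using partials[OF j, of \<alpha>] \<alpha> by simp
    qed
    then show "multi_partial \<alpha> (\<lambda>z. f j z - f 1 z) z0 = 0"
      using multi_partial_diff[OF holomorphic_automorphismD(1)[OF aut[OF j]] holomorphic_automorphismD(1)[OF aut[of 1]]] by simp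
  qed
  define F where "F j z = f j (z + z0) - z0" for j z
  have translation: "holomorphic_automorphism (\<lambda>z. z + c)" for c :: "complex^'n"
  proof (rule holomorphic_automorphismI)
    show "surj (\<lambda>z. z + c)" by (metis surjI diff_add_cancel)
    have "invertible (mat 1 :: complex^'n^'n)" unfolding invertible_def by (metis matrix_mul_lid)
    then show "regular_at (\<lambda>z. z + c) z" for z
      unfolding regular_at_def by (intro exI[of _ "mat 1"]) (auto intro!: derivative_eq_intros)
  qed simp
  have "biholomorphic (basin_of_attraction F 0) (UNIV :: (complex^'n) set)"
  proof (rule basin_at_origin[where \<delta> = \<delta> and s = s and r = r and q = q and D = "C * (2 * \<delta>)" and \<sigma> = \<sigma>])
    show "holomorphic_automorphism (F j)" if "j \<ge> 1" for j
      using holomorphic_automorphism_compose[OF holomorphic_automorphism_compose[OF translation[of z0] aut[OF that]] translation[of "- z0"]]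
      by (simp add: F_def[abs_def])
    show "F j 0 = 0" if "j \<ge> 1" for j using fix0[OF that] by (simp add: F_def)
    show "s * norm z \<le> norm (F j z)" "norm (F j z) \<le> r * norm z" if "j \<ge> 1" "norm z < \<delta>" for j z
      using bounds[OF that(1), of "z + z0"] that(2) by (auto simp: F_def)
    show "norm (F j z - F 1 z) \<le> C * (2 * \<delta>) * norm z ^ q" if "j \<ge> 1" "norm z < \<sigma>" for j z
      using agree[OF that(1), of "z + z0"] that(2) by (simp add: F_def)
  qed (use pos q q2 C in auto)
  from biholomorphic_translate[OF this, of z0]
  have "biholomorphic ((\<lambda>z. z - z0) -` basin_of_attraction F 0) (UNIV :: (complex^'n) set)" .
  moreover have "forward_comp F k (z - z0) = forward_comp f k z - z0" for k z
    by (induction k) (simp_all add: F_def)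
  then have "(\<lambda>z. z - z0) -` basin_of_attraction F 0 = basin_of_attraction f z0"
    by (auto simp: basin_of_attraction_def LIM_zero_iff)
  ultimately show ?thesis by simp
qed

section \<open>The size of the order\<close>

lemma least_power_below:
  fixes r s :: real
  assumes "0 < r" "r < 1" "0 < s"
  obtains q where "q \<ge> 1" "r ^ q < s" "q = 1 \<or> s \<le> r ^ (q - 1)" "\<And>p. p \<ge> 1 \<Longrightarrow> r ^ p < s \<Longrightarrow> q \<le> p"
proof -
  have "\<forall>\<^sub>F n in sequentially. r ^ n < s"
    using order_tendstoD(2)[OF LIMSEQ_realpow_zero, of r s] assms by simp
  then obtain N where "\<forall>n\<ge>N. r ^ n < s" unfolding eventually_sequentially by blast
  then have ex: "max 1 N \<ge> 1 \<and> r ^ max 1 N < s" by simp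
  define q where "q = (LEAST n. n \<ge> 1 \<and> r ^ n < s)"
  have q: "q \<ge> 1 \<and> r ^ q < s" unfolding q_def by (rule LeastI[of _ "max 1 N"]) (rule ex)
  have least: "q \<le> p" if "p \<ge> 1" "r ^ p < s" for p
    unfolding q_def by (rule Least_le) (use that in simp)
  have "q = 1 \<or> s \<le> r ^ (q - 1)"
  proof (rule disjCI)
    assume "\<not> s \<le> r ^ (q - 1)"
    then have "\<not> 1 \<le> q - 1" using least[of "q - 1"] q by fastforce
    then show "q = 1" using q by linarith
  qed
  then show thesis using that q least by blast
qed

text \<open>
  Taking logarithms in \<open>(1 / r) ^ (q - 1) \<le> 1 / s \<le> S\<close>.
\<close>

lemma least_power_le_log_quotient:
  fixes r s S :: real
  assumes r: "0 < r" "r < 1" and s: "0 < s" "s < 1" and q: "q \<ge> 1" "q = 1 \<or> s \<le> r ^ (q - 1)" and S: "1 / s \<le> S"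
  shows "real q \<le> ln S / ln (1 / r) + 1"
proof -
  have l: "ln (1 / r) > 0" using r by simp
  have "1 < 1 / s" using s by simp
  then have S1: "1 \<le> S" using S by simp
  have "(real q - 1) * ln (1 / r) \<le> ln S"
  proof (cases "q = 1")
    case False
    then have "1 / r ^ (q - 1) \<le> 1 / s" using q s by (intro divide_left_mono) (use r in auto)
    then have "(1 / r) ^ (q - 1) \<le> S" using S by (simp add: power_one_over)
    then have "ln ((1 / r) ^ (q - 1)) \<le> ln S" using r by (subst ln_le_cancel_iff) (use S1 in auto)
    moreover have "ln ((1 / r) ^ (q - 1)) = (real q - 1) * ln (1 / r)"
      using ln_realpow[of "1 / r" "q - 1"] r q by (simp add: of_nat_diff)
    ultimately show ?thesis by simp
  qed (use S1 in simp)
  then show ?thesis using l by (simp add: field_simps)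
qed

lemma finite_multi_indices: "finite {\<alpha> :: 'n::finite \<Rightarrow> nat. multi_order \<alpha> = m}"
proof (rule finite_subset)
  show "{\<alpha> :: 'n \<Rightarrow> nat. multi_order \<alpha> = m} \<subseteq> PiE UNIV (\<lambda>_. {..m})"
    by (auto simp: multi_order_def intro: member_le_sum)
  show "finite (PiE (UNIV :: 'n set) (\<lambda>_. {..m}))" by (rule finite_PiE) auto
qed

lemma multi_index_count_pos: "multi_index_count TYPE('n::finite) 1 \<ge> 1"
proof -
  obtain j :: 'n where True by simp
  have "multi_order (\<lambda>i. if i = j then 1 else 0) = 1" by (simp add: multi_order_def)
  then have "{\<alpha> :: 'n \<Rightarrow> nat. multi_order \<alpha> = 1} \<noteq> {}" by blast
  then have "card {\<alpha> :: 'n \<Rightarrow> nat. multi_order \<alpha> = 1} > 0"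
    using finite_multi_indices[where 'n='n and m=1] by (simp add: card_gt_0_iff)
  then show ?thesis unfolding multi_index_count_def by simp
qed

lemma first_term_le_sum:
  fixes f :: "nat \<Rightarrow> real"
  assumes "1 \<le> N" "\<And>i. i \<in> {1..N} \<Longrightarrow> 0 \<le> f i" shows "f 1 \<le> sum f {1..N}"
  using assms by (intro member_le_sum) auto

text \<open>
  The term for \<open>i = 1\<close> is at least \<open>n! / s^n \<ge> 1 / s\<close>. The sum is empty only for \<open>p = 1\<close>; then \<open>q = 1\<close> and the logarithm
  takes its default value \<open>0\<close>.
\<close>

lemma least_power_le_normal_bound:
  fixes r s \<delta> :: real
  assumes r: "0 < r" "r < 1" and s: "0 < s" "s < 1" and "0 < \<delta>" and p: "p \<ge> 1" "q \<le> p"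
    and q: "q \<ge> 1" "q = 1 \<or> s \<le> r ^ (q - 1)"
  shows "real q \<le> normal_bound TYPE('n::finite) r s \<delta> p"
proof -
  let ?n = "CARD('n)"
  define Q where "Q m = real (multi_index_count TYPE('n) m)" for m
  define b where "b = fact ?n / s ^ ?n * (1 + r * (\<Sum>m = 2..p - 1. (real ?n)\<^sup>2 * (Q m)\<^sup>2 * (sqrt (real ?n) / min 1 \<delta>) ^ m)) ^ (?n - 1)"
  define N where "N = (p - 1) ^ ((?n - 1)\<^sup>2)"
  define S where "S = (\<Sum>i = 1..N. Q i * b ^ i)"
  have bound: "normal_bound TYPE('n) r s \<delta> p = ln S / ln (1 / r) + 1"
    by (simp add: normal_bound_def Let_def Q_def b_def N_def S_def)
  have n: "?n \<ge> 1" by (simp add: Suc_leI)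
  show ?thesis
  proof (cases "N = 0")
    case True
    then have "p = 1" using p by (simp add: N_def)
    then show ?thesis using True p q unfolding bound by (simp add: S_def)
  next
    case False
    have "1 \<le> (1 + r * (\<Sum>m = 2..p - 1. (real ?n)\<^sup>2 * (Q m)\<^sup>2 * (sqrt (real ?n) / min 1 \<delta>) ^ m)) ^ (?n - 1)"
      using r \<open>0 < \<delta>\<close> by (intro one_le_power) (auto intro!: mult_nonneg_nonneg sum_nonneg)
    moreover have "1 / s \<le> fact ?n / s ^ ?n"
    proof -
      have "s ^ ?n \<le> s ^ 1" using s n by (intro power_decreasing) auto
      then have "1 / s \<le> 1 / s ^ ?n" using s by (intro divide_left_mono) auto
      also have "\<dots> \<le> fact ?n / s ^ ?n" using s by (intro divide_right_mono) (auto simp: fact_ge_1)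
      finally show ?thesis .
    qed
    ultimately have b: "1 / s \<le> b" unfolding b_def
      using mult_mono[of "1/s" "fact ?n / s ^ ?n" 1] s by simp
    then have "0 \<le> b" using s by (meson divide_nonneg_nonneg less_imp_le order_trans zero_le_one)
    have "1 / s \<le> Q 1 * b ^ 1"
      using b \<open>0 \<le> b\<close> multi_index_count_pos[where 'n='n] mult_right_mono[of 1 "Q 1" b] by (simp add: Q_def)
    also have "\<dots> \<le> S" unfolding S_def
      by (rule first_term_le_sum) (use False \<open>0 \<le> b\<close> in \<open>auto simp: Q_def\<close>)
    finally show ?thesis unfolding bound by (rule least_power_le_log_quotient[OF r s q])
  qed
qed

lemma least_power_le_normal_bound_dim2:
  fixes r s \<delta> :: real
  assumes r: "0 < r" "r < 1" and s: "0 < s" "s < 1" and "0 < \<delta>" and p: "p \<ge> 1" "q \<le> p"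
    and q: "q \<ge> 1" "q = 1 \<or> s \<le> r ^ (q - 1)"
  shows "real q \<le> normal_bound_dim2 r s \<delta> p"
proof -
  define b where "b = 2 / s\<^sup>2 * (1 + 2 * r * real p * (sqrt 2 / min 1 \<delta>) ^ (p - 1))"
  define S where "S = (\<Sum>i = 1..p - 1. (real i + 1) * b ^ i)"
  have bound: "normal_bound_dim2 r s \<delta> p = ln S / ln (1 / r) + 1"
    by (simp add: normal_bound_dim2_def b_def S_def)
  show ?thesis
  proof (cases "p = 1")
    case True
    then show ?thesis using p q unfolding bound by (simp add: S_def)
  next
    case False
    have "s\<^sup>2 \<le> s" using s by (simp add: power2_eq_square)
    then have "1 / s \<le> 1 / s\<^sup>2" using s by (intro divide_left_mono) auto
    also have "\<dots> \<le> 2 / s\<^sup>2" using s by (intro divide_right_mono) auto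
    finally have "1 / s \<le> 2 / s\<^sup>2" .
    moreover have "1 \<le> 1 + 2 * r * real p * (sqrt 2 / min 1 \<delta>) ^ (p - 1)" using r \<open>0 < \<delta>\<close> by auto
    ultimately have "1 / s * 1 \<le> b" unfolding b_def by (rule mult_mono) (use s in auto)
    then have b: "1 / s \<le> b" by simp
    then have "0 \<le> b" using s by (meson divide_nonneg_nonneg less_imp_le order_trans zero_le_one)
    have "1 / s \<le> (real 1 + 1) * b ^ 1" using b \<open>0 \<le> b\<close> by simp
    also have "\<dots> \<le> S" unfolding S_def
      by (rule first_term_le_sum) (use False p \<open>0 \<le> b\<close> in auto)
    finally show ?thesis unfolding bound by (rule least_power_le_log_quotient[OF r s q])
  qed
qed

text \<open>The sum has less than \<open>p\<close> terms, each at most \<open>p\<close> times the \<open>p\<close>-th power of a base that grows exponentially in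
  \<open>p\<close>, so its logarithm grows quadratically.\<close>

lemma normal_bound_dim2_quadratic:
  fixes r s \<delta> :: real
  assumes r: "0 < r" "r < 1" and s: "0 < s" "s < 1" and "0 < \<delta>"
  shows "(\<lambda>p. normal_bound_dim2 r s \<delta> p) \<in> O(\<lambda>p. (real p)\<^sup>2)"
proof -
  define c where "c = sqrt 2 / min 1 \<delta>"
  define a where "a = 6 / s\<^sup>2"
  define D where "D = (2 + (ln a + 1 + ln c)) / ln (1 / r) + 1"
  have c: "1 \<le> c"
  proof -
    have "1 \<le> sqrt 2" by simp
    then have "min 1 \<delta> \<le> sqrt 2" by (rule order_trans[OF min.cobounded1])
    then show ?thesis using \<open>0 < \<delta>\<close> by (simp add: c_def min_def field_simps)
  qed
  have "s\<^sup>2 \<le> 1" using s by (simp add: power_le_one)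
  then have a: "1 \<le> a" using s by (simp add: a_def field_simps)
  have l: "ln (1 / r) > 0" using r by simp
  have "norm (normal_bound_dim2 r s \<delta> p) \<le> D * norm ((real p)\<^sup>2)" if p: "p \<ge> 2" for p
  proof -
    define b where "b = 2 / s\<^sup>2 * (1 + 2 * r * real p * c ^ (p - 1))"
    define S where "S = (\<Sum>i = 1..p - 1. (real i + 1) * b ^ i)"
    have bound: "normal_bound_dim2 r s \<delta> p = ln S / ln (1 / r) + 1"
      by (simp add: normal_bound_dim2_def b_def S_def c_def)
    have "1 \<le> 2 / s\<^sup>2" using \<open>s\<^sup>2 \<le> 1\<close> s by (simp add: field_simps)
    moreover have "1 \<le> 1 + 2 * r * real p * c ^ (p - 1)" using r c by simp
    ultimately have "1 * 1 \<le> b" unfolding b_def by (rule mult_mono) (use s in auto)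
    then have b1: "1 \<le> b" by simp
    have b_le: "b \<le> a * real p * c ^ p"
    proof -
      have cp: "c ^ (p - 1) \<le> c ^ p" using c by (intro power_increasing) auto
      have "1 \<le> c ^ p" using c by (rule one_le_power)
      then have "1 * 1 \<le> real p * c ^ p" using p by (intro mult_mono) auto
      moreover have "2 * r * real p * c ^ (p - 1) \<le> 2 * 1 * real p * c ^ p"
        using r c cp by (intro mult_mono) auto
      ultimately have "1 + 2 * r * real p * c ^ (p - 1) \<le> 3 * (real p * c ^ p)" by simp
      then have "b \<le> 2 / s\<^sup>2 * (3 * (real p * c ^ p))" unfolding b_def using s by (intro mult_left_mono) auto
      then show ?thesis by (simp add: a_def mult_ac)
    qed
    have lnp: "0 \<le> ln (real p)" "ln (real p) \<le> real p" using p ln_le_minus_one[of "real p"] by auto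
    have "ln b \<le> ln (a * real p * c ^ p)" using b1 b_le by (subst ln_le_cancel_iff) auto
    also have "\<dots> = ln a + ln (real p) + real p * ln c"
      using a c p by (simp add: ln_mult ln_realpow)
    also have "\<dots> \<le> real p * ln a + real p + real p * ln c"
      using lnp a p mult_right_mono[of 1 "real p" "ln a"] by simp
    finally have lnb: "ln b \<le> real p * (ln a + 1 + ln c)" by (simp add: algebra_simps)
    have S1: "1 \<le> S"
    proof -
      have "1 \<le> (real 1 + 1) * b ^ 1" using b1 by simp
      also have "\<dots> \<le> S" unfolding S_def by (rule first_term_le_sum) (use p b1 in auto)
      finally show ?thesis .
    qed
    have "S \<le> (\<Sum>i = 1..p - 1. real p * b ^ p)"
      unfolding S_def using b1 by (intro sum_mono mult_mono power_increasing) auto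
    also have "\<dots> = real (p - 1) * (real p * b ^ p)" by simp
    also have "\<dots> \<le> real p * (real p * b ^ p)" using b1 by (intro mult_right_mono) auto
    finally have "ln S \<le> ln (real p * (real p * b ^ p))" using S1 p by (subst ln_le_cancel_iff) auto
    also have "\<dots> = 2 * ln (real p) + real p * ln b"
      using p b1 by (simp add: ln_mult ln_realpow)
    also have "\<dots> \<le> 2 * real p + real p * (real p * (ln a + 1 + ln c))"
      using lnp lnb by (intro add_mono mult_left_mono) auto
    also have "\<dots> \<le> 2 * (real p)\<^sup>2 + (real p)\<^sup>2 * (ln a + 1 + ln c)"
      using p by (simp add: power2_eq_square)
    finally have "ln S \<le> (real p)\<^sup>2 * (2 + (ln a + 1 + ln c))" by (simp add: algebra_simps)
    then have "ln S / ln (1 / r) \<le> (real p)\<^sup>2 * (2 + (ln a + 1 + ln c)) / ln (1 / r)"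
      using l by (intro divide_right_mono) auto
    moreover have "1 \<le> (real p)\<^sup>2" using p by simp
    ultimately have "normal_bound_dim2 r s \<delta> p \<le> D * (real p)\<^sup>2"
      unfolding bound D_def by (simp add: algebra_simps)
    moreover have "0 \<le> normal_bound_dim2 r s \<delta> p" unfolding bound using S1 l by simp
    ultimately show ?thesis by simp
  qed
  then show ?thesis by (intro bigoI[of _ D] eventually_mono[OF eventually_ge_at_top[of 2]])
qed

theorem theorem1p5:
  fixes z0 :: "complex ^ 'n" and r s \<delta> :: real
  assumes "0 < r" "r < 1" "0 < s" "s < 1" "0 < \<delta>"
  shows "(\<forall>f1 :: complex ^ 'n \<Rightarrow> complex ^ 'n. holomorphic_automorphism f1 \<longrightarrow>
           (\<exists>q\<ge>1. \<forall>f. f 1 = f1 \<and> admissible_sequence z0 r s \<delta> q f \<longrightarrow>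
             biholomorphic (basin_of_attraction f z0) (UNIV :: (complex ^ 'n) set))) \<and>
         (\<forall>p\<ge>1. r ^ p < s \<longrightarrow>
           (\<exists>q\<ge>1. real q \<le> normal_bound TYPE('n) r s \<delta> p \<and>
             (\<forall>f. admissible_sequence z0 r s \<delta> q f \<and>
                  (\<forall>j\<ge>1. normal_matrix (complex_jacobian (f j) z0)) \<longrightarrow>
                biholomorphic (basin_of_attraction f z0) (UNIV :: (complex ^ 'n) set))) \<and>
           (CARD('n) = 2 \<longrightarrow>
             (\<exists>q\<ge>1. real q \<le> normal_bound_dim2 r s \<delta> p \<and>
               (\<forall>f. admissible_sequence z0 r s \<delta> q f \<and>
                    (\<forall>j\<ge>1. normal_matrix (complex_jacobian (f j) z0)) \<longrightarrow>
                  biholomorphic (basin_of_attraction f z0) (UNIV :: (complex ^ 'n) set))))) \<and>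
         (\<lambda>p. normal_bound_dim2 r s \<delta> p) \<in> O(\<lambda>p. (real p)\<^sup>2)"
proof -
  obtain q where q: "q \<ge> 1" "r ^ q < s" "q = 1 \<or> s \<le> r ^ (q - 1)" and least: "\<And>p. p \<ge> 1 \<Longrightarrow> r ^ p < s \<Longrightarrow> q \<le> p"
    using least_power_below[OF assms(1-3)] by metis
  have basin: "biholomorphic (basin_of_attraction f z0) (UNIV :: (complex ^ 'n) set)"
    if "admissible_sequence z0 r s \<delta> q f" for f
    by (rule biholomorphic_basin_of_attraction[OF assms q(1,2) that])
  have "real q \<le> normal_bound TYPE('n) r s \<delta> p" "real q \<le> normal_bound_dim2 r s \<delta> p"
    if "p \<ge> 1" "r ^ p < s" for p
    using least_power_le_normal_bound[OF assms that(1) least[OF that] q(1,3), where 'n='n]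
      least_power_le_normal_bound_dim2[OF assms that(1) least[OF that] q(1,3)] by simp_all
  then show ?thesis
    using q(1) basin normal_bound_dim2_quadratic[OF assms] by blast
qed

end
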